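(* Let $\lambda\in(0,2)$ and let $q\in\mathbb{N}$, $q>1$. There exists a semi-infinite Jacobi matrix $J$ with coefficients $a_n\equiv1$, $b_n\in\mathbb{R}$ ($n\ge1$) such that $\sup_n|b_n|<\infty$, $$\sum_{n=1}^\infty|b_{n+q}-b_n|^2<\infty,$$ the set of right limits of $J$ is $\mathcal{R}=\{J(1,\beta)\mid\beta\in[-\lambda,\lambda]\}$, and $$\bigcap_{J^{(r)}\in\mathcal{R}} q\text{-int}(\sigma(J^{(r)}))\neq\Sigma_{\mathrm{ac}}(J)=\bigcap_{J^{(r)}\in\mathcal{R}}\sigma(J^{(r)}),$$ where equality and non-equality are understood modulo sets of Lebesgue measure zero.
   Context: The semi-infinite Jacobi matrix $J$ with coefficients $a_n>0$, $b_n\in\mathbb{R}$ is the tridiagonal matrix with diagonal entries $b_1,b_2,\dots$ and off-diagonal entries $a_1,a_2,\dots$, acting on $\ell^2(\mathbb{N})$, $\mathbb{N}=\{1,2,\dots\}$. Its canonical spectral measure $\mu$ is the spectral measure of $\delta_1$: $\int x^n\,d\mu(x)=\langle\delta_1,J^n\delta_1\rangle$, $n\ge0$. Write the Lebesgue decomposition $d\mu=f(x)\,dx+d\mu_{\mathrm{s}}$; the essential support of the a.c. spectrum is $\Sigma_{\mathrm{ac}}(J)=\{x\in\mathbb{R}\mid f(x)>0\}$, viewed as an equivalence class modulo sets of Lebesgue measure zero. A two-sided Jacobi matrix $J^{(r)}$ on $\ell^2(\mathbb{Z})$ with coefficients $a^{(r)}_n>0$, $b^{(r)}_n\in\mathbb{R}$,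 $n\in\mathbb{Z}$, is a right limit of $J$ if there is a sequence of integers $n_j\to+\infty$ with $\lim_j a_{n+n_j}=a_n^{(r)}$ and $\lim_j b_{n+n_j}=b_n^{(r)}$ for all $n\in\mathbb{Z}$. $J(1,\beta)$ denotes the two-sided Jacobi matrix with constant coefficients $a_n\equiv1$, $b_n\equiv\beta$, $n\in\mathbb{Z}$. For a two-sided $q$-periodic Jacobi matrix $J^{(r)}$, its $q$-discriminant is $\Delta^{(r)}(z)=\operatorname{tr}\big(A(a_q^{(r)},b_q^{(r)};z)\cdots A(a_1^{(r)},b_1^{(r)};z)\big)$ where $A(a,b;z)=\begin{pmatrix}\frac{z-b}{a}&-\frac1a\\ a&0\end{pmatrix}$, one has $\sigma(J^{(r)})=\{x\in\mathbb{R}\mid\Delta^{(r)}(x)\in[-2,2]\}$, and $q\text{-int}(\sigma(J^{(r)}))=\{x\in\mathbb{R}\mid\Delta^{(r)}(x)\in(-2,2)\}$. In the present situation, $\bigcap_{\mathcal{R}}\sigma(J^{(r)})=[-2+\lambda,2-\lambda]$ and $\bigcap_{\mathcal{R}}q\text{-int}(\sigma(J^{(r)}))=(-2+\lambda,2-\lambda)\setminus\bigcup_{j=1}^{q-1}[z_j-\lambda,z_j+\lambda]$ with $z_j=2\cos\big(\frac{(q-j)\pi}{q}\big)$. *)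

theory Defs
  imports "HOL-Analysis.Analysis"
begin

text \<open>
  Coefficients and vectors of a semi-infinite Jacobi matrix are functions on \<^typ>\<open>nat\<close> of which
  only the values at the indices \<open>1, 2, \<dots>\<close> matter; the index \<open>0\<close> is unused.
\<close>

definition half_jacobi :: "(nat \<Rightarrow> real) \<Rightarrow> (nat \<Rightarrow> real) \<Rightarrow> (nat \<Rightarrow> real) \<Rightarrow> nat \<Rightarrow> real" where
  "half_jacobi a b u n =
     (if n = 0 then 0
      else (if n = 1 then 0 else a (n - 1) * u (n - 1)) + b n * u n + a n * u (n + 1))"

definition half_inner :: "(nat \<Rightarrow> real) \<Rightarrow> (nat \<Rightarrow> real) \<Rightarrow> real" where
  "half_inner u v = (\<Sum>\<^sub>\<infinity>n\<in>{1..}. u n * v n)"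

definition delta_one :: "nat \<Rightarrow> real" where
  "delta_one n = (if n = 1 then 1 else 0)"

text \<open>
  For bounded coefficients the moments determine the measure uniquely. Integrability is demanded
  explicitly because the Bochner integral of a non-integrable function is \<open>0\<close>; for \<open>n = 0\<close> it makes
  the measure finite.
\<close>

definition is_spectral_measure :: "(nat \<Rightarrow> real) \<Rightarrow> (nat \<Rightarrow> real) \<Rightarrow> real measure \<Rightarrow> bool" where
  "is_spectral_measure a b \<mu> \<longleftrightarrow>
     sets \<mu> = sets borel \<and>
     (\<forall>n. integrable \<mu> (\<lambda>x. x ^ n) \<and>
          integral\<^sup>L \<mu> (\<lambda>x. x ^ n) = half_inner delta_one ((half_jacobi a b ^^ n) delta_one))"

definition is_lebesgue_decomposition :: "real measure \<Rightarrow> (real \<Rightarrow> real) \<Rightarrow> real measure \<Rightarrow> bool" where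
  "is_lebesgue_decomposition \<mu> f \<mu>s \<longleftrightarrow>
     f \<in> borel_measurable borel \<and> (\<forall>x. 0 \<le> f x) \<and>
     sets \<mu>s = sets borel \<and> (\<exists>N \<in> null_sets lborel. emeasure \<mu>s (UNIV - N) = 0) \<and>
     (\<forall>A \<in> sets borel.
        emeasure \<mu> A = emeasure (density lborel (\<lambda>x. ennreal (f x))) A + emeasure \<mu>s A)"

definition eq_mod_null :: "real set \<Rightarrow> real set \<Rightarrow> bool" where
  "eq_mod_null S T \<longleftrightarrow> (S - T) \<union> (T - S) \<in> null_sets lebesgue"

text \<open>
  \<open>is_Sigma_ac a b S\<close>: the set \<open>S\<close> is a representative of the essential support of the a.c.
  spectrum, which is a set only modulo null sets, since the density is determined only almost
  everywhere.
\<close>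

definition is_Sigma_ac :: "(nat \<Rightarrow> real) \<Rightarrow> (nat \<Rightarrow> real) \<Rightarrow> real set \<Rightarrow> bool" where
  "is_Sigma_ac a b S \<longleftrightarrow>
     (\<exists>\<mu> f \<mu>s. is_spectral_measure a b \<mu> \<and> is_lebesgue_decomposition \<mu> f \<mu>s \<and> S = {x. f x > 0})"

text \<open>A two-sided Jacobi matrix is given by its coefficients \<open>(a, b)\<close>.\<close>

type_synonym jacobi = "(int \<Rightarrow> real) \<times> (int \<Rightarrow> real)"

definition const_jacobi :: "real \<Rightarrow> real \<Rightarrow> jacobi" where
  "const_jacobi \<alpha> \<beta> = ((\<lambda>_. \<alpha>), (\<lambda>_. \<beta>))"

text \<open>The truncation in \<^const>\<open>nat\<close> is harmless: it affects only finitely many \<open>j\<close> for each \<open>n\<close>.\<close>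

definition right_limits :: "(nat \<Rightarrow> real) \<Rightarrow> (nat \<Rightarrow> real) \<Rightarrow> jacobi set" where
  "right_limits a b =
     {(ar, br). (\<forall>n. ar n > 0) \<and>
        (\<exists>s :: nat \<Rightarrow> int. filterlim s at_top sequentially \<and>
           (\<forall>n. (\<lambda>j. a (nat (n + s j))) \<longlonglongrightarrow> ar n \<and> (\<lambda>j. b (nat (n + s j))) \<longlonglongrightarrow> br n))}"

fun jacobi_op :: "jacobi \<Rightarrow> (int \<Rightarrow> complex) \<Rightarrow> int \<Rightarrow> complex" where
  "jacobi_op (a, b) u n =
     of_real (a (n - 1)) * u (n - 1) + of_real (b n) * u n + of_real (a n) * u (n + 1)"

definition ell2 :: "(int \<Rightarrow> complex) set" where
  "ell2 = {u. (\<lambda>n. (cmod (u n))\<^sup>2) summable_on UNIV}"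

definition ell2_norm :: "(int \<Rightarrow> complex) \<Rightarrow> real" where
  "ell2_norm u = sqrt (\<Sum>\<^sub>\<infinity>n. (cmod (u n))\<^sup>2)"

text \<open>
  The coefficients are meant to be bounded, so that the operator is defined on all of \<open>\<ell>\<^sup>2(\<int>)\<close>.
  The second condition says that the inverse of \<open>J - z\<close> is bounded.
\<close>

definition resolvent_set :: "jacobi \<Rightarrow> complex set" where
  "resolvent_set J =
     {z. bij_betw (\<lambda>u n. jacobi_op J u n - z * u n) ell2 ell2 \<and>
         (\<exists>C. \<forall>u\<in>ell2. ell2_norm u \<le> C * ell2_norm (\<lambda>n. jacobi_op J u n - z * u n))}"

text \<open>
  The spectrum of a (self-adjoint) Jacobi operator lies on the real line and is regarded as a
  set of real numbers.
\<close>

definition spectrum :: "jacobi \<Rightarrow> real set" where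
  "spectrum J = {x. complex_of_real x \<notin> resolvent_set J}"

definition transfer :: "real \<Rightarrow> real \<Rightarrow> real \<Rightarrow> real^2^2" where
  "transfer a b x = vector [vector [(x - b) / a, - 1 / a], vector [a, 0]]"

fun transfer_prod :: "nat \<Rightarrow> jacobi \<Rightarrow> real \<Rightarrow> real^2^2" where
  "transfer_prod 0 J x = mat 1"
| "transfer_prod (Suc k) J x =
     transfer (fst J (int (Suc k))) (snd J (int (Suc k))) x ** transfer_prod k J x"

text \<open>Discriminant and \<open>q\<close>-interior are meant for \<open>q\<close>-periodic \<open>J\<close>, with \<open>q \<ge> 1\<close>.\<close>

definition discriminant :: "nat \<Rightarrow> jacobi \<Rightarrow> real \<Rightarrow> real" where
  "discriminant q J x = trace (transfer_prod q J x)"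

definition q_int_spectrum :: "nat \<Rightarrow> jacobi \<Rightarrow> real set" where
  "q_int_spectrum q J = {x. discriminant q J x \<in> {-2<..<2}}"

end

theory Submission
  imports Defs "HOL-Probability.Helly_Selection"
    "HOL-Computational_Algebra.Fundamental_Theorem_Algebra" "HOL-Real_Asymp.Real_Asymp"
begin

text \<open>
  The potential is constant, equal to \<open>\<beta>\<^sub>k\<close>, on a block of length \<open>L\<^sub>k\<close>, where \<open>\<beta>\<^sub>k\<close> sweeps the interval
  \<open>[-\<lambda>, \<lambda>]\<close> with steps \<open>\<delta>\<^sub>k\<close> that are square summable relative to the distance of \<open>\<beta>\<^sub>k\<close> to
  \<open>\<plusminus>\<lambda>\<close>. The lengths are chosen inductively and very large.

  Outside \<open>[-2 + \<lambda>, 2 - \<lambda>]\<close> infinitely many blocks are hyperbolic, and there the orthonormal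
  polynomials \<open>p\<^sub>n\<close> become large off sets of summable Lebesgue measure, whereas \<open>\<integral> p\<^sub>n\<^sup>2 d\<mu> = 1\<close>; so
  \<open>\<mu>\<close> is singular there.

  On \<open>K = [-2 + \<lambda>, 2 - \<lambda>]\<close> let \<open>y = x - \<beta>\<^sub>k\<close> and let \<open>V\<^sub>k\<close> be the integral over \<open>K\<close> of the form
  \<open>p\<^sub>n\<^sub>+\<^sub>1\<^sup>2 - y p\<^sub>n p\<^sub>n\<^sub>+\<^sub>1 + p\<^sub>n\<^sup>2\<close>, which is constant along the block, divided by
  \<open>sqrt (4 - y\<^sup>2)\<close>. On changing \<open>\<beta>\<close> the oscillating part of the first-order term averages out along a
  long block and its mean is compensated by the weight, so \<open>V\<^sub>k\<close> grows only by a factor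
  \<open>1 + O(\<delta>\<^sub>k\<^sup>2)\<close> and stays bounded. By the Christoffel--Darboux formula and an inequality of Hilbert type,
  \<open>\<Sum>\<^sub>n (\<integral>\<^sub>K p\<^sub>n dx)\<^sup>2\<close> is controlled by \<open>V\<^sub>k\<close> (over compact subintervals), whence
  \<open>(\<integral>\<^sub>K P dx)\<^sup>2 \<le> C \<integral> P\<^sup>2 d\<mu>\<close> for all polynomials \<open>P\<close>, and \<open>\<mu>\<close> has positive density
  almost everywhere on \<open>K\<close>.

  At \<open>x = \<beta> + 2 cos (\<pi> / q)\<close> the \<open>q\<close>-discriminant of \<open>J(1, \<beta>)\<close> is \<open>-2\<close>, so an interval of such \<open>x\<close>
  is missing from the intersection of the \<open>q\<close>-interiors.
\<close>

section \<open>Orthonormal polynomials of a Jacobi matrix\<close>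

text \<open>As \<beta> comes near both \<lambda> and -\<lambda> infinitely often, the steps
  \<delta>_k cannot be absolutely summable. No estimate may therefore lose a factor 1 +
  O(|\<delta>_k|); the long blocks and the weight exist to remove the first-order term. What remains
  has relative size (\<delta>_k / \<epsilon>_k)^2, where |x - \<beta>_k| \<le> 2 - \<epsilon>_k for
  all x in K: the form degenerates near an end of K when \<beta>_k approaches \<lambda> or
  -\<lambda>. Hence \<beta>_k stays strictly inside the interval and its step is measured against
  \<epsilon>_k. The energy bounds p_n^2 only on average over K, not pointwise in x, and only at the
  block ends. This suffices: the final inequality says that P |-> \<integral>_K P dx is a bounded
  functional for the norm of L^2(\<mu>), so that Lebesgue measure on K is absolutely continuous with
  respect to \<mu>. The part of K where f vanishes, minus a Lebesgue null set carrying the singular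
  part, is \<mu>-null and hence Lebesgue null.\<close>

text \<open>Since indices start at \<open>1\<close>, \<open>p\<^sub>n\<close> has degree \<open>n - 1\<close>; \<open>p\<^sub>0 = 0\<close> is the boundary condition.\<close>

fun jacobi_poly :: "(nat \<Rightarrow> 'a::comm_ring_1) \<Rightarrow> nat \<Rightarrow> 'a poly" where
  "jacobi_poly b 0 = 0"
| "jacobi_poly b (Suc 0) = 1"
| "jacobi_poly b (Suc (Suc n)) = [:- b (Suc n), 1:] * jacobi_poly b (Suc n) - jacobi_poly b n"

lemma poly_jacobi_poly_Suc:
  "n \<ge> 1 \<Longrightarrow> poly (jacobi_poly b (Suc n)) x
     = (x - b n) * poly (jacobi_poly b n) x - poly (jacobi_poly b (n - 1)) x"
  by (cases n) (auto simp: algebra_simps)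

lemma degree_coeff_jacobi_poly:
  fixes b :: "nat \<Rightarrow> 'a::idom"
  shows
  "degree (jacobi_poly b n) \<le> n - 1 \<and> (n \<ge> 1 \<longrightarrow> coeff (jacobi_poly b n) (n - 1) = 1)"
proof (induction b n rule: jacobi_poly.induct)
  case (3 b n)
  have d: "degree (jacobi_poly b (Suc n)) \<le> n" "degree (jacobi_poly b n) \<le> n - 1"
    using 3 by auto
  have "degree ([:- b (Suc n), 1:] * jacobi_poly b (Suc n)) \<le> Suc n"
    by (rule order_trans[OF degree_mult_le]) (use d in simp)
  moreover have "coeff (jacobi_poly b (Suc n)) (Suc n) = 0" "coeff (jacobi_poly b n) (Suc n) = 0"
    using d by (auto intro!: coeff_eq_0)
  ultimately show ?case
    using d 3 by (auto intro!: degree_diff_le)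
qed auto

lemma degree_jacobi_poly_le: "degree (jacobi_poly b n :: 'a::idom poly) \<le> n - 1"
  and coeff_jacobi_poly_top: "n \<ge> 1 \<Longrightarrow> coeff (jacobi_poly b n :: 'a poly) (n - 1) = 1"
  using degree_coeff_jacobi_poly by blast+

lemma jacobi_poly_nonzero: "n \<ge> 1 \<Longrightarrow> jacobi_poly b n \<noteq> (0 :: 'a::idom poly)"
  using coeff_jacobi_poly_top[of n b] by auto

lemma christoffel_darboux:
  fixes x y :: "'a::comm_ring_1"
  shows
  "(x - y) * (\<Sum>n=1..N. poly (jacobi_poly b n) x * poly (jacobi_poly b n) y)
    = poly (jacobi_poly b (Suc N)) x * poly (jacobi_poly b N) y
      - poly (jacobi_poly b N) x * poly (jacobi_poly b (Suc N)) y"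
proof (induction N)
  case (Suc N)
  then show ?case by (simp add: algebra_simps)
qed auto

lemma christoffel_darboux_confluent:
  fixes b :: "nat \<Rightarrow> 'a::idom"
  shows "pderiv (jacobi_poly b (Suc N)) * jacobi_poly b N - pderiv (jacobi_poly b N) * jacobi_poly b (Suc N)
    = (\<Sum>n=1..N. jacobi_poly b n ^ 2)"
proof (induction N)
  case (Suc N)
  then show ?case
    by (simp add: pderiv_diff pderiv_mult pderiv_pCons pderiv_add pderiv_smult algebra_simps power2_eq_square)
qed auto

lemma jacobi_poly_span:
  fixes P :: "'a::idom poly"
  assumes "degree P < N"
  shows "\<exists>c. P = (\<Sum>n=1..N. smult (c n) (jacobi_poly b n))"
  using assms
proof (induction N arbitrary: P)
  case (Suc N)
  define R where "R = P - smult (coeff P N) (jacobi_poly b (Suc N))"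
  have R: "degree R \<le> N" "coeff R N = 0"
    using Suc.prems degree_jacobi_poly_le[of b "Suc N"] coeff_jacobi_poly_top[of "Suc N" b]
    by (auto simp: R_def intro!: degree_diff_le order_trans[OF degree_smult_le])
  obtain c where c: "R = (\<Sum>n=1..N. smult (c n) (jacobi_poly b n))"
  proof (cases "N = 0")
    case True
    then have "R = 0" using R by (auto intro: leading_coeff_0_iff[THEN iffD1])
    then show ?thesis by (intro that[of "\<lambda>_. 0"]) simp
  next
    case False
    have "degree R \<noteq> N"
      using R(2) False leading_coeff_0_iff[of R] degree_0 by metis
    then have "degree R < N" using R(1) by linarith
    then show ?thesis using Suc.IH that by blast
  qed
  have "(\<Sum>n=1..N. smult ((c(Suc N := coeff P N)) n) (jacobi_poly b n)) = R"
    unfolding c by (rule sum.cong) auto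
  then have "P = (\<Sum>n=1..Suc N. smult ((c(Suc N := coeff P N)) n) (jacobi_poly b n))"
    by (simp add: R_def)
  then show ?case by blast
qed auto

lemma jacobi_poly_independent:
  fixes b :: "nat \<Rightarrow> 'a::idom"
  assumes "(\<Sum>n=1..N. smult (c n) (jacobi_poly b n)) = 0" "n \<in> {1..N}"
  shows "c n = 0"
  using assms
proof (induction N)
  case (Suc N)
  have "degree (\<Sum>n=1..N. smult (c n) (jacobi_poly b n)) \<le> N - 1"
    by (intro degree_sum_le) (auto intro!: order_trans[OF degree_smult_le] order_trans[OF degree_jacobi_poly_le])
  then have "coeff (\<Sum>n=1..N. smult (c n) (jacobi_poly b n)) N = 0"
    by (cases "N = 0") (auto intro!: coeff_eq_0)
  then have "c (Suc N) = 0"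
    using arg_cong[OF Suc.prems(1), of "\<lambda>p. coeff p N"] coeff_jacobi_poly_top[of "Suc N" b] by simp
  then show ?case
    using Suc by (cases "n = Suc N") auto
qed auto

text \<open>Both sides are \<open>\<langle>\<delta>\<^sub>x, J\<^sup>m \<delta>\<^sub>1\<rangle>\<close> for the formal eigenvector \<open>\<delta>\<^sub>x = (p\<^sub>n(x))\<^sub>n\<close>.\<close>

lemma jacobi_power_expansion:
  fixes a b :: "nat \<Rightarrow> real"
  assumes "\<forall>n\<ge>1. a n = 1"
  defines "w \<equiv> \<lambda>m. (half_jacobi a b ^^ m) delta_one"
  shows "(\<forall>n. n > Suc m \<or> n = 0 \<longrightarrow> w m n = 0)
    \<and> monom 1 m = (\<Sum>n=1..Suc m. smult (w m n) (jacobi_poly b n))"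
proof (induction m)
  case 0
  then show ?case by (auto simp: w_def delta_one_def)
next
  case (Suc m)
  have z: "w m n = 0" if "n > Suc m \<or> n = 0" for n using Suc that by blast
  have ws: "w (Suc m) n = (if n = 0 then 0 else w m (n - 1) + b n * w m n + w m (n + 1))" for n
    using assms z[of 0] by (auto simp: w_def half_jacobi_def)
  have jp: "[:0, 1:] * jacobi_poly b (Suc n) = jacobi_poly b (Suc (Suc n))
      + smult (b (Suc n)) (jacobi_poly b (Suc n)) + jacobi_poly b n" for n
    by simp
  have "monom 1 (Suc m) = [:0, 1:] * (\<Sum>n=1..Suc m. smult (w m n) (jacobi_poly b n))"
    using Suc by (simp add: monom_Suc flip: monom_0)
  also have "\<dots> = (\<Sum>n=0..m. smult (w m (Suc n)) ([:0, 1:] * jacobi_poly b (Suc n)))"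
    unfolding sum_distrib_left
    by (rule sum.reindex_bij_witness[of _ Suc "\<lambda>n. n - 1"]) auto
  also have "\<dots> = (\<Sum>n\<le>m. smult (w m (Suc n)) (jacobi_poly b (Suc (Suc n))))
      + (\<Sum>n\<le>m. smult (b (Suc n) * w m (Suc n)) (jacobi_poly b (Suc n)))
      + (\<Sum>n\<le>m. smult (w m (Suc n)) (jacobi_poly b n))"
    unfolding jp smult_add_right sum.distrib smult_smult atLeast0AtMost by (simp add: mult.commute)
  also have "(\<Sum>n\<le>m. smult (w m (Suc n)) (jacobi_poly b (Suc (Suc n))))
      = (\<Sum>n=1..Suc (Suc m). smult (w m (n - 1)) (jacobi_poly b n))"
  proof -
    have "(\<Sum>n=1..Suc (Suc m). smult (w m (n - 1)) (jacobi_poly b n))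
      = (\<Sum>n=2..Suc (Suc m). smult (w m (n - 1)) (jacobi_poly b n))"
      by (rule sum.mono_neutral_right) (auto simp: z)
    also have "\<dots> = (\<Sum>n\<le>m. smult (w m (Suc n)) (jacobi_poly b (Suc (Suc n))))"
      by (rule sum.reindex_bij_witness[of _ "\<lambda>n. Suc (Suc n)" "\<lambda>n. n - 2"])
        (auto simp: numeral_2_eq_2 Suc_diff_Suc)
    finally show ?thesis by simp
  qed
  also have "(\<Sum>n\<le>m. smult (b (Suc n) * w m (Suc n)) (jacobi_poly b (Suc n)))
      = (\<Sum>n=1..Suc (Suc m). smult (b n * w m n) (jacobi_poly b n))"
  proof -
    have "(\<Sum>n=1..Suc (Suc m). smult (b n * w m n) (jacobi_poly b n))
      = (\<Sum>n=1..Suc m. smult (b n * w m n) (jacobi_poly b n))"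
      by (rule sum.mono_neutral_right) (auto simp: z)
    also have "\<dots> = (\<Sum>n\<le>m. smult (b (Suc n) * w m (Suc n)) (jacobi_poly b (Suc n)))"
      by (rule sum.reindex_bij_witness[of _ "Suc" "\<lambda>n. n - 1"]) auto
    finally show ?thesis by simp
  qed
  also have "(\<Sum>n\<le>m. smult (w m (Suc n)) (jacobi_poly b n))
      = (\<Sum>n=1..Suc (Suc m). smult (w m (n + 1)) (jacobi_poly b n))"
  proof -
    have "(\<Sum>n=1..Suc (Suc m). smult (w m (n + 1)) (jacobi_poly b n))
      = (\<Sum>n=1..m. smult (w m (n + 1)) (jacobi_poly b n))"
      by (rule sum.mono_neutral_right) (auto simp: z)
    also have "\<dots> = (\<Sum>n\<le>m. smult (w m (Suc n)) (jacobi_poly b n))"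
      by (rule sum.mono_neutral_cong_left) (auto simp: Suc_le_eq)
    finally show ?thesis by simp
  qed
  also have "(\<Sum>n=1..Suc (Suc m). smult (w m (n - 1)) (jacobi_poly b n))
     + (\<Sum>n=1..Suc (Suc m). smult (b n * w m n) (jacobi_poly b n))
     + (\<Sum>n=1..Suc (Suc m). smult (w m (n + 1)) (jacobi_poly b n))
     = (\<Sum>n=1..Suc (Suc m). smult (w (Suc m) n) (jacobi_poly b n))"
    unfolding sum.distrib[symmetric] by (rule sum.cong) (auto simp: ws smult_add_left)
  finally show ?case using z ws by auto
qed

text \<open>A bilinear form \<open>A m n = \<integral> p\<^sub>m p\<^sub>n d\<mu>\<close> is determined by its first row, because multiplication
  by \<open>x\<close> is symmetric.\<close>

lemma jacobi_form_orthonormal: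
  fixes A :: "nat \<Rightarrow> nat \<Rightarrow> real"
  assumes row0: "\<And>n. A 0 n = 0" "\<And>n. A n 0 = 0"
    and row1: "\<And>n. A 1 n = (if n = 1 then 1 else 0)"
    and sym: "\<And>m n. m \<ge> 1 \<Longrightarrow> n \<ge> 1 \<Longrightarrow>
      A (Suc m) n + b m * A m n + A (m - 1) n = A m (Suc n) + b n * A m n + A m (n - 1)"
  shows "A m n = (if m = n \<and> n \<ge> 1 then 1 else 0)"
proof (induction m arbitrary: n rule: less_induct)
  case (less m)
  consider "m = 0" | "m = 1" | k where "m = Suc (Suc k)" by (metis One_nat_def not0_implies_Suc)
  then show ?case
  proof cases
    case 3
    show ?thesis
    proof (cases "n = 0")
      case False
      have "A (Suc (Suc k)) n = A (Suc k) (Suc n) + A (Suc k) (n - 1) + (b n - b (Suc k)) * A (Suc k) n - A k n"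
        using sym[of "Suc k" n] False by (simp add: algebra_simps)
      then show ?thesis using less[of "Suc k"] less[of k] 3 False by auto
    qed (use row0 in auto)
  qed (use row0 row1 in auto)
qed

section \<open>Gauss quadrature and existence of the spectral measure\<close>

lemma poly_borel_measurable [measurable]: "poly (p :: real poly) \<in> borel_measurable borel"
  by (intro borel_measurable_continuous_onI continuous_intros)


text \<open>A zero x of p_{N+1} is an eigenvalue of the truncated N by N matrix with eigenvector
  p_1(x), ..., p_N(x). As in Gershgorin's theorem, the recurrence is read at an index where the
  eigenvector is largest; both neighbours are no larger, the ones beyond the ends being 0.\<close>

lemma jacobi_poly_root_bound:
  fixes x :: real
  assumes B: "\<And>n. n \<ge> 1 \<Longrightarrow> \<bar>b n\<bar> \<le> B" and N: "N \<ge> 1"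
    and root: "poly (jacobi_poly b (Suc N)) x = 0"
  shows "\<bar>x\<bar> \<le> 2 + B"
proof -
  define f where "f = (\<lambda>n. \<bar>poly (jacobi_poly b n) x\<bar>)"
  have "Max (f ` {1..N}) \<in> f ` {1..N}" using N by (intro Max_in) auto
  then obtain n where n: "n \<in> {1..N}" "Max (f ` {1..N}) = f n" by auto
  have n2: "f m \<le> f n" if "m \<in> {1..N}" for m
    unfolding n(2)[symmetric] by (rule Max_ge) (use that in auto)
  have le: "f m \<le> f n" if "m \<le> Suc N" for m
  proof -
    consider "m = 0" | "m = Suc N" | "m \<in> {1..N}" using \<open>m \<le> Suc N\<close> by fastforce
    then show ?thesis using n2 root by cases (auto simp: f_def)
  qed
  have pos: "f n > 0"
    using le[of 1] by (simp add: f_def)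
  have "\<bar>(x - b n) * poly (jacobi_poly b n) x\<bar>
      = \<bar>poly (jacobi_poly b (Suc n)) x + poly (jacobi_poly b (n - 1)) x\<bar>"
    using n poly_jacobi_poly_Suc[of n b x] by simp
  also have "\<dots> \<le> f (Suc n) + f (n - 1)" by (simp add: f_def)
  also have "\<dots> \<le> 2 * f n" using add_mono[OF le[of "Suc n"] le[of "n - 1"]] n(1) by fastforce
  finally have "\<bar>x - b n\<bar> * f n \<le> 2 * f n" by (simp add: f_def abs_mult)
  then have "\<bar>x - b n\<bar> \<le> 2" using pos by simp
  then show ?thesis using B[of n] n by auto
qed

text \<open>Nonreal zeros are excluded by the Christoffel--Darboux formula at \<open>(z, cnj z)\<close>, multiple
  zeros by its confluent form.\<close>

lemma card_jacobi_poly_roots: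
  fixes b :: "nat \<Rightarrow> real"
  assumes N: "N \<ge> 1"
  shows "card {x. poly (jacobi_poly b (Suc N)) x = 0} = N"
proof -
  define bc where "bc = (\<lambda>n. complex_of_real (b n))"
  define p where "p = jacobi_poly bc (Suc N)"
  have of_real: "poly (jacobi_poly bc n) (of_real x) = of_real (poly (jacobi_poly b n) x)" for n x
    by (induction n rule: induct_nat_012) (auto simp: bc_def)
  have cnj: "poly (jacobi_poly bc n) (cnj z) = cnj (poly (jacobi_poly bc n) z)" for n z
    by (induction n rule: induct_nat_012) (auto simp: bc_def)
  have real: "z = of_real (Re z)" if "poly p z = 0" for z
  proof -
    have "(z - cnj z) * (\<Sum>n=1..N. poly (jacobi_poly bc n) z * poly (jacobi_poly bc n) (cnj z)) = 0"
      unfolding christoffel_darboux using that by (simp add: p_def cnj)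
    moreover have "(\<Sum>n=1..N. poly (jacobi_poly bc n) z * poly (jacobi_poly bc n) (cnj z))
       = of_real (\<Sum>n=1..N. cmod (poly (jacobi_poly bc n) z) ^ 2)"
      unfolding cnj by (simp add: complex_norm_square del: of_real_power flip: of_real_power)
    moreover have "(\<Sum>n=1..N. cmod (poly (jacobi_poly bc n) z) ^ 2) \<ge> cmod (poly (jacobi_poly bc 1) z) ^ 2"
      by (rule member_le_sum) (use N in auto)
    then have "(\<Sum>n=1..N. cmod (poly (jacobi_poly bc n) z) ^ 2) \<noteq> 0" by auto
    ultimately have "z = cnj z" by (simp only: mult_eq_0_iff of_real_eq_0_iff) simp
    then show ?thesis by (simp add: complex_eq_iff)
  qed
  have "poly (pderiv p) z \<noteq> 0" if pz: "poly p z = 0" for z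
  proof
    assume "poly (pderiv p) z = 0"
    obtain x where x: "z = of_real x" using real[OF pz] by blast
    have "poly (\<Sum>n=1..N. jacobi_poly bc n ^ 2) z = 0"
      unfolding christoffel_darboux_confluent[symmetric] using that \<open>poly (pderiv p) z = 0\<close>
      by (simp add: p_def)
    then have "of_real (\<Sum>n=1..N. poly (jacobi_poly b n) x ^ 2) = (0::complex)"
      by (simp add: poly_sum poly_power x of_real)
    then have "(\<Sum>n=1..N. poly (jacobi_poly b n) x ^ 2) = 0" by (simp only: of_real_eq_0_iff)
    moreover have "(\<Sum>n=1..N. poly (jacobi_poly b n) x ^ 2) \<ge> poly (jacobi_poly b 1) x ^ 2"
      by (rule member_le_sum) (use N in auto)
    ultimately show False by auto
  qed
  then have sf: "rsquarefree p" unfolding rsquarefree_roots by blast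
  have p0: "p \<noteq> 0" unfolding p_def by (rule jacobi_poly_nonzero) simp
  have "degree p = N"
    using degree_jacobi_poly_le[of bc "Suc N"] coeff_jacobi_poly_top[of "Suc N" bc]
    by (auto simp: p_def intro!: antisym le_degree)
  moreover have "degree p = card {z. poly p z = 0}"
    using arg_cong[OF complex_poly_decompose_rsquarefree[OF sf], of degree] p0
    by (simp add: degree_prod_sum_eq)
  moreover have "{z. poly p z = 0} = of_real ` {x. poly (jacobi_poly b (Suc N)) x = 0}"
  proof (intro set_eqI iffI)
    fix z assume "z \<in> {z. poly p z = 0}"
    then obtain x where x: "z = of_real x" "poly p z = 0" using real[of z] by blast
    then have "poly (jacobi_poly b (Suc N)) x = 0"
      by (simp add: p_def of_real del: jacobi_poly.simps)
    then show "z \<in> of_real ` {x. poly (jacobi_poly b (Suc N)) x = 0}" using x by blast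
  qed (auto simp: p_def of_real simp del: jacobi_poly.simps)
  ultimately show ?thesis
    by (simp add: card_image inj_on_def)
qed

text \<open>The measure has mass 1 / k(x), the Christoffel number, at each zero x of p_{N+1}. Only
  the integrals of p_1, ..., p_N are computed, since the first row of the Gram matrix determines the
  rest.\<close>

lemma jacobi_gauss_quadrature:
  fixes b :: "nat \<Rightarrow> real"
  assumes N: "N \<ge> 1" and B: "\<And>n. n \<ge> 1 \<Longrightarrow> \<bar>b n\<bar> \<le> B"
  shows "\<exists>M. real_distribution M \<and> (AE x in M. \<bar>x\<bar> \<le> 2 + B) \<and>
    (\<forall>n\<in>{1..N}. integral\<^sup>L M (poly (jacobi_poly b n)) = (if n = 1 then 1 else 0))"
proof -
  define p where "p = (\<lambda>n. poly (jacobi_poly b n))"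
  define X where "X = {x. p (Suc N) x = 0}"
  define k where "k = (\<lambda>x. \<Sum>n=1..N. p n x ^ 2)"
  have cardX: "card X = N" unfolding X_def p_def by (rule card_jacobi_poly_roots[OF N])
  then have finX: "finite X" using N card.infinite by fastforce
  have k1: "k x \<ge> 1" for x
    unfolding k_def by (rule order_trans[OF _ member_le_sum[of 1]]) (use N in \<open>auto simp: p_def\<close>)
  have cd: "(\<Sum>n=1..N. p n x * p n y) = (if x = y then k x else 0)" if "x \<in> X" "y \<in> X" for x y
    using christoffel_darboux[of x y b N] that by (auto simp: X_def p_def k_def power2_eq_square)
  \<comment> \<open>\<open>d n\<close> is the quadrature value of p_n, so the aim is that
    \<open>d\<close> is the first unit vector. Christoffel--Darboux at the nodes gives orthogonality
    in the other index, namely that \<Sum> d_n p_n is 1 at every node.\<close>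
  define d where "d = (\<lambda>n. \<Sum>x\<in>X. p n x / k x)"
  have d: "(\<Sum>n=1..N. d n * p n y) = 1" if "y \<in> X" for y
  proof -
    have "(\<Sum>n=1..N. d n * p n y) = (\<Sum>n=1..N. \<Sum>x\<in>X. p n x * p n y / k x)"
      by (simp add: d_def sum_distrib_right)
    also have "\<dots> = (\<Sum>x\<in>X. (\<Sum>n=1..N. p n x * p n y) / k x)"
      by (subst sum.swap) (simp add: sum_divide_distrib)
    also have "\<dots> = (\<Sum>x\<in>X. if x = y then 1 else 0)"
    proof (rule sum.cong)
      fix x assume "x \<in> X"
      show "(\<Sum>n=1..N. p n x * p n y) / k x = (if x = y then 1 else 0)"
        unfolding cd[OF \<open>x \<in> X\<close> that] using k1[of x] by auto
    qed simp
    finally show ?thesis using that finX by simp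
  qed
  \<comment> \<open>\<Sum> e_n p_n has degree at most N - 1 but vanishes at all N nodes.\<close>
  define e where "e = (\<lambda>n. if n = 1 then d n - 1 else d n)"
  have "(\<Sum>n=1..N. smult (e n) (jacobi_poly b n)) = 0" (is "?P = 0")
  proof (rule ccontr)
    assume nz: "?P \<noteq> 0"
    have "poly ?P y = 0" if "y \<in> X" for y
    proof -
      have "poly ?P y = (\<Sum>n=1..N. d n * p n y - (if n = 1 then 1 else 0))"
        unfolding poly_sum by (rule sum.cong) (auto simp: e_def p_def algebra_simps)
      also have "\<dots> = 0" unfolding sum_subtractf d[OF that] using N by simp
      finally show ?thesis .
    qed
    then have "card X \<le> card {x. poly ?P x = 0}"
      by (intro card_mono poly_roots_finite nz) auto
    also have "\<dots> \<le> degree ?P" by (rule card_poly_roots_bound[OF nz])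
    also have "\<dots> \<le> N - 1"
      by (intro degree_sum_le) (auto intro!: order_trans[OF degree_smult_le] order_trans[OF degree_jacobi_poly_le])
    finally show False using cardX N by simp
  qed
  then have "e n = 0" if "n \<in> {1..N}" for n using jacobi_poly_independent that by blast
  then have dn: "d n = (if n = 1 then 1 else 0)" if "n \<in> {1..N}" for n
    using that by (force simp: e_def)
  define M0 where "M0 = point_measure X (\<lambda>x. ennreal (1 / k x))"
  define M where "M = distr M0 borel (\<lambda>x. x)"
  have meas: "(\<lambda>x. x) \<in> measurable M0 borel"
    unfolding M0_def by (simp add: measurable_point_measure_eq1)
  have em: "emeasure M0 X = 1"
  proof -
    have "emeasure M0 X = (\<Sum>x\<in>X. ennreal (1 / k x))"
      unfolding M0_def using finX by (simp add: emeasure_point_measure_finite)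
    also have "\<dots> = ennreal (\<Sum>x\<in>X. 1 / k x)"
      using k1 by (intro sum_ennreal) (auto intro: order_trans[of 0 1])
    also have "(\<Sum>x\<in>X. 1 / k x) = d 1" by (simp add: d_def p_def)
    finally show ?thesis using dn[of 1] N by simp
  qed
  have spX: "space M0 = X" by (simp add: M0_def space_point_measure)
  interpret P: prob_space M0 by standard (simp add: spX em)
  have rd: "real_distribution M" unfolding M_def using meas by (rule P.real_distribution_distr)
  have "integral\<^sup>L M (p n) = d n" if "n \<in> {1..N}" for n
  proof -
    have "integral\<^sup>L M (p n) = integral\<^sup>L M0 (p n)"
      unfolding M_def by (rule integral_distr[OF meas]) (simp add: p_def)
    also have "\<dots> = (\<Sum>x\<in>X. 1 / k x * p n x)"
      unfolding M0_def using finX k1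
      by (subst lebesgue_integral_point_measure_finite) (auto intro: order_trans[of 0 1])
    finally show ?thesis by (simp add: d_def)
  qed
  moreover have "AE x in M. \<bar>x\<bar> \<le> 2 + B"
    unfolding M_def
  proof (subst AE_distr_iff[OF meas])
    show "AE x in M0. \<bar>x\<bar> \<le> 2 + B"
      using jacobi_poly_root_bound[OF B N] by (intro AE_I2) (auto simp: spX X_def p_def)
  qed simp
  ultimately show ?thesis using rd dn unfolding p_def by metis
qed

text \<open>A weak limit of the Gauss measures, which live on a common compact interval. For fixed n
  the integral of p_n has the right value under all but finitely many of them, so the limit inherits
  it.\<close>

theorem jacobi_spectral_measure_exists:
  fixes b :: "nat \<Rightarrow> real"
  assumes B: "\<And>n. n \<ge> 1 \<Longrightarrow> \<bar>b n\<bar> \<le> B"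
  shows "\<exists>M. real_distribution M \<and> (AE x in M. \<bar>x\<bar> \<le> 2 + B) \<and>
    (\<forall>n\<ge>1. integral\<^sup>L M (poly (jacobi_poly b n)) = (if n = 1 then 1 else 0))"
proof -
  have "B \<ge> 0" using B[of 1] by auto
  define R where "R = 2 + B"
  have R: "R > 0" using \<open>B \<ge> 0\<close> by (simp add: R_def)
  obtain \<nu> where \<nu>: "\<And>N. real_distribution (\<nu> N)" "\<And>N. AE x in \<nu> N. \<bar>x\<bar> \<le> R"
    "\<And>N n. n \<in> {1..Suc N} \<Longrightarrow> integral\<^sup>L (\<nu> N) (poly (jacobi_poly b n)) = (if n = 1 then 1 else 0)"
    using jacobi_gauss_quadrature[of "Suc N" b B for N, OF _ B] unfolding R_def
    by (metis le_add1 plus_1_eq_Suc)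
  interpret \<nu>: real_distribution "\<nu> N" for N by (rule \<nu>)
  have "tight \<nu>"
    unfolding tight_def
  proof (intro conjI allI impI \<nu>(1))
    fix e :: real assume "e > 0"
    \<comment> \<open>The interval is open on the left, so it starts at -R - 1 in order to contain
      -R.\<close>
    have "measure (\<nu> N) {-R-1<..R} = 1" for N
      using \<nu>(2)[of N] by (intro \<nu>.prob_eq_1[THEN iffD2]) auto
    then have "- R - 1 < R \<and> (\<forall>N. 1 - e < measure (\<nu> N) {-R-1<..R})"
      using \<open>e > 0\<close> R by simp
    then show "\<exists>a b. a < b \<and> (\<forall>N. 1 - e < measure (\<nu> N) {a<..b})" by blast
  qed
  then obtain r M where r: "strict_mono r" "real_distribution M" "weak_conv_m (\<nu> \<circ> id \<circ> r) M"
    using tight_imp_convergent_subsubsequence[of \<nu> id] by (auto simp: strict_mono_id)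
  interpret M: real_distribution M by (rule r)
  have lim: "(\<lambda>j. integral\<^sup>L (\<nu> (r j)) f) \<longlonglongrightarrow> integral\<^sup>L M f"
    if "\<And>x. isCont f x" "\<And>x. \<bar>f x\<bar> \<le> C" for f :: "real \<Rightarrow> real" and C
    using weak_conv_imp_integral_bdd_continuous_conv[of "\<nu> \<circ> id \<circ> r" M f C] r that \<nu>(1)
    by (simp add: comp_def)
  \<comment> \<open>A bounded continuous function that vanishes exactly on [-R, R]: its integral is
    0 under every Gauss measure, hence under the limit, which confines the support of the
    limit.\<close>
  define g where "g = (\<lambda>x::real. min 1 (max 0 (\<bar>x\<bar> - R)))"
  have gb: "\<bar>g x\<bar> \<le> 1" for x by (auto simp: g_def)
  have gc: "isCont g x" for x unfolding g_def by (intro continuous_intros)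
  have "integral\<^sup>L (\<nu> (r j)) g = 0" for j
    using \<nu>(2)[of "r j"] by (intro integral_eq_zero_AE) (auto simp: g_def)
  then have "integral\<^sup>L M g = 0" using lim[OF gc gb] by (simp add: LIMSEQ_const_iff)
  moreover have gi: "integrable M g"
    using gb by (intro M.integrable_const_bound[of _ 1]) (auto simp: g_def)
  ultimately have "AE x in M. g x = 0"
    by (subst integral_nonneg_eq_0_iff_AE[symmetric]) (auto simp: g_def)
  then have sup: "AE x in M. \<bar>x\<bar> \<le> R"
    by (rule AE_mp) (auto simp: g_def)
  \<comment> \<open>Weak convergence tests bounded functions only. Clamping the argument to [-R, R]
    makes a polynomial bounded without changing it on the supports.\<close>
  define cl where "cl = (\<lambda>x::real. max (-R) (min R x))"
  have "integral\<^sup>L M (poly (jacobi_poly b n)) = (if n = 1 then 1 else 0)" if "n \<ge> 1" for n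
  proof -
    define f where "f = (\<lambda>x. poly (jacobi_poly b n) (cl x))"
    have "isCont f x" for x unfolding f_def cl_def by (intro continuous_intros)
    moreover obtain C where C: "\<And>x. x \<in> {-R..R} \<Longrightarrow> \<bar>poly (jacobi_poly b n) x\<bar> \<le> C"
      using compact_imp_bounded[OF compact_continuous_image[OF continuous_on_poly[OF continuous_on_id, of "{-R..R}" "jacobi_poly b n"] compact_Icc]]
      unfolding bounded_iff by (metis image_eqI real_norm_def)
    have "\<bar>f x\<bar> \<le> C" for x unfolding f_def by (rule C) (use R in \<open>auto simp: cl_def\<close>)
    ultimately have l: "(\<lambda>j. integral\<^sup>L (\<nu> (r j)) f) \<longlonglongrightarrow> integral\<^sup>L M f" by (rule lim)
    have eq: "integral\<^sup>L K f = integral\<^sup>L K (poly (jacobi_poly b n))" if "AE x in K. \<bar>x\<bar> \<le> R" "sets K = sets borel" for K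
    proof (rule integral_cong_AE)
      show "AE x in K. f x = poly (jacobi_poly b n) x"
        using that(1) by (rule AE_mp) (auto simp: f_def cl_def intro!: AE_I2)
      show "f \<in> borel_measurable K" "poly (jacobi_poly b n) \<in> borel_measurable K"
        unfolding measurable_cong_sets[OF that(2) refl] f_def cl_def by measurable
    qed
    have "\<forall>\<^sub>F j in sequentially. integral\<^sup>L (\<nu> (r j)) f = (if n = 1 then 1 else 0)"
      unfolding eventually_sequentially
    proof (intro exI allI impI)
      fix j assume "j \<ge> n"
      then have "n \<in> {1..Suc (r j)}" using seq_suble[OF r(1), of j] \<open>n \<ge> 1\<close> by auto
      then show "integral\<^sup>L (\<nu> (r j)) f = (if n = 1 then 1 else 0)"
        using eq[OF \<nu>(2)] \<nu>(3) by simp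
    qed
    then have "(\<lambda>j. integral\<^sup>L (\<nu> (r j)) f) \<longlonglongrightarrow> (if n = 1 then 1 else 0)"
      by (rule tendsto_eventually)
    then show ?thesis using l LIMSEQ_unique eq[OF sup] by fastforce
  qed
  then show ?thesis using r(2) sup unfolding R_def by metis
qed

section \<open>Lebesgue decomposition\<close>

text \<open>The singular part is the restriction to a null set of maximal \<open>\<mu>\<close>-measure.\<close>

theorem lebesgue_decomposition_exists:
  fixes M :: "real measure"
  assumes fin: "finite_measure M" and sets: "sets M = sets borel"
  shows "\<exists>f Ms. is_lebesgue_decomposition M f Ms"
proof -
  interpret finite_measure M by (rule fin)
  note [measurable_cong] = sets
  have sp: "space M = UNIV" using sets_eq_imp_space_eq[OF sets] by simp
  define \<N> where "\<N> = null_sets (lborel :: real measure)"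
  define s where "s = (SUP A\<in>\<N>. measure M A)"
  have bdd: "bdd_above (measure M ` \<N>)"
    by (intro bdd_aboveI2[of _ _ "measure M (space M)"] bounded_measure)
  have ne: "\<N> \<noteq> {}" by (auto simp: \<N>_def)
  have "\<exists>A\<in>\<N>. s - 1 / Suc n < measure M A" for n
    using less_cSUP_iff[OF ne bdd, of "s - 1 / Suc n"] by (simp add: s_def)
  then obtain A where A: "\<And>n. A n \<in> \<N>" "\<And>n. s - 1 / Suc n < measure M (A n)" by metis
  define N where "N = (\<Union>n. A n)"
  have N: "N \<in> \<N>" using A unfolding N_def \<N>_def by auto
  have Nb [measurable]: "N \<in> sets borel" using N by (auto simp: \<N>_def null_sets_def)
  have le: "measure M B \<le> s" if "B \<in> \<N>" for B
    unfolding s_def by (rule cSUP_upper[OF that bdd])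
  have "s \<le> measure M N"
  proof (rule LIMSEQ_le_const2)
    show "(\<lambda>n. s - 1 / Suc n) \<longlonglongrightarrow> s" by real_asymp
    show "\<exists>k. \<forall>n\<ge>k. s - 1 / Suc n \<le> measure M N"
      using A(2) finite_measure_mono[of "A _" N] unfolding N_def
      by (metis (no_types, lifting) Nb N_def UN_upper UNIV_I less_le_trans less_imp_le sets)
  qed
  then have sN: "measure M N = s" using le[OF N] by simp
  define M1 where "M1 = density M (indicator (- N))"
  define Ms where "Ms = density M (indicator N)"
  have em1: "emeasure M1 B = emeasure M (B - N)" if [measurable]: "B \<in> sets borel" for B
    unfolding M1_def by (subst emeasure_density) (auto simp: sets Diff_eq Int_commute simp flip: indicator_inter_arith intro!: nn_integral_cong)
  have ems: "emeasure Ms B = emeasure M (B \<inter> N)" if [measurable]: "B \<in> sets borel" for B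
    unfolding Ms_def by (subst emeasure_density) (auto simp: sets Int_commute simp flip: indicator_inter_arith intro!: nn_integral_cong)
  have "absolutely_continuous lborel M1"
    unfolding absolutely_continuous_def
  proof
    fix B :: "real set" assume B: "B \<in> null_sets lborel"
    then have [measurable]: "B \<in> sets borel" by (auto simp: null_sets_def)
    \<comment> \<open>Enlarging \<open>N\<close> by the null set \<open>B\<close> cannot exceed the
      maximal measure, so \<open>B - N\<close> has measure 0.\<close>
    have "N \<union> B \<in> \<N>" using B N by (auto simp: \<N>_def)
    from le[OF this] have "measure M N + measure M (B - N) \<le> measure M N"
      using finite_measure_Union[of N "B - N"] by (simp add: sets sN Un_Diff_cancel)
    then have "measure M (B - N) = 0" by (simp add: measure_le_0_iff)
    then show "B \<in> null_sets M1"
      using em1[of B] by (auto simp: null_sets_def emeasure_eq_measure M1_def sets)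
  qed
  then obtain g where g: "g \<in> borel_measurable lborel" "density lborel g = M1"
    using sigma_finite_measure.Radon_Nikodym[OF sigma_finite_lborel, of M1] by (auto simp: M1_def sets)
  have "integral\<^sup>N lborel g = emeasure M1 UNIV"
    unfolding g(2)[symmetric] using g(1) by (subst emeasure_density) auto
  also have "\<dots> \<noteq> \<infinity>" by (simp add: em1)
  finally have "AE x in lborel. g x \<noteq> \<infinity>"
    using g by (intro nn_integral_PInf_AE) auto
  define f where "f = (\<lambda>x. enn2real (g x))"
  have f: "f \<in> borel_measurable borel" using g by (simp add: f_def)
  have "density lborel (\<lambda>x. ennreal (f x)) = density lborel g"
    by (rule density_cong) (use f g \<open>AE x in lborel. g x \<noteq> \<infinity>\<close> in \<open>auto simp: f_def less_top\<close>)
  then have "emeasure M B = emeasure (density lborel (\<lambda>x. ennreal (f x))) B + emeasure Ms B"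
    if B [measurable]: "B \<in> sets borel" for B
    using plus_emeasure[of "B - N" M "B \<inter> N"]
    by (simp add: g(2) em1 ems sets Un_Diff_Int Diff_Int_distrib2)
  moreover have "emeasure Ms (UNIV - N) = 0"
    using ems[of "UNIV - N"] by (simp add: Int_commute)
  ultimately have "is_lebesgue_decomposition M f Ms"
    using f N by (auto simp: is_lebesgue_decomposition_def \<N>_def Ms_def sets f_def)
  then show ?thesis by blast
qed

section \<open>Spectrum of constant two-sided Jacobi matrices\<close>

lemma ell2_iff_bounded_sums:
  "u \<in> ell2 \<longleftrightarrow> (\<exists>B. \<forall>F. finite F \<longrightarrow> (\<Sum>n\<in>F. (cmod (u n))\<^sup>2) \<le> B)"
proof
  assume "u \<in> ell2"
  then have "(\<lambda>n. (cmod (u n))\<^sup>2) summable_on UNIV" by (simp add: ell2_def)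
  then show "\<exists>B. \<forall>F. finite F \<longrightarrow> (\<Sum>n\<in>F. (cmod (u n))\<^sup>2) \<le> B"
    by (intro exI[of _ "\<Sum>\<^sub>\<infinity>n. (cmod (u n))\<^sup>2"] allI impI finite_sum_le_infsum) auto
next
  assume "\<exists>B. \<forall>F. finite F \<longrightarrow> (\<Sum>n\<in>F. (cmod (u n))\<^sup>2) \<le> B"
  then obtain B where "\<And>F. finite F \<Longrightarrow> (\<Sum>n\<in>F. (cmod (u n))\<^sup>2) \<le> B" by blast
  then show "u \<in> ell2"
    unfolding ell2_def mem_Collect_eq
    by (intro nonneg_bdd_above_summable_on bdd_aboveI2[of _ _ B]) auto
qed

text \<open>m and 1/m are the roots of t^2 - y t + 1; taking the square root with the sign of y
  picks the larger root without cancellation. The small root gives the decay of the resolvent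
  kernel, its inverse the growth of solutions on hyperbolic blocks.\<close>

lemma joukowski_inverse:
  fixes y :: real
  assumes "\<bar>y\<bar> > 2"
  obtains m where "m \<noteq> 0" "\<bar>m\<bar> < 1" "m + 1 / m = y"
proof -
  define s where "s = sqrt (y\<^sup>2 - 4)"
  define M where "M = (y + sgn y * s) / 2"
  have "\<bar>y\<bar>\<^sup>2 > 2\<^sup>2" using power_strict_mono[OF assms, of 2] by simp
  then have s: "s > 0" "s\<^sup>2 = y\<^sup>2 - 4" by (auto simp: s_def)
  have "\<bar>M\<bar> = (\<bar>y\<bar> + s) / 2"
    using assms s by (cases "y > 0") (auto simp: M_def)
  then have M: "\<bar>M\<bar> > 1" using assms s by simp
  have "M * M - y * M + 1 = 0"
    using assms s(2) by (cases "y > 0") (auto simp: M_def power2_eq_square field_simps)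
  then have "M + 1 / M = y" using M by (auto simp: field_simps)
  then show ?thesis using that[of "1 / M"] M by (auto simp: abs_div)
qed

lemma jacobi_op_const:
  "jacobi_op (const_jacobi 1 \<beta>) u n - of_real x * u n
     = u (n - 1) + u (n + 1) - of_real (x - \<beta>) * u n"
  by (simp add: const_jacobi_def left_diff_distrib)

text \<open>Truncated plane waves are approximate eigenvectors.\<close>

lemma spectrum_const_jacobi_supset:
  assumes "\<bar>x - \<beta>\<bar> \<le> 2"
  shows "x \<in> spectrum (const_jacobi 1 \<beta>)"
proof (rule ccontr)
  assume "x \<notin> spectrum (const_jacobi 1 \<beta>)"
  define T where "T = (\<lambda>u n. jacobi_op (const_jacobi 1 \<beta>) u n - of_real x * u n)"
  obtain C where C: "\<And>u. u \<in> ell2 \<Longrightarrow> ell2_norm u \<le> C * ell2_norm (T u)"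
    using \<open>x \<notin> spectrum _\<close> by (auto simp: spectrum_def resolvent_set_def T_def)
  define th where "th = arccos ((x - \<beta>) / 2)"
  have th: "2 * cos th = x - \<beta>" using assms by (simp add: th_def cos_arccos_abs)
  define e where "e = (\<lambda>n::int. cis (th * of_int n))"
  have e: "e (n - 1) + e (n + 1) = of_real (x - \<beta>) * e n" for n
  proof -
    have "e (n - 1) = cis (- th) * e n" "e (n + 1) = cis th * e n"
      by (simp_all add: e_def cis_mult algebra_simps)
    moreover have "cis (- th) + cis th = of_real (x - \<beta>)"
      unfolding th[symmetric] by (simp add: complex_eq_iff)
    ultimately show ?thesis by (metis distrib_right)
  qed
  have ne: "cmod (e n) = 1" for n by (simp add: e_def)
  \<comment> \<open>For a plane wave cut off to N sites, \<open>T u\<close> lives on the four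
    boundary sites in \<open>S\<close>, where its modulus is at most 4. So its squared norm is at
    most 4 * 16 = 64, while that of \<open>u\<close> is N.\<close>
  obtain N :: nat where N: "N > 64 * C\<^sup>2" using reals_Archimedean2 by blast
  define I where "I = {0..<int N}"
  define u where "u = (\<lambda>n. if n \<in> I then e n else 0)"
  define S where "S = {-1, 0, int N - 1, int N}"
  have out: "T u n = 0" if "n \<notin> S" for n
  proof -
    have "n \<in> I \<and> n - 1 \<in> I \<and> n + 1 \<in> I \<or> n \<notin> I \<and> n - 1 \<notin> I \<and> n + 1 \<notin> I"
      using that by (auto simp: I_def S_def)
    then show ?thesis using e[of n] unfolding T_def jacobi_op_const u_def by auto
  qed
  have "cmod (T u n) \<le> 4" for n
  proof -
    have u1: "cmod (u m) \<le> 1" for m by (simp add: u_def ne)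
    have "cmod (T u n) \<le> cmod (u (n - 1)) + cmod (u (n + 1)) + cmod (of_real (x - \<beta>) * u n)"
      unfolding T_def jacobi_op_const
      by (rule order_trans[OF norm_triangle_ineq4 add_right_mono[OF norm_triangle_ineq]])
    also have "\<dots> \<le> 1 + 1 + 2 * 1"
      unfolding norm_mult norm_of_real by (intro add_mono mult_mono u1 assms) auto
    finally show ?thesis by simp
  qed
  then have b: "(cmod (T u n))\<^sup>2 \<le> 16" for n using power_mono[of "cmod (T u n)" 4 2] by simp
  have "(\<Sum>\<^sub>\<infinity>n. (cmod (T u n))\<^sup>2) = (\<Sum>\<^sub>\<infinity>n\<in>S. (cmod (T u n))\<^sup>2)"
    using out by (intro infsum_cong_neutral) auto
  also have "\<dots> = (\<Sum>n\<in>S. (cmod (T u n))\<^sup>2)" by (simp add: S_def)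
  also have "\<dots> \<le> of_nat (card S) * 16" using b by (intro sum_bounded_above) auto
  also have "card S \<le> 4"
    by (simp add: S_def card_insert_if)
  finally have T64: "(\<Sum>\<^sub>\<infinity>n. (cmod (T u n))\<^sup>2) \<le> 64" by simp
  have fin: "finite I" by (simp add: I_def)
  have "(\<lambda>n. (cmod (u n))\<^sup>2) summable_on I" using fin by (rule summable_on_finite)
  then have "u \<in> ell2"
    unfolding ell2_def mem_Collect_eq
    by (rule summable_on_cong_neutral[THEN iffD1, rotated -1]) (auto simp: u_def)
  have "(\<Sum>\<^sub>\<infinity>n. (cmod (u n))\<^sup>2) = (\<Sum>\<^sub>\<infinity>n\<in>I. (cmod (u n))\<^sup>2)"
    by (intro infsum_cong_neutral) (auto simp: u_def)
  also have "\<dots> = (\<Sum>n\<in>I. (cmod (u n))\<^sup>2)" using fin by simp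
  also have "\<dots> = (\<Sum>n\<in>I. 1)" by (rule sum.cong) (auto simp: u_def ne)
  also have "\<dots> = real N" by (simp add: I_def)
  finally have "sqrt (real N) \<le> C * ell2_norm (T u)"
    using C[OF \<open>u \<in> ell2\<close>] by (simp add: ell2_norm_def)
  also have "\<dots> \<le> \<bar>C\<bar> * sqrt 64"
    unfolding ell2_norm_def
    by (intro mult_mono real_sqrt_le_mono T64) (auto intro: infsum_nonneg)
  finally have "sqrt (real N) \<le> \<bar>C\<bar> * 8" by simp
  then have "(sqrt (real N))\<^sup>2 \<le> (\<bar>C\<bar> * 8)\<^sup>2" by (intro power_mono) auto
  then show False using N by (simp add: power_mult_distrib)
qed

text \<open>With \<open>m + 1/m = y\<close> and \<open>\<bar>m\<bar> < 1\<close> the resolvent is convolution with a multiple of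
  \<open>m^\<bar>n\<bar>\<close>; the Cauchy--Schwarz inequality makes this convolution bounded.\<close>

lemma ell2_convolution:
  fixes G :: "int \<Rightarrow> real"
  assumes G: "(\<lambda>k. \<bar>G k\<bar>) summable_on UNIV" and v: "v \<in> ell2"
  shows "(\<lambda>k. of_real (G k) * v (n - k)) summable_on UNIV"
    and "(\<lambda>n. \<Sum>\<^sub>\<infinity>k. of_real (G k) * v (n - k)) \<in> ell2"
proof -
  define g where "g = (\<Sum>\<^sub>\<infinity>k. \<bar>G k\<bar>)"
  define S where "S = (\<Sum>\<^sub>\<infinity>n. (cmod (v n))\<^sup>2)"
  have g0: "g \<ge> 0" unfolding g_def by (intro infsum_nonneg) simp
  have sv: "(\<lambda>n. (cmod (v n))\<^sup>2) summable_on UNIV" using v by (simp add: ell2_def)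
  have fsum: "(\<Sum>n\<in>F. (cmod (v n))\<^sup>2) \<le> S" if "finite F" for F
    unfolding S_def by (intro finite_sum_le_infsum sv that) auto
  have vb: "(cmod (v n))\<^sup>2 \<le> S" for n using fsum[of "{n}"] by simp
  have abs: "(\<lambda>k. norm (of_real (G k) * v (n - k))) summable_on UNIV" for n
  proof (rule summable_on_comparison_test)
    show "(\<lambda>k. \<bar>G k\<bar> * sqrt S) summable_on UNIV" by (intro summable_on_cmult_left G)
    show "norm (of_real (G k) * v (n - k)) \<le> \<bar>G k\<bar> * sqrt S" for k
      using vb[of "n - k"] by (auto simp: norm_mult intro!: mult_left_mono real_le_rsqrt)
  qed auto
  then show "(\<lambda>k. of_real (G k) * v (n - k)) summable_on UNIV" for n
    by (rule abs_summable_summable)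
  define u where "u = (\<lambda>n. \<Sum>\<^sub>\<infinity>k. of_real (G k) * v (n - k))"
  have fin: "(\<Sum>n\<in>A. (cmod (\<Sum>k\<in>F. of_real (G k) * v (n - k)))\<^sup>2) \<le> g\<^sup>2 * S"
    if "finite A" "finite F" for A F
  proof -
    have gF: "(\<Sum>k\<in>F. \<bar>G k\<bar>) \<le> g" unfolding g_def by (intro finite_sum_le_infsum G that) auto
    have "(cmod (\<Sum>k\<in>F. of_real (G k) * v (n - k)))\<^sup>2 \<le> g * (\<Sum>k\<in>F. \<bar>G k\<bar> * (cmod (v (n - k)))\<^sup>2)" for n
    proof -
      \<comment> \<open>Schur's test: |G| is split into two square roots, so that Cauchy--Schwarz
        leaves one factor \<Sum> |G| and one average of |v|^2 with weights |G|.\<close>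
      have "cmod (\<Sum>k\<in>F. of_real (G k) * v (n - k)) \<le> (\<Sum>k\<in>F. sqrt \<bar>G k\<bar> * (sqrt \<bar>G k\<bar> * cmod (v (n - k))))"
        by (rule order_trans[OF norm_sum]) (simp add: norm_mult flip: mult.assoc)
      then have "(cmod (\<Sum>k\<in>F. of_real (G k) * v (n - k)))\<^sup>2
          \<le> (\<Sum>k\<in>F. sqrt \<bar>G k\<bar> * (sqrt \<bar>G k\<bar> * cmod (v (n - k))))\<^sup>2"
        by (intro power_mono) auto
      also have "\<dots> \<le> (\<Sum>k\<in>F. (sqrt \<bar>G k\<bar>)\<^sup>2) * (\<Sum>k\<in>F. (sqrt \<bar>G k\<bar> * cmod (v (n - k)))\<^sup>2)"
        by (rule Cauchy_Schwarz_ineq_sum)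
      also have "\<dots> = (\<Sum>k\<in>F. \<bar>G k\<bar>) * (\<Sum>k\<in>F. \<bar>G k\<bar> * (cmod (v (n - k)))\<^sup>2)"
        by (simp add: power_mult_distrib)
      also have "\<dots> \<le> g * (\<Sum>k\<in>F. \<bar>G k\<bar> * (cmod (v (n - k)))\<^sup>2)"
        by (intro mult_right_mono gF sum_nonneg mult_nonneg_nonneg) auto
      finally show ?thesis .
    qed
    then have "(\<Sum>n\<in>A. (cmod (\<Sum>k\<in>F. of_real (G k) * v (n - k)))\<^sup>2)
        \<le> (\<Sum>n\<in>A. g * (\<Sum>k\<in>F. \<bar>G k\<bar> * (cmod (v (n - k)))\<^sup>2))" by (intro sum_mono)
    also have "\<dots> = g * (\<Sum>k\<in>F. \<bar>G k\<bar> * (\<Sum>n\<in>A. (cmod (v (n - k)))\<^sup>2))"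
      unfolding sum_distrib_left[symmetric] by (subst sum.swap) (simp add: sum_distrib_left)
    also have "\<dots> \<le> g * (\<Sum>k\<in>F. \<bar>G k\<bar> * S)"
    proof (intro mult_left_mono sum_mono g0 abs_ge_zero)
      fix k
      have "(\<Sum>n\<in>A. (cmod (v (n - k)))\<^sup>2) = (\<Sum>n\<in>(\<lambda>n. n - k) ` A. (cmod (v n))\<^sup>2)"
        by (subst sum.reindex) (auto simp: inj_on_def)
      also have "\<dots> \<le> S" using that by (intro fsum) auto
      finally show "(\<Sum>n\<in>A. (cmod (v (n - k)))\<^sup>2) \<le> S" .
    qed
    also have "\<dots> \<le> g * (g * S)"
      unfolding sum_distrib_right[symmetric] using vb[of 0]
      by (intro mult_left_mono mult_right_mono gF g0) (auto intro: order_trans[OF zero_le_power2])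
    finally show ?thesis by (simp add: power2_eq_square)
  qed
  have "(\<Sum>n\<in>A. (cmod (u n))\<^sup>2) \<le> g\<^sup>2 * S" if A: "finite A" for A
  proof (rule tendsto_upperbound)
    show "((\<lambda>F. \<Sum>n\<in>A. (cmod (\<Sum>k\<in>F. of_real (G k) * v (n - k)))\<^sup>2)
        \<longlongrightarrow> (\<Sum>n\<in>A. (cmod (u n))\<^sup>2)) (finite_subsets_at_top UNIV)"
      unfolding u_def
      by (intro tendsto_sum tendsto_power tendsto_norm infsum_tendsto abs_summable_summable[OF abs])
    show "\<forall>\<^sub>F F in finite_subsets_at_top UNIV.
        (\<Sum>n\<in>A. (cmod (\<Sum>k\<in>F. of_real (G k) * v (n - k)))\<^sup>2) \<le> g\<^sup>2 * S"
      using fin[OF A] by (auto intro!: eventually_finite_subsets_at_top_weakI)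
  qed auto
  then show "(\<lambda>n. \<Sum>\<^sub>\<infinity>k. of_real (G k) * v (n - k)) \<in> ell2"
    unfolding ell2_iff_bounded_sums u_def[symmetric] by blast
qed

lemma ell2_norm_squared: "(ell2_norm u)\<^sup>2 = (\<Sum>\<^sub>\<infinity>n. (cmod (u n))\<^sup>2)"
  by (simp add: ell2_norm_def infsum_nonneg)

text \<open>Cauchy--Schwarz with weights d, 1, 1. In the application d + 2 = |y|, which lets the two
  shifted terms be absorbed without loss.\<close>

lemma weighted_square_sum_le:
  fixes a b c d :: real
  assumes "d > 0"
  shows "(a + b + c)\<^sup>2 \<le> (d + 2) * (a\<^sup>2 / d + b\<^sup>2 + c\<^sup>2)"
proof -
  have "(d + 2) * (a\<^sup>2 / d + b\<^sup>2 + c\<^sup>2) - (a + b + c)\<^sup>2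
      = (b - c)\<^sup>2 + (a - d * b)\<^sup>2 / d + (a - d * c)\<^sup>2 / d"
    using assms by (simp add: field_simps power2_eq_square)
  also have "\<dots> \<ge> 0" using assms by simp
  finally show ?thesis by simp
qed

text \<open>The triangle inequality |y| ||u|| \<le> ||T|| + 2 ||u||, as shifts are isometries. It is
  carried out on squares, site by site; the weight d = |y| - 2 yields the same constant after
  summation.\<close>

lemma jacobi_const_bounded_below:
  assumes u: "u \<in> ell2" and y: "\<bar>y\<bar> > 2"
  defines "T \<equiv> \<lambda>n. u (n - 1) + u (n + 1) - of_real y * u n"
  shows "T \<in> ell2" "ell2_norm u \<le> 1 / (\<bar>y\<bar> - 2) * ell2_norm T"
proof -
  define f where "f = (\<lambda>n. (cmod (u n))\<^sup>2)"
  define d where "d = \<bar>y\<bar> - 2"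
  have d: "d > 0" "\<bar>y\<bar> = d + 2" using y by (auto simp: d_def)
  have sf: "f summable_on UNIV" using u by (simp add: f_def ell2_def)
  have shift: "(\<lambda>n. f (n + k)) summable_on UNIV" "(\<Sum>\<^sub>\<infinity>n. f (n + k)) = (\<Sum>\<^sub>\<infinity>n. f n)" for k
  proof -
    have bij: "bij_betw (\<lambda>n. n + k) UNIV UNIV"
      by (rule bij_betwI[of _ _ _ "\<lambda>n. n - k"]) auto
    show "(\<lambda>n. f (n + k)) summable_on UNIV"
      using sf summable_on_reindex_bij_betw[OF bij, of f] by simp
    show "(\<Sum>\<^sub>\<infinity>n. f (n + k)) = (\<Sum>\<^sub>\<infinity>n. f n)" by (rule infsum_reindex_bij_betw[OF bij])
  qed
  define h where "h = (\<lambda>n. (cmod (T n))\<^sup>2)"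
  have "h n \<le> 3 * (y\<^sup>2 * f n + f (n + (- 1)) + f (n + 1))" for n
  proof -
    have "cmod (T n) \<le> \<bar>y\<bar> * cmod (u n) + cmod (u (n - 1)) + cmod (u (n + 1))"
      using norm_triangle_ineq4[of "u (n - 1) + u (n + 1)" "of_real y * u n"]
        norm_triangle_ineq[of "u (n - 1)" "u (n + 1)"] by (simp add: T_def norm_mult)
    then have "h n \<le> (\<bar>y\<bar> * cmod (u n) + cmod (u (n - 1)) + cmod (u (n + 1)))\<^sup>2"
      unfolding h_def by (intro power_mono) auto
    also have "\<dots> \<le> (1 + 2) * ((\<bar>y\<bar> * cmod (u n))\<^sup>2 / 1 + (cmod (u (n - 1)))\<^sup>2 + (cmod (u (n + 1)))\<^sup>2)"
      by (rule weighted_square_sum_le) simp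
    finally show ?thesis by (simp add: f_def power_mult_distrib)
  qed
  then have sh: "h summable_on UNIV"
    by (rule summable_on_comparison_test[rotated])
      (auto intro!: summable_on_cmult_right summable_on_add sf shift(1) simp: h_def simp del: add_uminus_conv_diff)
  then show "T \<in> ell2" by (simp add: ell2_def h_def)
  have "y\<^sup>2 * f n \<le> \<bar>y\<bar> * (h n / d + f (n + (- 1)) + f (n + 1))" for n
  proof -
    have "of_real y * u n = u (n - 1) + u (n + 1) - T n" by (simp add: T_def)
    then have "\<bar>y\<bar> * cmod (u n) = cmod (u (n - 1) + u (n + 1) - T n)"
      by (metis norm_mult norm_of_real)
    also have "\<dots> \<le> cmod (T n) + cmod (u (n - 1)) + cmod (u (n + 1))"
      using norm_triangle_ineq4[of "u (n - 1) + u (n + 1)" "T n"]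
        norm_triangle_ineq[of "u (n - 1)" "u (n + 1)"] by simp
    finally have "(\<bar>y\<bar> * cmod (u n))\<^sup>2 \<le> (cmod (T n) + cmod (u (n - 1)) + cmod (u (n + 1)))\<^sup>2"
      by (intro power_mono) auto
    also have "\<dots> \<le> (d + 2) * ((cmod (T n))\<^sup>2 / d + (cmod (u (n - 1)))\<^sup>2 + (cmod (u (n + 1)))\<^sup>2)"
      by (rule weighted_square_sum_le) (rule d)
    finally show ?thesis by (simp add: f_def h_def d(2)[symmetric] power_mult_distrib)
  qed
  then have "(\<Sum>\<^sub>\<infinity>n. y\<^sup>2 * f n) \<le> (\<Sum>\<^sub>\<infinity>n. \<bar>y\<bar> * (1 / d * h n + f (n + (- 1)) + f (n + 1)))"
    by (intro infsum_mono summable_on_cmult_right summable_on_add sf sh shift(1)) simp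
  also have "\<dots> = \<bar>y\<bar> * (1 / d * (\<Sum>\<^sub>\<infinity>n. h n) + (\<Sum>\<^sub>\<infinity>n. f n) + (\<Sum>\<^sub>\<infinity>n. f n))"
    by (simp only: infsum_cmult_right' infsum_add summable_on_cmult_right summable_on_add sf sh shift)
  finally have "\<bar>y\<bar> * (\<bar>y\<bar> * (\<Sum>\<^sub>\<infinity>n. f n)) \<le> \<bar>y\<bar> * (1 / d * (\<Sum>\<^sub>\<infinity>n. h n) + (\<Sum>\<^sub>\<infinity>n. f n) + (\<Sum>\<^sub>\<infinity>n. f n))"
    by (simp add: infsum_cmult_right' power2_eq_square flip: mult.assoc)
  then have "\<bar>y\<bar> * (\<Sum>\<^sub>\<infinity>n. f n) \<le> 1 / d * (\<Sum>\<^sub>\<infinity>n. h n) + (\<Sum>\<^sub>\<infinity>n. f n) + (\<Sum>\<^sub>\<infinity>n. f n)"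
    using y by (subst (asm) mult_le_cancel_left_pos) auto
  then have "d * (\<Sum>\<^sub>\<infinity>n. f n) \<le> (\<Sum>\<^sub>\<infinity>n. h n) / d" by (simp add: d(2) algebra_simps)
  then have "(\<Sum>\<^sub>\<infinity>n. f n) \<le> (1 / d)\<^sup>2 * (\<Sum>\<^sub>\<infinity>n. h n)"
    using d by (simp add: field_simps power2_eq_square)
  then have "(ell2_norm u)\<^sup>2 \<le> (1 / d * ell2_norm T)\<^sup>2"
    unfolding power_mult_distrib ell2_norm_squared f_def h_def .
  then show "ell2_norm u \<le> 1 / (\<bar>y\<bar> - 2) * ell2_norm T"
    unfolding d_def[symmetric]
    by (rule power2_le_imp_le) (use d in \<open>simp add: ell2_norm_def infsum_nonneg\<close>)
qed

lemma abs_power_nat_abs_summable: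
  fixes m :: real
  assumes "\<bar>m\<bar> < 1"
  shows "(\<lambda>k::int. \<bar>m ^ nat \<bar>k\<bar>\<bar>) summable_on UNIV"
proof -
  have g: "(\<lambda>n::nat. \<bar>m ^ n\<bar>) summable_on UNIV"
    using assms by (intro norm_summable_imp_summable_on) (auto simp: power_abs summable_geometric)
  have "(\<lambda>k::int. \<bar>m ^ nat \<bar>k\<bar>\<bar>) summable_on range int"
    using g by (subst summable_on_reindex) (auto simp: comp_def)
  moreover have "(\<lambda>k::int. \<bar>m ^ nat \<bar>k\<bar>\<bar>) summable_on range (\<lambda>n. - int n)"
    using g by (subst summable_on_reindex) (auto simp: comp_def inj_on_def)
  moreover have "(UNIV :: int set) = range int \<union> range (\<lambda>n. - int n)"
    by (auto simp: image_iff) (metis int_cases2)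
  ultimately show ?thesis by (metis summable_on_union)
qed

text \<open>The lower bound already gives injectivity and a bounded inverse; the explicit kernel
  \<open>G\<close> serves for surjectivity.\<close>

lemma spectrum_const_jacobi_subset:
  assumes x: "x \<in> spectrum (const_jacobi 1 \<beta>)"
  shows "\<bar>x - \<beta>\<bar> \<le> 2"
proof (rule ccontr)
  define y where "y = x - \<beta>"
  assume "\<not> \<bar>x - \<beta>\<bar> \<le> 2"
  then have y: "\<bar>y\<bar> > 2" by (simp add: y_def)
  define T where "T = (\<lambda>u n. jacobi_op (const_jacobi 1 \<beta>) u n - complex_of_real x * u n)"
  have T: "T u = (\<lambda>n. u (n - 1) + u (n + 1) - of_real y * u n)" for u
    unfolding T_def jacobi_op_const y_def ..
  have mem: "T u \<in> ell2" and low: "ell2_norm u \<le> 1 / (\<bar>y\<bar> - 2) * ell2_norm (T u)" if "u \<in> ell2" for u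
    unfolding T using jacobi_const_bounded_below[OF that y] by auto
  have inj: "inj_on T ell2"
  proof (rule inj_onI)
    fix u v assume uv: "u \<in> ell2" "v \<in> ell2" "T u = T v"
    define w where "w = (\<lambda>n. u n - v n)"
    have "(cmod (w n))\<^sup>2 \<le> 2 * ((cmod (u n))\<^sup>2 + (cmod (v n))\<^sup>2)" for n
    proof -
      have "(cmod (w n))\<^sup>2 \<le> (cmod (u n) + cmod (v n))\<^sup>2"
        unfolding w_def by (intro power_mono norm_triangle_ineq4) auto
      also have "\<dots> \<le> 2 * ((cmod (u n))\<^sup>2 + (cmod (v n))\<^sup>2)"
        using zero_le_power2[of "cmod (u n) - cmod (v n)"] by (simp add: power2_eq_square algebra_simps)
      finally show ?thesis .
    qed
    then have sw: "(\<lambda>n. (cmod (w n))\<^sup>2) summable_on UNIV"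
      by (rule summable_on_comparison_test[rotated])
        (use uv in \<open>auto intro!: summable_on_cmult_right summable_on_add simp: ell2_def\<close>)
    then have "w \<in> ell2" by (simp add: ell2_def)
    moreover have "T w = (\<lambda>n. T u n - T v n)" by (auto simp: T w_def algebra_simps)
    ultimately have "ell2_norm w \<le> 0" using low[of w] uv by (simp add: ell2_norm_def)
    then have "(\<Sum>\<^sub>\<infinity>n. (cmod (w n))\<^sup>2) \<le> 0" by (simp add: ell2_norm_def)
    then have "(cmod (w n))\<^sup>2 = 0" for n
      by (rule nonneg_infsum_le_0D[OF _ sw]) auto
    then show "u = v" by (auto simp: w_def)
  qed
  obtain m where m: "m \<noteq> 0" "\<bar>m\<bar> < 1" "m + 1 / m = y" using joukowski_inverse[OF y] .
  \<comment> \<open>At k = 0 the difference expression applied to m^|k| gives 2 m - (m + 1/m) = m -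
    1/m, and 0 elsewhere; dividing by \<open>D\<close> turns this into a unit impulse.\<close>
  define D where "D = m - 1 / m"
  have D: "D \<noteq> 0"
  proof
    assume "D = 0"
    then have "m\<^sup>2 = 1" using m by (simp add: D_def field_simps power2_eq_square)
    then show False using m(2) by (auto simp: power2_eq_1_iff)
  qed
  define G where "G = (\<lambda>k::int. m ^ nat \<bar>k\<bar> / D)"
  have sG: "(\<lambda>k. \<bar>G k\<bar>) summable_on UNIV"
    using summable_on_cmult_left[OF abs_power_nat_abs_summable[OF m(2)], of "1 / \<bar>D\<bar>"]
    by (simp add: G_def abs_divide)
  have rec: "G (k - 1) + G (k + 1) - y * G k = (if k = 0 then 1 else 0)" for k
  proof -
    have my: "y * (m * c) = m * (m * c) + c" for c
      using m by (simp add: field_simps flip: m(3))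
    have G: "G (k - 1) + G (k + 1) - y * G k
        = (m ^ nat \<bar>k - 1\<bar> + m ^ nat \<bar>k + 1\<bar> - y * m ^ nat \<bar>k\<bar>) / D"
      by (simp add: G_def add_divide_distrib diff_divide_distrib)
    consider "k = 0" | "k > 0" | "k < 0" by linarith
    then show ?thesis
    proof cases
      case 1
      then show ?thesis using D unfolding G by (simp add: D_def flip: m(3))
    next
      case 2
      define n where "n = nat (k - 1)"
      have "nat \<bar>k\<bar> = Suc n" "nat \<bar>k - 1\<bar> = n" "nat \<bar>k + 1\<bar> = Suc (Suc n)"
        using 2 by (auto simp: n_def)
      then show ?thesis using 2 unfolding G by (simp add: my)
    next
      case 3
      define n where "n = nat (- k - 1)"
      have "nat \<bar>k\<bar> = Suc n" "nat \<bar>k + 1\<bar> = n" "nat \<bar>k - 1\<bar> = Suc (Suc n)"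
        using 3 by (auto simp: n_def)
      then show ?thesis using 3 unfolding G by (simp add: my)
    qed
  qed
  have "v \<in> T ` ell2" if v: "v \<in> ell2" for v
  proof
    define u where "u = (\<lambda>n. \<Sum>\<^sub>\<infinity>k. of_real (G k) * v (n - k))"
    show "u \<in> ell2" unfolding u_def by (rule ell2_convolution(2)[OF sG v])
    have s: "(\<lambda>k. of_real (G k) * v (n - k)) summable_on UNIV" for n
      by (rule ell2_convolution(1)[OF sG v])
    have sh: "(\<lambda>k. of_real (G (k + j)) * v (n - k)) summable_on UNIV"
      "(\<Sum>\<^sub>\<infinity>k. of_real (G (k + j)) * v (n - k)) = u (n + j)" for n j
    proof -
      have bij: "bij_betw (\<lambda>k. k + j) UNIV UNIV"
        by (rule bij_betwI[of _ _ _ "\<lambda>k. k - j"]) auto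
      show "(\<lambda>k. of_real (G (k + j)) * v (n - k)) summable_on UNIV"
        using s[of "n + j"] summable_on_reindex_bij_betw[OF bij, of "\<lambda>k. of_real (G k) * v (n + j - k)"]
        by (simp add: algebra_simps)
      show "(\<Sum>\<^sub>\<infinity>k. of_real (G (k + j)) * v (n - k)) = u (n + j)"
        using infsum_reindex_bij_betw[OF bij, of "\<lambda>k. of_real (G k) * v (n + j - k)"]
        by (simp add: u_def algebra_simps)
    qed
    have "T u n = v n" for n
    proof -
      have "T u n = (\<Sum>\<^sub>\<infinity>k. of_real (G (k + (- 1))) * v (n - k))
          + (\<Sum>\<^sub>\<infinity>k. of_real (G (k + 1)) * v (n - k))
          + of_real (- y) * (\<Sum>\<^sub>\<infinity>k. of_real (G k) * v (n - k))"
        unfolding T sh(2) by (simp add: u_def)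
      also have "\<dots> = (\<Sum>\<^sub>\<infinity>k. of_real (G (k + (- 1))) * v (n - k)
          + of_real (G (k + 1)) * v (n - k) + of_real (- y) * (of_real (G k) * v (n - k)))"
        by (simp only: infsum_cmult_right' infsum_add sh(1) s summable_on_add summable_on_cmult_right)
      also have "\<dots> = (\<Sum>\<^sub>\<infinity>k. of_real (G (k - 1) + G (k + 1) - y * G k) * v (n - k))"
        by (simp add: algebra_simps)
      also have "\<dots> = (\<Sum>\<^sub>\<infinity>k\<in>{0}. of_real (G (k - 1) + G (k + 1) - y * G k) * v (n - k))"
        by (intro infsum_cong_neutral) (auto simp: rec)
      also have "\<dots> = v n" by (simp only: rec) simp
      finally show ?thesis .
    qed
    then show "v = T u" by auto
  qed
  then have "bij_betw T ell2 ell2" using inj mem by (auto simp: bij_betw_def)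
  then have "complex_of_real x \<in> resolvent_set (const_jacobi 1 \<beta>)"
    using low unfolding resolvent_set_def mem_Collect_eq T_def by meson
  then show False using x by (simp add: spectrum_def)
qed

lemma spectrum_const_jacobi: "spectrum (const_jacobi 1 \<beta>) = {\<beta> - 2..\<beta> + 2}"
proof (intro set_eqI iffI)
  fix x assume "x \<in> spectrum (const_jacobi 1 \<beta>)"
  then show "x \<in> {\<beta> - 2..\<beta> + 2}" using spectrum_const_jacobi_subset[of x \<beta>] by auto
next
  fix x assume "x \<in> {\<beta> - 2..\<beta> + 2}"
  then show "x \<in> spectrum (const_jacobi 1 \<beta>)" by (intro spectrum_const_jacobi_supset) auto
qed

section \<open>Discriminant of constant Jacobi matrices\<close>

text \<open>The powers of the transfer matrix have Chebyshev polynomials of the second kind, sin((k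
  + 1) \<theta>) / sin \<theta>, as entries. With sin \<theta> multiplied out, the induction is the
  addition theorem.\<close>

lemma discriminant_const_jacobi:
  assumes s: "sin \<theta> \<noteq> 0"
  shows "discriminant k (const_jacobi 1 \<beta>) (\<beta> + 2 * cos \<theta>) = 2 * cos (real k * \<theta>)"
proof -
  define T where "T = (\<lambda>k. transfer_prod k (const_jacobi 1 \<beta>) (\<beta> + 2 * cos \<theta>))"
  have "sin \<theta> * T k $ 1 $ 1 = sin ((real k + 1) * \<theta>)
    \<and> sin \<theta> * T k $ 1 $ 2 = - sin (real k * \<theta>)
    \<and> sin \<theta> * T k $ 2 $ 1 = sin (real k * \<theta>)
    \<and> sin \<theta> * T k $ 2 $ 2 = - sin ((real k - 1) * \<theta>)" for k
  proof (induction k)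
    case 0
    then show ?case by (simp add: T_def mat_def)
  next
    case (Suc k)
    have T: "T (Suc k) $ 1 $ j = 2 * cos \<theta> * T k $ 1 $ j - T k $ 2 $ j"
      "T (Suc k) $ 2 $ j = T k $ 1 $ j" for j
      by (simp_all add: T_def transfer_def const_jacobi_def matrix_matrix_mult_def UNIV_2)
    have a: "2 * cos \<theta> * sin u - sin (u - \<theta>) = sin (u + \<theta>)" for u
      by (simp add: sin_add sin_diff)
    have S: "sin \<theta> * T (Suc k) $ 1 $ j = 2 * cos \<theta> * (sin \<theta> * T k $ 1 $ j) - sin \<theta> * T k $ 2 $ j" for j
      by (simp add: T algebra_simps)
    have u: "(real k + 1) * \<theta> - \<theta> = real k * \<theta>" "(real k + 1) * \<theta> + \<theta> = (real (Suc k) + 1) * \<theta>"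
      "real k * \<theta> - \<theta> = (real k - 1) * \<theta>" "real k * \<theta> + \<theta> = real (Suc k) * \<theta>"
      by (simp_all add: algebra_simps)
    have "sin \<theta> * T (Suc k) $ 1 $ 1 = sin ((real (Suc k) + 1) * \<theta>)"
      using Suc a[of "(real k + 1) * \<theta>", unfolded u] by (simp only: S)
    moreover have "sin \<theta> * T (Suc k) $ 1 $ 2 = - sin (real (Suc k) * \<theta>)"
      using Suc a[of "real k * \<theta>", unfolded u] by (simp only: S mult_minus_right)
    ultimately show ?case using Suc by (simp add: T(2) add.commute)
  qed
  from this[of k] have "sin \<theta> * trace (T k) = sin ((real k + 1) * \<theta>) - sin ((real k - 1) * \<theta>)"
    by (simp add: trace_def UNIV_2 distrib_left)
  also have "\<dots> = sin \<theta> * (2 * cos (real k * \<theta>))"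
    by (simp add: algebra_simps sin_add sin_diff)
  finally show ?thesis using s by (simp add: discriminant_def T_def)
qed

section \<open>A Hilbert-type inequality\<close>

lemma bessel_inequality:
  fixes f :: "'a \<Rightarrow> real" and e :: "'i \<Rightarrow> 'a \<Rightarrow> real"
  assumes c: "c > 0" and I: "finite I"
    and f2: "integrable M (\<lambda>x. (f x)\<^sup>2)"
    and fe: "\<And>i. i \<in> I \<Longrightarrow> integrable M (\<lambda>x. f x * e i x)"
    and ee: "\<And>i j. i \<in> I \<Longrightarrow> j \<in> I \<Longrightarrow> integrable M (\<lambda>x. e i x * e j x)"
    and orth: "\<And>i j. i \<in> I \<Longrightarrow> j \<in> I \<Longrightarrow> (\<integral>x. e i x * e j x \<partial>M) = (if i = j then c else 0)"
  shows "(\<Sum>i\<in>I. (\<integral>x. f x * e i x \<partial>M)\<^sup>2) \<le> c * (\<integral>x. (f x)\<^sup>2 \<partial>M)"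
proof -
  define a where "a = (\<lambda>i. (\<integral>x. f x * e i x \<partial>M) / c)"
  have ex: "(f x - (\<Sum>i\<in>I. a i * e i x))\<^sup>2
      = (f x)\<^sup>2 - 2 * (\<Sum>i\<in>I. a i * (f x * e i x)) + (\<Sum>i\<in>I. \<Sum>j\<in>I. (a i * a j) * (e i x * e j x))" for x
  proof -
    have "(\<Sum>i\<in>I. a i * e i x)\<^sup>2 = (\<Sum>i\<in>I. \<Sum>j\<in>I. (a i * a j) * (e i x * e j x))"
      by (simp add: power2_eq_square sum_product algebra_simps)
    moreover have "f x * (\<Sum>i\<in>I. a i * e i x) = (\<Sum>i\<in>I. a i * (f x * e i x))"
      by (simp add: sum_distrib_left algebra_simps)
    ultimately show ?thesis by (simp add: power2_diff algebra_simps)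
  qed
  have "0 \<le> (\<integral>x. (f x - (\<Sum>i\<in>I. a i * e i x))\<^sup>2 \<partial>M)" by simp
  also have "\<dots> = (\<integral>x. (f x)\<^sup>2 \<partial>M) - 2 * (\<Sum>i\<in>I. a i * (\<integral>x. f x * e i x \<partial>M))
      + (\<Sum>i\<in>I. \<Sum>j\<in>I. (a i * a j) * (\<integral>x. e i x * e j x \<partial>M))"
    unfolding ex
    by (subst Bochner_Integration.integral_add Bochner_Integration.integral_diff Bochner_Integration.integral_sum integral_mult_right_zero,
        (auto intro!: f2 fe ee integrable_mult_right Bochner_Integration.integrable_sum Bochner_Integration.integrable_diff)[])+
      (auto simp: Bochner_Integration.integral_sum f2 fe ee)
  also have "(\<Sum>i\<in>I. \<Sum>j\<in>I. (a i * a j) * (\<integral>x. e i x * e j x \<partial>M)) = (\<Sum>i\<in>I. \<Sum>j\<in>I. if i = j then c * (a i)\<^sup>2 else 0)"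
    by (intro sum.cong refl) (auto simp: orth power2_eq_square)
  also have "\<dots> = (\<Sum>i\<in>I. c * (a i)\<^sup>2)" using I by (simp add: sum.delta)
  also have "(\<Sum>i\<in>I. a i * (\<integral>x. f x * e i x \<partial>M)) = (\<Sum>i\<in>I. c * (a i)\<^sup>2)"
    using c by (intro sum.cong) (auto simp: a_def power2_eq_square)
  finally have "(\<Sum>i\<in>I. c * (a i)\<^sup>2) \<le> (\<integral>x. (f x)\<^sup>2 \<partial>M)" by simp
  then have "c * (\<Sum>i\<in>I. c * (a i)\<^sup>2) \<le> c * (\<integral>x. (f x)\<^sup>2 \<partial>M)" using c by simp
  also have "c * (\<Sum>i\<in>I. c * (a i)\<^sup>2) = (\<Sum>i\<in>I. (\<integral>x. f x * e i x \<partial>M)\<^sup>2)"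
    using c by (simp add: a_def sum_distrib_left power2_eq_square)
  finally show ?thesis .
qed

section \<open>Fourier coefficients at half-integer frequencies\<close>

abbreviation circ :: "real measure" where
  "circ \<equiv> restrict_space lborel {- pi..pi}"

lemma circle_measure_space: "measure circ (space circ) = 2 * pi"
  by (simp add: measure_restrict_space space_restrict_space)

lemma finite_circle_measure: "finite_measure circ"
  by (intro finite_measureI) (simp add: emeasure_restrict_space space_restrict_space)

lemma circle_measurable [measurable (raw)]:
  "f \<in> borel_measurable borel \<Longrightarrow> f \<in> borel_measurable circ"
  by (rule measurable_restrict_space1) simp

lemma circle_integral_cos:
  fixes j :: int
  shows "(\<integral>x. cos (of_int j * x) \<partial>circ) = (if j = 0 then 2 * pi else 0)"
proof (cases "j = 0")
  case True
  then show ?thesis using circle_measure_space by simp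
next
  case False
  have "(\<integral>x. cos (of_int j * x) \<partial>circ) = (\<integral>x. indicator {-pi..pi} x *\<^sub>R cos (of_int j * x) \<partial>lborel)"
    by (rule integral_restrict_space) simp
  also have "\<dots> = sin (of_int j * pi) / of_int j - sin (of_int j * (- pi)) / of_int j"
    using False by (intro integral_FTC_Icc) (auto intro!: derivative_eq_intros continuous_intros simp flip: has_real_derivative_iff_has_vector_derivative)
  also have "\<dots> = 0" by (simp add: sin_int_times_real sin_zero_iff_int2)
  finally show ?thesis using False by simp
qed

lemma circle_integrable:
  fixes f :: "real \<Rightarrow> real"
  assumes "f \<in> borel_measurable borel" "\<And>x. \<bar>f x\<bar> \<le> B"
  shows "integrable circ f"
  using assms by (intro finite_measure.integrable_const_bound[OF finite_circle_measure, of _ B]) auto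

text \<open>The frequencies m + 1/2 are those whose sine sums produce 1 / (2 sin(t / 2)). Products
  of two such functions have the integer frequencies i - j and i + j + 1, and the second never
  vanishes; hence orthogonality over a full period with squared norm \<pi>.\<close>

lemma circle_half_integer_bessel:
  fixes f :: "real \<Rightarrow> real"
  assumes f [measurable]: "f \<in> borel_measurable borel" and B: "\<And>x. \<bar>f x\<bar> \<le> B"
  shows "(\<Sum>m<n. (\<integral>x. f x * sin ((real m + 1/2) * x) \<partial>circ)\<^sup>2) \<le> pi * (\<integral>x. (f x)\<^sup>2 \<partial>circ)" (is ?S)
    and "(\<Sum>m<n. (\<integral>x. f x * cos ((real m + 1/2) * x) \<partial>circ)\<^sup>2) \<le> pi * (\<integral>x. (f x)\<^sup>2 \<partial>circ)" (is ?C)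
proof -
  have B0: "0 \<le> B" using B[of 0] by simp
  have f2: "integrable circ (\<lambda>x. (f x)\<^sup>2)"
    by (rule circle_integrable[of _ "B\<^sup>2"]) (use B power_mono[OF B, of _ 2] in auto)
  have fe: "integrable circ (\<lambda>x. f x * e x)"
    if "e \<in> borel_measurable borel" "\<And>x. \<bar>e x\<bar> \<le> 1" for e
    by (rule circle_integrable[of _ "B * 1"]) (use that B B0 in \<open>auto simp: abs_mult simp del: mult_1_right intro!: mult_mono\<close>)
  have ee: "integrable circ (\<lambda>x. d x * e x)"
    if "d \<in> borel_measurable borel" "e \<in> borel_measurable borel" "\<And>x. \<bar>d x\<bar> \<le> 1" "\<And>x. \<bar>e x\<bar> \<le> 1" for d e :: "real \<Rightarrow> real"
    by (rule circle_integrable[of _ "1 * 1"]) (use that in \<open>auto simp: abs_mult intro!: mult_le_one\<close>)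
  have ci: "integrable circ (\<lambda>x. cos (k * x))" for k
    by (rule circle_integrable[of _ 1]) auto
  have cc: "cos ((real i + 1/2) * x) * cos ((real j + 1/2) * x)
      = (cos (of_int (int i - int j) * x) + cos (of_int (int i + int j + 1) * x)) / 2"
    and ss: "sin ((real i + 1/2) * x) * sin ((real j + 1/2) * x)
      = (cos (of_int (int i - int j) * x) - cos (of_int (int i + int j + 1) * x)) / 2" for i j x
    unfolding cos_times_cos sin_times_sin by (simp_all add: algebra_simps)
  have "(\<integral>x. cos ((real i + 1/2) * x) * cos ((real j + 1/2) * x) \<partial>circ) = (if i = j then pi else 0)"
    and "(\<integral>x. sin ((real i + 1/2) * x) * sin ((real j + 1/2) * x) \<partial>circ) = (if i = j then pi else 0)" for i j
    unfolding cc ss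
    by (simp_all only: integral_divide_zero Bochner_Integration.integral_add Bochner_Integration.integral_diff ci circle_integral_cos) auto
  then show ?S ?C
    by (intro bessel_inequality[where e = "\<lambda>m x. sin ((real m + 1/2) * x)"] bessel_inequality[where e = "\<lambda>m x. cos ((real m + 1/2) * x)"]
        f2 fe ee; force)+
qed

lemma circle_product_integral:
  fixes u v :: "real \<Rightarrow> real"
  assumes [measurable]: "u \<in> borel_measurable borel" "v \<in> borel_measurable borel"
    and b: "\<And>x. \<bar>u x\<bar> \<le> B" "\<And>x. \<bar>v x\<bar> \<le> B"
  shows "integrable (circ \<Otimes>\<^sub>M circ) (\<lambda>z. u (fst z) * v (snd z))"
    and "(\<integral>z. u (fst z) * v (snd z) \<partial>(circ \<Otimes>\<^sub>M circ))
      = (\<integral>x. u x \<partial>circ) * (\<integral>x. v x \<partial>circ)"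
proof -
  interpret M: finite_measure circ by (rule finite_circle_measure)
  interpret P: pair_sigma_finite circ circ ..
  interpret PF: finite_measure "circ \<Otimes>\<^sub>M circ"
    by (rule finite_measure_pair_measure) (rule finite_circle_measure)+
  have [measurable]: "(\<lambda>z. u (fst z)) \<in> borel_measurable (circ \<Otimes>\<^sub>M circ)"
    "(\<lambda>z. v (snd z)) \<in> borel_measurable (circ \<Otimes>\<^sub>M circ)"
    using assms(1,2) by (auto intro!: measurable_compose[OF measurable_fst] measurable_compose[OF measurable_snd] circle_measurable)
  show i: "integrable (circ \<Otimes>\<^sub>M circ) (\<lambda>z. u (fst z) * v (snd z))"
    by (rule PF.integrable_const_bound[of _ "B * B"])
      (use b in \<open>auto simp: abs_mult intro!: mult_mono order_trans[OF abs_ge_zero b(1)]\<close>)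
  show "(\<integral>z. u (fst z) * v (snd z) \<partial>(circ \<Otimes>\<^sub>M circ))
      = (\<integral>x. u x \<partial>circ) * (\<integral>x. v x \<partial>circ)"
    by (subst P.integral_fst'[OF i, symmetric]) simp
qed

lemma sum_sin_half_integers:
  fixes t :: real
  shows "2 * sin (t / 2) * (\<Sum>m<n. sin ((real m + 1/2) * t)) = 1 - cos (real n * t)"
proof (induction n)
  case (Suc n)
  have u: "(real n + 1/2) * t - t / 2 = real n * t" "(real n + 1/2) * t + t / 2 = real (Suc n) * t"
    by (simp_all add: algebra_simps)
  have "2 * sin (t / 2) * sin ((real n + 1/2) * t) = cos (real n * t) - cos (real (Suc n) * t)"
    unfolding u[symmetric] cos_add cos_diff by simp
  then show ?case unfolding sum.lessThan_Suc distrib_left Suc by simp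
qed simp

lemma abs_sum_cos_le:
  fixes t :: real
  assumes "sin (t / 2) \<noteq> 0"
  shows "\<bar>\<Sum>n<K. cos (real n * t)\<bar> \<le> 1 / \<bar>sin (t / 2)\<bar>"
proof -
  have "2 * sin (t / 2) * (\<Sum>n<K. cos (real n * t)) = sin ((real K - 1/2) * t) + sin (t / 2)"
  proof (induction K)
    case (Suc K)
    have u: "(real (Suc K) - 1/2) * t = real K * t + t / 2" "(real K - 1/2) * t = real K * t - t / 2"
      by (simp_all add: algebra_simps)
    have "2 * sin (t / 2) * cos (real K * t) = sin ((real (Suc K) - 1/2) * t) - sin ((real K - 1/2) * t)"
      unfolding u sin_add sin_diff by simp
    then show ?case unfolding sum.lessThan_Suc distrib_left Suc by simp
  qed (simp add: algebra_simps)
  then have "2 * \<bar>sin (t / 2)\<bar> * \<bar>\<Sum>n<K. cos (real n * t)\<bar> = \<bar>sin ((real K - 1/2) * t) + sin (t / 2)\<bar>"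
    by (metis abs_mult abs_numeral)
  also have "\<dots> \<le> 2"
    using abs_sin_le_one[of "(real K - 1/2) * t"] abs_sin_le_one[of "t / 2"] by linarith
  finally show ?thesis using assms by (simp add: field_simps)
qed

text \<open>Compares the kernel 1/t with its periodic version 1 / (2 sin(t / 2)). For points of
  [-2, 2] one has |t| \<le> 4 < 2 \<pi>, so t = 0 is the only singularity. With s = |t / 2| \<le> 2
  the Taylor error s^3 / 6 is at most 2 s / 3, whence sin s \<ge> s / 3.\<close>

lemma half_sine_bounds:
  fixes t :: real
  assumes t: "t \<noteq> 0" "\<bar>t\<bar> \<le> 4"
  shows "\<bar>t / (2 * sin (t / 2))\<bar> \<le> 3" "\<bar>1 / (2 * sin (t / 2)) - 1 / t\<bar> \<le> 1 / 2" "sin (t / 2) \<noteq> 0"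
proof -
  define s where "s = \<bar>t / 2\<bar>"
  have s: "0 < s" "s \<le> 2" using t by (auto simp: s_def)
  have "\<bar>sin s - s\<bar> \<le> s ^ 3 / 6"
    using Maclaurin_sin_bound[of s 3] s by (simp add: eval_nat_numeral sin_coeff_def)
  moreover have "s ^ 3 \<le> 4 * s"
    using mult_right_mono[OF power_mono[of s 2 2], of s] s by (simp add: eval_nat_numeral)
  moreover have "s ^ 3 \<le> 2 * s\<^sup>2"
    using mult_right_mono[of s 2 "s\<^sup>2"] s by (simp add: eval_nat_numeral)
  ultimately have lo: "sin s \<ge> s / 3" and up: "\<bar>sin s - s\<bar> \<le> s\<^sup>2 / 3" by linarith+
  have pos: "sin s > 0" using lo s by linarith
  have 1: "\<bar>s / sin s\<bar> \<le> 3" using lo pos s by (simp add: field_simps)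
  have "\<bar>1 / (2 * sin s) - 1 / (2 * s)\<bar> = \<bar>sin s - s\<bar> / (2 * s * sin s)"
    using pos s by (simp add: abs_mult divide_simps)
  also have "\<dots> \<le> (s\<^sup>2 / 3) / (2 * s * (s / 3))"
    using lo up s by (intro frac_le mult_left_mono) auto
  also have "\<dots> = 1 / 2" using s by (simp add: power2_eq_square)
  finally have 2: "\<bar>1 / (2 * sin s) - 1 / (2 * s)\<bar> \<le> 1 / 2" .
  have c: "t = 2 * s \<or> t = - (2 * s)" by (auto simp: s_def)
  then show "\<bar>t / (2 * sin (t / 2))\<bar> \<le> 3" using 1 by auto
  show "\<bar>1 / (2 * sin (t / 2)) - 1 / t\<bar> \<le> 1 / 2"
    using c
  proof
    assume "t = - (2 * s)"
    then have "\<bar>1 / (2 * sin (t / 2)) - 1 / t\<bar> = \<bar>- (1 / (2 * sin s) - 1 / (2 * s))\<bar>" by simp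
    then show ?thesis using 2 unfolding abs_minus_cancel by simp
  qed (use 2 in auto)
  show "sin (t / 2) \<noteq> 0" using c pos by auto
qed

text \<open>Expanding \<open>1 / (2 sin (t / 2))\<close> as the Cesaro limit of \<open>\<Sum> sin ((m + 1/2) t)\<close> splits the
  bilinear form into products of Fourier coefficients, to which Bessel's inequality applies.\<close>

theorem hilbert_kernel_inequality:
  fixes f g :: "real \<Rightarrow> real" and H :: "real \<times> real \<Rightarrow> real"
  assumes f [measurable]: "f \<in> borel_measurable borel" and g [measurable]: "g \<in> borel_measurable borel"
    and fB: "\<And>x. \<bar>f x\<bar> \<le> B" and gB: "\<And>x. \<bar>g x\<bar> \<le> B"
    and supp: "\<And>x. \<bar>x\<bar> > 2 \<Longrightarrow> f x = 0" "\<And>x. \<bar>x\<bar> > 2 \<Longrightarrow> g x = 0"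
    and H [measurable]: "H \<in> borel_measurable (circ \<Otimes>\<^sub>M circ)"
    and HB: "\<And>z. \<bar>H z\<bar> \<le> B"
    and kernel: "\<And>x y. (x - y) * H (x, y) = f x * g y - g x * f y"
  shows "(\<integral>z. H z \<partial>(circ \<Otimes>\<^sub>M circ))
    \<le> 3 * pi * ((\<integral>x. (f x)\<^sup>2 \<partial>circ) + (\<integral>x. (g x)\<^sup>2 \<partial>circ))"
proof -
  let ?P = "circ \<Otimes>\<^sub>M circ"
  interpret M: finite_measure circ by (rule finite_circle_measure)
  interpret P: pair_sigma_finite circ circ ..
  interpret PF: finite_measure ?P
    by (rule finite_measure_pair_measure) (rule finite_circle_measure)+
  have B0: "B \<ge> 0" using fB[of 0] by simp
  have [measurable]: "fst \<in> borel_measurable ?P" "snd \<in> borel_measurable ?P"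
    using measurable_compose[OF measurable_fst circle_measurable[of "\<lambda>x. x"]]
      measurable_compose[OF measurable_snd circle_measurable[of "\<lambda>x. x"]] by auto
  have [measurable]: "(\<lambda>z. u (fst z)) \<in> borel_measurable ?P" "(\<lambda>z. u (snd z)) \<in> borel_measurable ?P"
    if "u \<in> borel_measurable borel" for u :: "real \<Rightarrow> real"
    using measurable_compose[OF measurable_fst circle_measurable[OF that]]
      measurable_compose[OF measurable_snd circle_measurable[OF that]] by auto
  define E where "E = (\<integral>x. (f x)\<^sup>2 \<partial>circ) + (\<integral>x. (g x)\<^sup>2 \<partial>circ)"
  define N where "N = (\<lambda>z. f (fst z) * g (snd z) - g (fst z) * f (snd z))"
  define t where "t = (\<lambda>z::real \<times> real. fst z - snd z)"
  \<comment> \<open>Off the diagonal H = N / t; \<open>G\<close> has the periodic kernel instead,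
    which can be expanded in sines.\<close>
  define G where "G = (\<lambda>z. N z / (2 * sin (t z / 2)))"
  have [measurable]: "N \<in> borel_measurable ?P" "t \<in> borel_measurable ?P" "G \<in> borel_measurable ?P"
    unfolding N_def t_def G_def by measurable
  have NH: "N z = t z * H z" for z using kernel[of "fst z" "snd z"] by (simp add: N_def t_def)
  have N0: "N z = 0" if "t z = 0 \<or> \<bar>t z\<bar> > 4" for z
  proof (cases "t z = 0")
    case False
    then have "\<bar>fst z\<bar> > 2 \<or> \<bar>snd z\<bar> > 2" using that by (auto simp: t_def)
    then show ?thesis using supp by (auto simp: N_def)
  qed (simp add: NH)
  have GB: "\<bar>G z\<bar> \<le> 3 * B" for z
  proof (cases "t z = 0 \<or> \<bar>t z\<bar> > 4")
    case False
    have "\<bar>G z\<bar> = \<bar>t z / (2 * sin (t z / 2))\<bar> * \<bar>H z\<bar>" by (simp add: G_def NH abs_mult)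
    also have "\<dots> \<le> 3 * B"
      using False by (intro mult_mono half_sine_bounds HB) auto
    finally show ?thesis .
  qed (use B0 in \<open>simp add: G_def N0\<close>)
  have iG: "integrable ?P G"
    by (rule PF.integrable_const_bound[of _ "3 * B"]) (use GB in auto)
  have iGc: "integrable ?P (\<lambda>z. G z * c z)" if [measurable]: "c \<in> borel_measurable ?P" and "\<And>z. \<bar>c z\<bar> \<le> 1" for c
  proof (rule PF.integrable_const_bound[of _ "3 * B"])
    show "AE z in ?P. norm (G z * c z) \<le> 3 * B"
      using mult_mono[OF GB that(2)] B0 by (auto simp: abs_mult)
  qed measurable
  \<comment> \<open>A finite sine sum yields 1 - cos(n t) in place of 1. The surplus cosine is
    averaged away over n below.\<close>
  have trig: "(\<integral>z. G z * (1 - cos (real n * t z)) \<partial>?P) \<le> 2 * pi * E" for n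
  proof -
    define s where "s = (\<lambda>m x. sin ((real m + 1/2) * x))"
    define c where "c = (\<lambda>m x. cos ((real m + 1/2) * x))"
    define S where "S = (\<lambda>u m. \<integral>x. u x * s m x \<partial>circ)"
    define C where "C = (\<lambda>u m. \<integral>x. u x * c m x \<partial>circ)"
    have prod: "integrable ?P (\<lambda>z. (u (fst z) * d (fst z)) * (v (snd z) * e (snd z)))"
      "(\<integral>z. (u (fst z) * d (fst z)) * (v (snd z) * e (snd z)) \<partial>?P)
        = (\<integral>x. u x * d x \<partial>circ) * (\<integral>x. v x * e x \<partial>circ)"
      if "u \<in> {f, g}" "v \<in> {f, g}" "d \<in> {s m, c m}" "e \<in> {s m, c m}" for u v d e m
    proof -
      have [measurable]: "u \<in> borel_measurable borel" "v \<in> borel_measurable borel"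
        "d \<in> borel_measurable borel" "e \<in> borel_measurable borel"
        using that unfolding s_def c_def by auto
      have "\<bar>u x * d x\<bar> \<le> B * 1" "\<bar>v x * e x\<bar> \<le> B * 1" for x
        unfolding abs_mult using that fB[of x] gB[of x] B0 by (intro mult_mono; auto simp: s_def c_def)+
      then show "integrable ?P (\<lambda>z. (u (fst z) * d (fst z)) * (v (snd z) * e (snd z)))"
        "(\<integral>z. (u (fst z) * d (fst z)) * (v (snd z) * e (snd z)) \<partial>?P)
        = (\<integral>x. u x * d x \<partial>circ) * (\<integral>x. v x * e x \<partial>circ)"
        by (intro circle_product_integral[where B = "B * 1"]; auto)+
    qed
    define body where "body = (\<lambda>m z.
        (f (fst z) * s m (fst z)) * (g (snd z) * c m (snd z))
        - (f (fst z) * c m (fst z)) * (g (snd z) * s m (snd z))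
        - (g (fst z) * s m (fst z)) * (f (snd z) * c m (snd z))
        + (g (fst z) * c m (fst z)) * (f (snd z) * s m (snd z)))"
    have "G z * (1 - cos (real n * t z)) = N z * (\<Sum>m<n. sin ((real m + 1/2) * t z))" for z
    proof (cases "t z = 0 \<or> \<bar>t z\<bar> > 4")
      case False
      then have "sin (t z / 2) \<noteq> 0" by (intro half_sine_bounds) auto
      then show ?thesis unfolding sum_sin_half_integers[symmetric] by (simp add: G_def)
    qed (simp add: G_def N0)
    also have "N z * (\<Sum>m<n. sin ((real m + 1/2) * t z)) = (\<Sum>m<n.
        (f (fst z) * s m (fst z)) * (g (snd z) * c m (snd z))
        - (f (fst z) * c m (fst z)) * (g (snd z) * s m (snd z))
        - (g (fst z) * s m (fst z)) * (f (snd z) * c m (snd z))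
        + (g (fst z) * c m (fst z)) * (f (snd z) * s m (snd z)))" for z
      unfolding sum_distrib_left N_def t_def s_def c_def right_diff_distrib sin_diff
      by (intro sum.cong refl) (simp add: algebra_simps)
    finally have Gsum: "G z * (1 - cos (real n * t z)) = (\<Sum>m<n. body m z)" for z
      unfolding body_def .
    have "integrable ?P (body m)" "(\<integral>z. body m z \<partial>?P) = S f m * C g m - C f m * S g m - S g m * C f m + C g m * S f m" for m
    proof -
      note p1 = prod[where u = f and v = g and d = "s m" and e = "c m" and m = m, simplified]
      note p2 = prod[where u = f and v = g and d = "c m" and e = "s m" and m = m, simplified]
      note p3 = prod[where u = g and v = f and d = "s m" and e = "c m" and m = m, simplified]
      note p4 = prod[where u = g and v = f and d = "c m" and e = "s m" and m = m, simplified]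
      show "integrable ?P (body m)" unfolding body_def
        by (intro Bochner_Integration.integrable_add Bochner_Integration.integrable_diff p1 p2 p3 p4)
      show "(\<integral>z. body m z \<partial>?P) = S f m * C g m - C f m * S g m - S g m * C f m + C g m * S f m"
        unfolding body_def S_def C_def
        by (simp only: Bochner_Integration.integral_add Bochner_Integration.integral_diff
            Bochner_Integration.integrable_diff p1 p2 p3 p4)
    qed
    then have "(\<integral>z. G z * (1 - cos (real n * t z)) \<partial>?P)
      = (\<Sum>m<n. S f m * C g m - C f m * S g m - S g m * C f m + C g m * S f m)"
      unfolding Gsum by (subst Bochner_Integration.integral_sum) auto
    also have "\<dots> \<le> (\<Sum>m<n. (S f m)\<^sup>2 + (C g m)\<^sup>2 + ((C f m)\<^sup>2 + (S g m)\<^sup>2))"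
    proof (rule sum_mono)
      fix m
      show "S f m * C g m - C f m * S g m - S g m * C f m + C g m * S f m
          \<le> (S f m)\<^sup>2 + (C g m)\<^sup>2 + ((C f m)\<^sup>2 + (S g m)\<^sup>2)"
        using zero_le_power2[of "S f m - C g m"] zero_le_power2[of "C f m + S g m"]
        by (simp add: power2_eq_square algebra_simps)
    qed
    also have "\<dots> \<le> (pi * (\<integral>x. (f x)\<^sup>2 \<partial>circ) + pi * (\<integral>x. (g x)\<^sup>2 \<partial>circ))
       + (pi * (\<integral>x. (f x)\<^sup>2 \<partial>circ) + pi * (\<integral>x. (g x)\<^sup>2 \<partial>circ))"
      unfolding sum.distrib S_def C_def s_def c_def
      by (intro add_mono circle_half_integer_bessel[OF f fB] circle_half_integer_bessel[OF g gB])
    finally show ?thesis by (simp add: E_def algebra_simps)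
  qed
  \<comment> \<open>Ces\<agrave>ro means of cos(n t) tend to 0 pointwise and are bounded by 1, so
    dominated convergence applies although cos(n t) itself need not converge.\<close>
  define avg where "avg = (\<lambda>K z. (\<Sum>n<K. cos (real n * t z)) / real K)"
  have avg_le: "\<bar>avg K z\<bar> \<le> 1" for K z
  proof -
    have "\<bar>\<Sum>n<K. cos (real n * t z)\<bar> \<le> (\<Sum>n<K. 1)"
      by (rule order_trans[OF sum_abs]) (intro sum_mono abs_cos_le_one)
    then show ?thesis by (cases "K = 0") (auto simp: avg_def)
  qed
  have [measurable]: "avg K \<in> borel_measurable ?P" for K unfolding avg_def by measurable
  have avg: "(\<integral>z. G z \<partial>?P) - (\<integral>z. G z * avg K z \<partial>?P) \<le> 2 * pi * E" if "K > 0" for K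
  proof -
    have ic: "integrable ?P (\<lambda>z. G z * cos (real n * t z))" for n
      by (rule iGc) auto
    have "real K * ((\<integral>z. G z \<partial>?P) - (\<integral>z. G z * avg K z \<partial>?P))
        = (\<Sum>n<K. (\<integral>z. G z \<partial>?P) - (\<integral>z. G z * cos (real n * t z) \<partial>?P))"
    proof -
      have "G z * avg K z = (\<Sum>n<K. G z * cos (real n * t z)) / real K" for z
        by (simp add: avg_def sum_distrib_left)
      then have "(\<integral>z. G z * avg K z \<partial>?P) = (\<Sum>n<K. \<integral>z. G z * cos (real n * t z) \<partial>?P) / real K"
        using ic by (simp add: Bochner_Integration.integral_sum)
      then show ?thesis using that by (simp add: sum_subtractf right_diff_distrib)
    qed
    also have "\<dots> \<le> (\<Sum>n<K. 2 * pi * E)"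
      using trig by (intro sum_mono) (simp add: right_diff_distrib Bochner_Integration.integral_diff iG ic)
    finally show ?thesis using that by simp
  qed
  have "(\<lambda>K. \<integral>z. G z * avg K z \<partial>?P) \<longlonglongrightarrow> (\<integral>z. 0 \<partial>?P)"
  proof (rule integral_dominated_convergence[where w = "\<lambda>_. 3 * B"])
    show "AE z in ?P. norm (G z * avg K z) \<le> 3 * B" for K
      using mult_mono[OF GB avg_le] B0 by (auto simp: abs_mult)
    show "AE z in ?P. (\<lambda>K. G z * avg K z) \<longlonglongrightarrow> 0"
    proof (rule AE_I2)
      fix z
      show "(\<lambda>K. G z * avg K z) \<longlonglongrightarrow> 0"
      proof (cases "sin (t z / 2) = 0")
        case False
        have "(\<lambda>K. avg K z) \<longlonglongrightarrow> 0"
        proof (rule Lim_null_comparison)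
          show "\<forall>\<^sub>F K in sequentially. norm (avg K z) \<le> (1 / \<bar>sin (t z / 2)\<bar>) / real K"
            using divide_right_mono[OF abs_sum_cos_le[OF False], of "real K" for K]
            by (intro always_eventually allI) (simp add: avg_def)
          show "(\<lambda>K. (1 / \<bar>sin (t z / 2)\<bar>) / real K) \<longlonglongrightarrow> 0"
            by (rule lim_const_over_n)
        qed
        then show ?thesis by (rule tendsto_mult_right_zero)
      \<comment> \<open>Where sin(t / 2) = 0 the means need not tend to 0, but there
        \<open>G z\<close> is a division by zero and hence 0.\<close>
      qed (simp add: G_def)
    qed
  qed auto
  then have "(\<lambda>K. (\<integral>z. G z \<partial>?P) - (\<integral>z. G z * avg K z \<partial>?P)) \<longlonglongrightarrow> (\<integral>z. G z \<partial>?P) - 0"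
    by (intro tendsto_diff tendsto_const) simp
  then have Gle: "(\<integral>z. G z \<partial>?P) \<le> 2 * pi * E"
    using avg by (intro LIMSEQ_le_const2[where X = "\<lambda>K. (\<integral>z. G z \<partial>?P) - (\<integral>z. G z * avg K z \<partial>?P)"]) (auto intro!: exI[of _ 1])
  have f2: "integrable circ (\<lambda>x. (f x)\<^sup>2)" "integrable circ (\<lambda>x. (g x)\<^sup>2)"
    by (rule circle_integrable[of _ "B\<^sup>2"]; use power_mono[OF fB, of _ 2] power_mono[OF gB, of _ 2] in auto)+
  \<comment> \<open>\<open>Q\<close> pays for replacing 1/t by the periodic kernel: the error is at
    most |N| / 2 \<le> Q, and Q has integral \<pi> E. Together with 2 \<pi> E for \<open>G\<close>
    this gives the constant 3 \<pi>.\<close>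
  define Q where "Q = (\<lambda>z. ((f (fst z))\<^sup>2 + (g (fst z))\<^sup>2) / 4 + ((f (snd z))\<^sup>2 + (g (snd z))\<^sup>2) / 4)"
  have f2B: "\<bar>(f x)\<^sup>2\<bar> \<le> max 1 (B\<^sup>2)" "\<bar>(g x)\<^sup>2\<bar> \<le> max 1 (B\<^sup>2)" for x
    using power_mono[OF fB, of x 2] power_mono[OF gB, of x 2] by auto
  have one: "\<bar>1::real\<bar> \<le> max 1 (B\<^sup>2)" by simp
  have iQ: "integrable ?P Q" "(\<integral>z. Q z \<partial>?P) = pi * E"
  proof -
    note i = circle_product_integral[of "\<lambda>x. (f x)\<^sup>2" "\<lambda>_. 1", OF _ _ f2B(1) one, simplified]
      circle_product_integral[of "\<lambda>x. (g x)\<^sup>2" "\<lambda>_. 1", OF _ _ f2B(2) one, simplified]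
      circle_product_integral[of "\<lambda>_. 1" "\<lambda>x. (f x)\<^sup>2", OF _ _ one f2B(1), simplified]
      circle_product_integral[of "\<lambda>_. 1" "\<lambda>x. (g x)\<^sup>2", OF _ _ one f2B(2), simplified]
    show "integrable ?P Q" unfolding Q_def using i by auto
    show "(\<integral>z. Q z \<partial>?P) = pi * E"
      unfolding Q_def E_def using i circle_measure_space by (simp add: algebra_simps)
  qed
  have le: "AE z in ?P. H z \<le> G z + Q z"
  proof -
    \<comment> \<open>On the diagonal the kernel identity says nothing about \<open>H\<close>; the
      diagonal is a null set.\<close>
    have "AE z in ?P. t z \<noteq> 0"
    proof (rule P.AE_pair_measure)
      show "{z \<in> space ?P. t z \<noteq> 0} \<in> sets ?P" by measurable
      have "AE y in circ. t (x, y) \<noteq> 0" for x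
      proof (subst AE_restrict_space_iff)
        show "AE y in lborel. y \<in> {- pi..pi} \<longrightarrow> t (x, y) \<noteq> 0"
          using AE_lborel_singleton[of x] by eventually_elim (simp add: t_def)
      qed simp
      then show "AE x in circ. AE y in circ. t (x, y) \<noteq> 0" by simp
    qed
    then show ?thesis
    proof (rule AE_mp, intro AE_I2 impI)
      fix z assume tz: "t z \<noteq> 0"
      show "H z \<le> G z + Q z"
      proof (cases "\<bar>t z\<bar> > 4")
        case False
        have "H z - G z = - (N z * (1 / (2 * sin (t z / 2)) - 1 / t z))"
          using tz by (simp add: G_def NH right_diff_distrib)
        also have "\<dots> \<le> \<bar>N z\<bar> * \<bar>1 / (2 * sin (t z / 2)) - 1 / t z\<bar>"
          unfolding abs_mult[symmetric] by (rule abs_ge_minus_self)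
        also have "\<dots> \<le> \<bar>N z\<bar> * (1 / 2)"
          using tz False by (intro mult_left_mono half_sine_bounds) auto
        also have "\<bar>N z\<bar> \<le> 2 * Q z"
        proof (rule abs_leI)
          show "N z \<le> 2 * Q z"
            using zero_le_power2[of "f (fst z) - g (snd z)"] zero_le_power2[of "g (fst z) + f (snd z)"]
            by (simp add: N_def Q_def power2_eq_square field_simps)
          show "- N z \<le> 2 * Q z"
            using zero_le_power2[of "f (fst z) + g (snd z)"] zero_le_power2[of "g (fst z) - f (snd z)"]
            by (simp add: N_def Q_def power2_eq_square field_simps)
        qed
        finally show ?thesis by simp
      next
        case True
        then have "H z = 0" "G z = 0" using N0[of z] NH[of z] tz by (auto simp: G_def)
        then show ?thesis by (simp add: Q_def)
      qed
    qed
  qed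
  have "(\<integral>z. H z \<partial>?P) \<le> (\<integral>z. G z + Q z \<partial>?P)"
  proof (rule integral_mono_AE[OF _ _ le])
    show "integrable ?P H" by (rule PF.integrable_const_bound[of _ B]) (use HB in auto)
    show "integrable ?P (\<lambda>z. G z + Q z)" by (intro Bochner_Integration.integrable_add iG iQ)
  qed
  also have "\<dots> \<le> 2 * pi * E + pi * E"
    unfolding Bochner_Integration.integral_add[OF iG iQ(1)] iQ(2) using Gle by (rule add_right_mono)
  finally show ?thesis by (simp add: E_def algebra_simps)
qed

lemma poly_bounded_on_Icc:
  fixes p :: "real poly"
  shows "\<exists>B\<ge>0. \<forall>x. \<bar>indicator {c..d} x * poly p x\<bar> \<le> B"
proof -
  have "bounded (poly p ` {c..d})"
    by (intro compact_imp_bounded compact_continuous_image continuous_intros) auto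
  then obtain B where "\<And>x. x \<in> {c..d} \<Longrightarrow> \<bar>poly p x\<bar> \<le> B"
    unfolding bounded_iff by (metis image_eqI real_norm_def)
  then have "\<bar>indicator {c..d} x * poly p x\<bar> \<le> max B 0" for x
    by (cases "x \<in> {c..d}") (auto simp: le_max_iff_disj)
  then show ?thesis by (intro exI[of _ "max B 0"]) auto
qed

lemma circle_integral_indicator:
  fixes f :: "real \<Rightarrow> real"
  assumes "- 2 \<le> c" "d \<le> 2"
  shows "(\<integral>x. indicator {c..d} x * f x \<partial>circ) = (LINT x:{c..d}|lborel. f x)"
proof -
  have "(\<integral>x. indicator {c..d} x * f x \<partial>circ)
      = (\<integral>x. indicator {-pi..pi} x *\<^sub>R (indicator {c..d} x * f x) \<partial>lborel)"
    by (rule integral_restrict_space) simp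
  also have "\<dots> = (\<integral>x. indicator {c..d} x *\<^sub>R f x \<partial>lborel)"
    using assms pi_gt3 by (intro Bochner_Integration.integral_cong) (auto simp: indicator_def)
  finally show ?thesis by (simp add: set_lebesgue_integral_def)
qed

text \<open>By the Christoffel--Darboux formula the left-hand side is a quadratic form with a
  Hilbert-type kernel.\<close>

theorem jacobi_poly_integrals_bound:
  fixes b :: "nat \<Rightarrow> real"
  assumes cd: "- 2 \<le> c" "d \<le> 2"
  shows "(\<Sum>n=1..N. (LINT x:{c..d}|lborel. poly (jacobi_poly b n) x)\<^sup>2)
    \<le> 3 * pi * ((LINT x:{c..d}|lborel. (poly (jacobi_poly b (Suc N)) x)\<^sup>2)
      + (LINT x:{c..d}|lborel. (poly (jacobi_poly b N) x)\<^sup>2))"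
proof -
  define p where "p = (\<lambda>n x. indicator {c..d} x * poly (jacobi_poly b n) x)"
  have pm [measurable]: "p n \<in> borel_measurable borel" for n unfolding p_def by measurable
  have "\<forall>n. \<exists>C\<ge>0. \<forall>x. \<bar>p n x\<bar> \<le> C" unfolding p_def using poly_bounded_on_Icc by blast
  then obtain C where C: "\<And>n. C n \<ge> 0" "\<And>n x. \<bar>p n x\<bar> \<le> C n" by metis
  define B1 where "B1 = (\<Sum>n\<le>Suc N. C n)"
  have B1: "\<bar>p n x\<bar> \<le> B1" if "n \<le> Suc N" for n x
  proof -
    have "C n \<le> B1" unfolding B1_def by (rule member_le_sum) (use C that in auto)
    then show ?thesis using C(2)[of n x] by linarith
  qed
  define B where "B = B1 + real N * (B1 * B1)"
  have B10: "B1 \<ge> 0" unfolding B1_def using C by (intro sum_nonneg)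
  have p2: "(p n x)\<^sup>2 = indicator {c..d} x * (poly (jacobi_poly b n) x)\<^sup>2" for n x
    by (auto simp: p_def indicator_def)
  define H where "H = (\<lambda>z. \<Sum>n=1..N. p n (fst z) * p n (snd z))"
  note prod = circle_product_integral[OF pm pm B1 B1]
  have iH: "(\<integral>z. H z \<partial>(circ \<Otimes>\<^sub>M circ)) = (\<Sum>n=1..N. (\<integral>x. p n x \<partial>circ)\<^sup>2)"
    unfolding H_def power2_eq_square
    by (subst Bochner_Integration.integral_sum) (auto intro!: prod sum.cong)
  have "(\<integral>z. H z \<partial>(circ \<Otimes>\<^sub>M circ))
    \<le> 3 * pi * ((\<integral>x. (p (Suc N) x)\<^sup>2 \<partial>circ) + (\<integral>x. (p N x)\<^sup>2 \<partial>circ))"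
  proof (rule hilbert_kernel_inequality[where B = B])
    show "\<bar>p (Suc N) x\<bar> \<le> B" "\<bar>p N x\<bar> \<le> B" for x
      using B1[of "Suc N" x] B1[of N x] B10 by (auto simp: B_def intro: order_trans)
    show "p (Suc N) x = 0" "p N x = 0" if "\<bar>x\<bar> > 2" for x
      using that cd by (auto simp: p_def indicator_def)
    show "H \<in> borel_measurable (circ \<Otimes>\<^sub>M circ)"
      unfolding H_def using prod(1) by (intro borel_measurable_sum) (auto dest: borel_measurable_integrable)
    show "\<bar>H z\<bar> \<le> B" for z
    proof -
      have "\<bar>H z\<bar> \<le> (\<Sum>n=1..N. B1 * B1)"
        unfolding H_def
      proof (rule order_trans[OF sum_abs], rule sum_mono)
        fix n assume "n \<in> {1..N}"
        then show "\<bar>p n (fst z) * p n (snd z)\<bar> \<le> B1 * B1"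
          unfolding abs_mult by (intro mult_mono B1 B10) auto
      qed
      then show ?thesis using B10 by (simp add: B_def)
    qed
    show "(x - y) * H (x, y) = p (Suc N) x * p N y - p N x * p (Suc N) y" for x y
    proof -
      have "H (x, y) = indicator {c..d} x * indicator {c..d} y *
          (\<Sum>n=1..N. poly (jacobi_poly b n) x * poly (jacobi_poly b n) y)"
        by (simp add: H_def p_def sum_distrib_left algebra_simps)
      then have "(x - y) * H (x, y) = indicator {c..d} x * indicator {c..d} y *
          ((x - y) * (\<Sum>n=1..N. poly (jacobi_poly b n) x * poly (jacobi_poly b n) y))"
        by (simp add: algebra_simps)
      then show ?thesis unfolding christoffel_darboux p_def by (simp add: algebra_simps)
    qed
  qed (rule pm)+
  then show ?thesis
    unfolding iH p2 unfolding p_def circle_integral_indicator[OF cd] .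
qed

section \<open>Transfer along a block of constant potential\<close>

text \<open>For u = A cos \<phi>, v = A cos(\<phi> + \<theta>) and y = 2 cos \<theta> this is A^2
  sin^2 \<theta>. So the amplitude satisfies A^2 = 4 Q / (4 - y^2), and the mean A^2 cos \<theta> /
  2 of consecutive products is Q y / (4 - y^2).\<close>

definition block_form :: "real \<Rightarrow> real \<Rightarrow> real \<Rightarrow> real" where
  "block_form y u v = v\<^sup>2 - y * u * v + u\<^sup>2"

lemma block_form_step: "block_form y v (y * v - u) = block_form y u v"
  by (simp add: block_form_def power2_eq_square algebra_simps)

lemma block_form_lower:
  assumes "\<bar>y\<bar> \<le> 2 - \<epsilon>"
  shows "\<epsilon> * \<bar>u * v\<bar> \<le> block_form y u v" "\<epsilon> / 2 * (u\<^sup>2 + v\<^sup>2) \<le> block_form y u v"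
proof -
  have yuv: "y * u * v \<le> \<bar>y\<bar> * \<bar>u * v\<bar>"
    by (metis abs_ge_self abs_mult mult.assoc)
  have "2 * \<bar>u * v\<bar> \<le> u\<^sup>2 + v\<^sup>2"
    using zero_le_power2[of "\<bar>u\<bar> - \<bar>v\<bar>"] by (simp add: power2_diff abs_mult)
  moreover have "\<bar>y\<bar> * \<bar>u * v\<bar> \<le> (2 - \<epsilon>) * \<bar>u * v\<bar>" using assms by (rule mult_right_mono) simp
  ultimately show "\<epsilon> * \<bar>u * v\<bar> \<le> block_form y u v"
    using yuv by (simp add: block_form_def algebra_simps)
  have "\<bar>y\<bar> * (2 * \<bar>u * v\<bar>) \<le> \<bar>y\<bar> * (u\<^sup>2 + v\<^sup>2)"
    using \<open>2 * \<bar>u * v\<bar> \<le> u\<^sup>2 + v\<^sup>2\<close> by (intro mult_left_mono) auto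
  also have "\<dots> \<le> (2 - \<epsilon>) * (u\<^sup>2 + v\<^sup>2)" using assms by (intro mult_right_mono) auto
  finally show "\<epsilon> / 2 * (u\<^sup>2 + v\<^sup>2) \<le> block_form y u v"
    using yuv by (simp add: block_form_def algebra_simps)
qed

lemma four_minus_square_lower:
  fixes y :: real
  assumes "0 < \<epsilon>" "\<bar>y\<bar> \<le> 2 - \<epsilon>"
  shows "2 * \<epsilon> \<le> 4 - y\<^sup>2"
proof -
  have "2 * \<epsilon> \<le> (2 + \<bar>y\<bar>) * (2 - \<bar>y\<bar>)" using assms by (intro mult_mono) auto
  also have "\<dots> = 4 - y\<^sup>2" by (simp add: algebra_simps power2_eq_square)
  finally show ?thesis .
qed

lemma block_form_nonneg: "\<bar>y\<bar> \<le> 2 \<Longrightarrow> block_form y u v \<ge> 0"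
  using block_form_lower(1)[of y 0 u v] by simp

context
  fixes y :: real and s :: "nat \<Rightarrow> real"
  assumes rec: "\<And>n. s (Suc (Suc n)) = y * s (Suc n) - s n"
begin

lemma block_form_invariant: "block_form y (s n) (s (Suc n)) = block_form y (s 0) (s (Suc 0))"
  by (induction n) (simp_all add: rec block_form_step)

text \<open>For \<open>y = 2 cos \<theta>\<close> one has \<open>s n = A cos (n\<theta> + \<phi>)\<close>; the term subtracted in \<open>r\<close> is the mean
  of \<open>s n * s (n + 1)\<close>, and \<open>r\<close> oscillates with frequency \<open>2\<theta>\<close>.\<close>

lemma sum_oscillation_bound:
  assumes eps: "\<epsilon> > 0" "\<bar>y\<bar> \<le> 2 - \<epsilon>"
  defines "Q \<equiv> block_form y (s 0) (s (Suc 0))"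
  defines "r \<equiv> \<lambda>n. s n * s (Suc n) - Q * y / (4 - y\<^sup>2)"
  shows "\<bar>\<Sum>n<K. r (Suc n)\<bar> \<le> 4 * Q / \<epsilon>\<^sup>2"
proof -
  note W = four_minus_square_lower[OF eps(1,2)]
  have Q0: "Q \<ge> 0" unfolding Q_def using eps by (intro block_form_nonneg) auto
  \<comment> \<open>Frequency 2 \<theta> means r_{n+2} + r_n = (y^2 - 2) r_{n+1}, since 2 cos(2
    \<theta>) = y^2 - 2. Thus (4 - y^2) r_{n+1} is minus a second difference and its sum
    telescopes.\<close>
  have rr: "(4 - y\<^sup>2) * r (Suc n) = 2 * r (Suc n) - r (Suc (Suc n)) - r n" for n
  proof -
    define c where "c = Q / (4 - y\<^sup>2)"
    have Qc: "Q = (4 - y\<^sup>2) * c" using W eps by (simp add: c_def)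
    have inv: "Q = (s (Suc (Suc n)))\<^sup>2 - y * s (Suc n) * s (Suc (Suc n)) + (s (Suc n))\<^sup>2"
      using block_form_invariant[of "Suc n"] by (simp add: Q_def block_form_def)
    have s0: "s n = y * s (Suc n) - s (Suc (Suc n))" using rec[of n] by simp
    have r: "r m = s m * s (Suc m) - c * y" for m by (simp add: r_def c_def)
    have "r (Suc (Suc n)) + r n - (y\<^sup>2 - 2) * r (Suc n) = y * (Q - (4 - y\<^sup>2) * c)"
      unfolding r rec[of "Suc n"] s0 inv by (simp add: power2_eq_square algebra_simps)
    then show ?thesis using Qc by (simp add: algebra_simps)
  qed
  have "(4 - y\<^sup>2) * (\<Sum>n<K. r (Suc n)) = r (Suc 0) - r 0 - (r (Suc K) - r K)"
  proof (induction K)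
    case (Suc K)
    then show ?case by (simp only: sum.lessThan_Suc distrib_left rr)
  qed simp
  moreover have rb: "\<bar>r n\<bar> \<le> 2 * Q / \<epsilon>" for n
  proof -
    have "\<epsilon> * \<bar>s n * s (Suc n)\<bar> \<le> Q"
      using block_form_lower(1)[OF eps(2), of "s n" "s (Suc n)"] block_form_invariant[of n] by (simp add: Q_def)
    then have "\<bar>s n * s (Suc n)\<bar> \<le> Q / \<epsilon>" using eps by (simp add: field_simps)
    moreover have "\<bar>Q * y / (4 - y\<^sup>2)\<bar> \<le> Q * 2 / (2 * \<epsilon>)"
      unfolding abs_divide abs_mult using eps W Q0 by (intro frac_le mult_mono) auto
    moreover have "Q * 2 / (2 * \<epsilon>) = Q / \<epsilon>" "2 * Q / \<epsilon> = Q / \<epsilon> + Q / \<epsilon>" by simp_all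
    ultimately show ?thesis unfolding r_def
      using abs_triangle_ineq4[of "s n * s (Suc n)" "Q * y / (4 - y\<^sup>2)"] by linarith
  qed
  ultimately have "\<bar>(4 - y\<^sup>2) * (\<Sum>n<K. r (Suc n))\<bar> \<le> 4 * (2 * Q / \<epsilon>)"
    using rb[of "Suc 0"] rb[of 0] rb[of "Suc K"] rb[of K] by linarith
  then have "2 * \<epsilon> * \<bar>\<Sum>n<K. r (Suc n)\<bar> \<le> 4 * (2 * Q / \<epsilon>)"
    using mult_right_mono[OF W, of "\<bar>\<Sum>n<K. r (Suc n)\<bar>"] W eps by (simp add: abs_mult)
  then show ?thesis using eps by (simp add: field_simps power2_eq_square)
qed

text \<open>\<open>D\<close> and \<open>E\<close> are the components along the growing and the
  decaying solution, and the invariant form factors as D_0 E_0. A nonzero form therefore guarantees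
  that the growing component is present.\<close>

lemma hyperbolic_growth:
  assumes y: "\<bar>y\<bar> > 2" and Q: "block_form y (s 0) (s (Suc 0)) \<noteq> 0"
  shows "filterlim (\<lambda>n. (s n)\<^sup>2) at_top sequentially"
proof -
  obtain m where m: "m \<noteq> 0" "\<bar>m\<bar> < 1" "m + 1 / m = y" using joukowski_inverse[OF y] .
  define D where "D = (\<lambda>n. s (Suc n) - m * s n)"
  define E where "E = (\<lambda>n. s (Suc n) - s n / m)"
  have D: "m ^ n * D n = D 0" for n
  proof (induction n)
    case (Suc n)
    have "m * D (Suc n) = D n" using m(1) by (simp add: D_def rec field_simps flip: m(3))
    then show ?case using Suc by (metis mult.assoc power_Suc2)
  qed simp
  have E: "E n = m ^ n * E 0" for n
  proof (induction n)
    case (Suc n)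
    have "E (Suc n) = m * E n" using m(1) by (simp add: E_def rec field_simps flip: m(3))
    then show ?case using Suc by simp
  qed simp
  have "block_form y (s 0) (s (Suc 0)) = D 0 * E 0"
    using m(1) by (simp add: D_def E_def block_form_def power2_eq_square field_simps flip: m(3))
  then have D0: "D 0 \<noteq> 0" using Q by auto
  have m2: "m\<^sup>2 < 1" using m(2) by (simp add: abs_square_less_1)
  have sn: "(1 - m\<^sup>2) * s (Suc n) = D n - m\<^sup>2 * E n" for n
    using m(1) by (simp add: D_def E_def power2_eq_square field_simps)
  have low: "(1 - m\<^sup>2) * \<bar>s (Suc n)\<bar> \<ge> \<bar>D 0\<bar> / \<bar>m\<bar> ^ n - \<bar>E 0\<bar>" for n
  proof -
    have "\<bar>D n\<bar> = \<bar>D 0\<bar> / \<bar>m\<bar> ^ n"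
      using D[of n] m(1) by (simp add: field_simps flip: power_abs abs_mult)
    moreover have "\<bar>m\<^sup>2 * E n\<bar> \<le> 1 * (1 * \<bar>E 0\<bar>)"
      unfolding E[of n] abs_mult using m m2
      by (intro mult_mono) (auto simp: power_abs intro: power_le_one)
    moreover have "(1 - m\<^sup>2) * \<bar>s (Suc n)\<bar> = \<bar>D n - m\<^sup>2 * E n\<bar>"
      using m2 by (simp add: abs_mult flip: sn)
    ultimately show ?thesis by linarith
  qed
  have "filterlim (\<lambda>n. \<bar>D 0\<bar> / \<bar>m\<bar> ^ n - \<bar>E 0\<bar>) at_top sequentially"
  proof -
    have "filterlim (\<lambda>n. (1 / \<bar>m\<bar>) ^ n) at_top sequentially"
      using filterlim_inverse_at_top[OF LIMSEQ_realpow_zero[of "\<bar>m\<bar>"]] m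
      by (simp add: power_divide inverse_eq_divide)
    then have "filterlim (\<lambda>n. \<bar>D 0\<bar> * (1 / \<bar>m\<bar>) ^ n) at_top sequentially"
      using D0 by (intro filterlim_tendsto_pos_mult_at_top[OF tendsto_const]) auto
    then show ?thesis
      using filterlim_tendsto_add_at_top[OF tendsto_const[of "- \<bar>E 0\<bar>"]]
      by (fastforce simp: power_divide)
  qed
  then have fl: "filterlim (\<lambda>n. (1 - m\<^sup>2) * \<bar>s (Suc n)\<bar>) at_top sequentially"
    by (rule filterlim_at_top_mono) (use low in auto)
  have "filterlim (\<lambda>n. (1 / (1 - m\<^sup>2)) * ((1 - m\<^sup>2) * \<bar>s (Suc n)\<bar>)) at_top sequentially"
    by (rule filterlim_tendsto_pos_mult_at_top[OF tendsto_const _ fl]) (use m2 in simp)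
  moreover have "(1 / (1 - m\<^sup>2)) * ((1 - m\<^sup>2) * X) = X" for X using m2 by simp
  ultimately have "filterlim (\<lambda>n. \<bar>s (Suc n)\<bar>) at_top sequentially" by (simp only:)
  then have "filterlim (\<lambda>n. \<bar>s n\<bar>) at_top sequentially" by (subst (asm) filterlim_sequentially_Suc)
  then have "filterlim (\<lambda>n. \<bar>s n\<bar> * \<bar>s n\<bar>) at_top sequentially"
    by (rule filterlim_at_top_mult_at_top) fact
  then show ?thesis by (simp add: power2_eq_square flip: abs_mult)
qed

end

text \<open>The first-order terms in \<open>\<delta>\<close> cancel: the weight \<open>1 / sqrt (4 - y\<^sup>2)\<close> is chosen for that.\<close>

lemma weight_change_bound:
  fixes y \<delta> \<epsilon> :: real
  assumes eps: "\<epsilon> > 0" "\<bar>y\<bar> \<le> 2 - \<epsilon>" and y': "\<bar>y - \<delta>\<bar> < 2" and d: "\<bar>\<delta>\<bar> \<le> \<epsilon> / 3"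
  shows "(1 + \<delta> * y / (4 - y\<^sup>2)) / sqrt (4 - (y - \<delta>)\<^sup>2)
    \<le> (1 + 3 * (\<delta> / \<epsilon>)\<^sup>2) / sqrt (4 - y\<^sup>2)"
proof -
  define W where "W = 4 - y\<^sup>2"
  define W' where "W' = 4 - (y - \<delta>)\<^sup>2"
  define a where "a = \<delta> * y / W"
  define \<tau> where "\<tau> = (\<delta> / \<epsilon>)\<^sup>2"
  have W: "W \<ge> 2 * \<epsilon>" unfolding W_def by (rule four_minus_square_lower[OF eps(1,2)])
  have W0: "W > 0" using W eps by simp
  have W'0: "W' > 0"
    using power_strict_mono[OF y', of 2] by (simp add: W'_def)
  have t: "\<tau> \<le> 1 / 9" "\<tau> \<ge> 0"
  proof -
    have "\<bar>\<delta> / \<epsilon>\<bar> \<le> 1 / 3" using d eps by (simp add: field_simps)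
    from power_mono[OF this, of 2] show "\<tau> \<le> 1 / 9" by (simp add: \<tau>_def power2_eq_square)
  qed (simp add: \<tau>_def)
  have a: "\<bar>a\<bar> \<le> 1 / 3"
  proof -
    have "\<bar>a\<bar> \<le> (\<epsilon> / 3) * 2 / (2 * \<epsilon>)"
      unfolding a_def abs_divide abs_mult using d eps W by (intro frac_le mult_mono) auto
    then show ?thesis using eps by simp
  qed
  define s where "s = 4 * \<delta>\<^sup>2 / W\<^sup>2"
  have st: "s \<le> \<tau>"
  proof -
    have "s \<le> 4 * \<delta>\<^sup>2 / (2 * \<epsilon>)\<^sup>2"
      unfolding s_def using W eps W0 by (intro divide_left_mono power_mono mult_pos_pos) auto
    then show ?thesis using eps by (simp add: \<tau>_def power_divide power_mult_distrib)
  qed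
  \<comment> \<open>An exact identity: sqrt W' differs from sqrt W (1 + a) only through
    \<open>s\<close>, which is of second order. Since |a| \<le> 1/3, (1 + a)^2 \<ge> 4/9 turns the
    error s \<le> \<tau> into the relative error 9 \<tau> / 4.\<close>
  have W': "W' = W * ((1 + a)\<^sup>2 - s)"
  proof -
    have "W\<^sup>2 * W' = W\<^sup>2 * (W * ((1 + a)\<^sup>2 - s))"
    proof -
      have Wa: "W * a = \<delta> * y" "W\<^sup>2 * s = 4 * \<delta>\<^sup>2" using W0 by (auto simp: a_def s_def)
      have "W\<^sup>2 * (W * ((1 + a)\<^sup>2 - s)) = W * ((W + W * a)\<^sup>2 - W\<^sup>2 * s)"
        by (simp add: power2_eq_square algebra_simps)
      also have "\<dots> = W * ((W + \<delta> * y)\<^sup>2 - 4 * \<delta>\<^sup>2)" unfolding Wa ..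
      also have "(W + \<delta> * y)\<^sup>2 - 4 * \<delta>\<^sup>2 = W * W'"
        by (simp add: W_def W'_def power2_eq_square algebra_simps)
      finally show ?thesis by (metis mult.assoc power2_eq_square)
    qed
    then show ?thesis by (rule mult_left_cancel[THEN iffD1, rotated]) (use W0 in auto)
  qed
  have a1: "(1 + a)\<^sup>2 \<ge> 4 / 9"
    using power_mono[of "2/3" "1 + a" 2] a by (simp add: power2_eq_square)
  have "(1 + a)\<^sup>2 \<le> (1 + 3 * \<tau>)\<^sup>2 * ((1 + a)\<^sup>2 - s)"
  proof -
    have "1 \<le> (1 + 6 * \<tau>) * (1 - 9 * \<tau> / 4)"
    proof -
      have "\<tau> * (27 / 2 * \<tau>) \<le> \<tau> * (15 / 4)" using t by (intro mult_left_mono) auto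
      then show ?thesis by (simp add: algebra_simps)
    qed
    also have "\<dots> \<le> (1 + 3 * \<tau>)\<^sup>2 * (1 - 9 * \<tau> / 4)"
      using t by (intro mult_right_mono) (auto simp: power2_eq_square algebra_simps)
    finally have "(1 + a)\<^sup>2 * 1 \<le> (1 + a)\<^sup>2 * ((1 + 3 * \<tau>)\<^sup>2 * (1 - 9 * \<tau> / 4))"
      by (rule mult_left_mono) simp
    also have "\<dots> = (1 + 3 * \<tau>)\<^sup>2 * ((1 + a)\<^sup>2 - (1 + a)\<^sup>2 * (9 * \<tau> / 4))" by (simp add: algebra_simps)
    also have "\<dots> \<le> (1 + 3 * \<tau>)\<^sup>2 * ((1 + a)\<^sup>2 - s)"
      using st mult_right_mono[OF a1, of "9 * \<tau> / 4"] t by (intro mult_left_mono) auto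
    finally show ?thesis by simp
  qed
  then have "W * (1 + a)\<^sup>2 \<le> (1 + 3 * \<tau>)\<^sup>2 * W'"
    using W0 mult_left_mono[of "(1 + a)\<^sup>2" "(1 + 3 * \<tau>)\<^sup>2 * ((1 + a)\<^sup>2 - s)" W] unfolding W' by (simp add: algebra_simps)
  then have "sqrt (W * (1 + a)\<^sup>2) \<le> sqrt ((1 + 3 * \<tau>)\<^sup>2 * W')" by (rule real_sqrt_le_mono)
  then have "sqrt W * (1 + a) \<le> (1 + 3 * \<tau>) * sqrt W'"
    using a t by (simp add: real_sqrt_mult)
  then have "(1 + a) / sqrt W' \<le> (1 + 3 * \<tau>) / sqrt W"
    using W0 W'0 by (simp add: field_simps)
  then show ?thesis by (simp add: W_def W'_def a_def \<tau>_def)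
qed

section \<open>Blocks with arbitrary initial polynomials\<close>

text \<open>The Jacobi recurrence restarted from any pair. A block of undetermined length can thus
  be studied before the potential has been defined on it.\<close>

fun block_seq :: "real \<Rightarrow> real poly \<Rightarrow> real poly \<Rightarrow> nat \<Rightarrow> real poly" where
  "block_seq \<beta> u v 0 = u"
| "block_seq \<beta> u v (Suc 0) = v"
| "block_seq \<beta> u v (Suc (Suc n)) = [:- \<beta>, 1:] * block_seq \<beta> u v (Suc n) - block_seq \<beta> u v n"

lemma poly_block_seq_rec:
  "poly (block_seq \<beta> u v (Suc (Suc n))) x
    = (x - \<beta>) * poly (block_seq \<beta> u v (Suc n)) x - poly (block_seq \<beta> u v n) x"
  by (simp add: algebra_simps)

lemma block_form_block_seq:
  "block_form (x - \<beta>) (poly (block_seq \<beta> u v n) x) (poly (block_seq \<beta> u v (Suc n)) x)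
    = block_form (x - \<beta>) (poly u x) (poly v x)"
  using block_form_invariant[of "\<lambda>n. poly (block_seq \<beta> u v n) x" "x - \<beta>" n, OF poly_block_seq_rec]
  by simp

lemma block_seq_no_common_zero:
  assumes "poly u x \<noteq> 0 \<or> poly v x \<noteq> 0"
  shows "poly (block_seq \<beta> u v n) x \<noteq> 0 \<or> poly (block_seq \<beta> u v (Suc n)) x \<noteq> 0"
proof (induction n)
  case (Suc n)
  then show ?case unfolding poly_block_seq_rec by auto
qed (use assms in simp)

text \<open>The oscillating sequence \<open>r\<close> of \<open>sum_oscillation_bound\<close> for y
  = x - \<beta>, as a function of x.\<close>

definition block_osc :: "real \<Rightarrow> real poly \<Rightarrow> real poly \<Rightarrow> nat \<Rightarrow> real \<Rightarrow> real" where
  "block_osc \<beta> u v n x = poly (block_seq \<beta> u v n) x * poly (block_seq \<beta> u v (Suc n)) x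
    - block_form (x - \<beta>) (poly u x) (poly v x) * (x - \<beta>) / (4 - (x - \<beta>)\<^sup>2)"

lemma four_minus_square_pos: "\<bar>y\<bar> < 2 \<Longrightarrow> 4 - y\<^sup>2 > (0::real)"
  using power_strict_mono[of "\<bar>y\<bar>" 2 2] by simp

lemma continuous_on_block_form:
  fixes f g h :: "real \<Rightarrow> real"
  assumes "continuous_on S f" "continuous_on S g" "continuous_on S h"
  shows "continuous_on S (\<lambda>x. block_form (f x) (g x) (h x))"
  unfolding block_form_def by (intro continuous_intros assms)

lemma continuous_on_block_osc:
  assumes "\<And>x. x \<in> S \<Longrightarrow> \<bar>x - \<beta>\<bar> < 2"
  shows "continuous_on S (block_osc \<beta> u v n)"
  unfolding block_osc_def using four_minus_square_pos[OF assms]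
  by (intro continuous_intros continuous_on_block_form) force

lemma set_integrable_continuous:
  fixes f :: "real \<Rightarrow> real"
  shows "continuous_on {c..d} f \<Longrightarrow> set_integrable lborel {c..d} f"
  by (rule borel_integrable_atLeastAtMost')

text \<open>The integrals over consecutive block lengths have bounded sums, so arbitrarily large
  lengths make them small from above.\<close>

lemma block_osc_integral_small:
  fixes g :: "real \<Rightarrow> real"
  assumes eps: "\<epsilon> > 0" "\<And>x. x \<in> {c..d} \<Longrightarrow> \<bar>x - \<beta>\<bar> \<le> 2 - \<epsilon>"
    and g: "continuous_on {c..d} g" and eta: "\<eta> > 0"
  shows "\<exists>L\<ge>L0. \<delta> * (LINT x:{c..d}|lborel. block_osc \<beta> u v L x * g x) \<le> \<eta>"
proof (rule ccontr)
  define I where "I = (\<lambda>L. LINT x:{c..d}|lborel. block_osc \<beta> u v L x * g x)"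
  assume "\<not> ?thesis"
  then have big: "\<delta> * I L > \<eta>" if "L \<ge> L0" for L using that by (force simp: I_def)
  have cont: "continuous_on {c..d} (block_osc \<beta> u v L)" for L
    by (rule continuous_on_block_osc) (use eps in force)
  have si: "set_integrable lborel {c..d} (\<lambda>x. block_osc \<beta> u v L x * g x)" for L
    by (intro set_integrable_continuous continuous_intros cont g)
  define Q where "Q = (\<lambda>x. block_form (x - \<beta>) (poly u x) (poly v x))"
  define C where "C = (LINT x:{c..d}|lborel. 4 * Q x / \<epsilon>\<^sup>2 * \<bar>g x\<bar>)"
  have "real K * \<eta> \<le> \<bar>\<delta>\<bar> * C" for K
  proof -
    define S where "S = (\<lambda>x. \<Sum>n<K. block_osc \<beta> u v (L0 + Suc n) x)"
    have cS: "continuous_on {c..d} S" unfolding S_def by (intro continuous_intros cont)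
    have Sb: "\<bar>S x\<bar> \<le> 4 * Q x / \<epsilon>\<^sup>2" if "x \<in> {c..d}" for x
    proof -
      have "\<bar>\<Sum>n<K. poly (block_seq \<beta> u v (L0 + Suc n)) x * poly (block_seq \<beta> u v (L0 + Suc (Suc n))) x
          - block_form (x - \<beta>) (poly (block_seq \<beta> u v (L0 + 0)) x) (poly (block_seq \<beta> u v (L0 + Suc 0)) x)
            * (x - \<beta>) / (4 - (x - \<beta>)\<^sup>2)\<bar>
        \<le> 4 * block_form (x - \<beta>) (poly (block_seq \<beta> u v (L0 + 0)) x) (poly (block_seq \<beta> u v (L0 + Suc 0)) x) / \<epsilon>\<^sup>2"
        by (rule sum_oscillation_bound) (use poly_block_seq_rec[of \<beta> u v "L0 + n" x for n] eps that in auto)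
      then show ?thesis
        using block_form_block_seq[of x \<beta> u v L0] by (simp add: S_def block_osc_def Q_def)
    qed
    have "(\<Sum>n<K. I (L0 + Suc n)) = (LINT x:{c..d}|lborel. S x * g x)"
    proof -
      have "(LINT x:{c..d}|lborel. S x * g x) = (\<integral>x. (\<Sum>n<K. indicator {c..d} x *\<^sub>R (block_osc \<beta> u v (L0 + Suc n) x * g x)) \<partial>lborel)"
        unfolding set_lebesgue_integral_def S_def
        by (simp add: sum_distrib_left sum_distrib_right)
      also have "\<dots> = (\<Sum>n<K. I (L0 + Suc n))"
        unfolding I_def set_lebesgue_integral_def
        by (rule Bochner_Integration.integral_sum) (use si in \<open>simp add: set_integrable_def\<close>)
      finally show ?thesis by simp
    qed
    moreover have "\<bar>LINT x:{c..d}|lborel. S x * g x\<bar> \<le> C"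
    proof -
      have "\<bar>LINT x:{c..d}|lborel. S x * g x\<bar> \<le> (LINT x:{c..d}|lborel. \<bar>S x * g x\<bar>)"
        using set_integral_norm_bound[of lborel "{c..d}" "\<lambda>x. S x * g x"]
          set_integrable_continuous[OF continuous_on_mult[OF cS g]] by simp
      also have "\<dots> \<le> C"
        unfolding C_def
      proof (rule set_integral_mono)
        show "set_integrable lborel {c..d} (\<lambda>x. \<bar>S x * g x\<bar>)"
          by (intro set_integrable_continuous continuous_intros cS g)
        show "set_integrable lborel {c..d} (\<lambda>x. 4 * Q x / \<epsilon>\<^sup>2 * \<bar>g x\<bar>)"
          unfolding Q_def using eps by (intro set_integrable_continuous continuous_intros continuous_on_block_form g) auto
        show "\<bar>S x * g x\<bar> \<le> 4 * Q x / \<epsilon>\<^sup>2 * \<bar>g x\<bar>" if "x \<in> {c..d}" for x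
          unfolding abs_mult by (intro mult_right_mono Sb that) auto
      qed
      finally show ?thesis .
    qed
    moreover have "real K * \<eta> \<le> (\<Sum>n<K. \<delta> * I (L0 + Suc n))"
      using sum_mono[of "{..<K}" "\<lambda>_. \<eta>" "\<lambda>n. \<delta> * I (L0 + Suc n)"] big by (simp add: less_imp_le)
    moreover have "\<delta> * z \<le> \<bar>\<delta>\<bar> * \<bar>z\<bar>" for z by (metis abs_ge_self abs_mult)
    moreover have "\<bar>\<delta>\<bar> * \<bar>LINT x:{c..d}|lborel. S x * g x\<bar> \<le> \<bar>\<delta>\<bar> * C"
      by (rule mult_left_mono) (use calculation(2) in auto)
    ultimately show ?thesis
      unfolding sum_distrib_left[symmetric] by (metis order_trans)
  qed
  moreover obtain K :: nat where "\<bar>\<delta>\<bar> * C / \<eta> < real K" using reals_Archimedean2 by blast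
  ultimately show False using eta by (force simp: field_simps not_le[symmetric])
qed

text \<open>Solutions grow at every hyperbolic x where the form is nonzero, and dominated
  convergence on [-R, R] makes this a statement about measures. The form is a polynomial in x with
  finitely many zeros: at x = \<beta> it is u^2 + v^2, which is positive because u and v have no
  common zero.\<close>

lemma hyperbolic_small_set:
  assumes nz: "\<And>x. poly u x \<noteq> 0 \<or> poly v x \<noteq> 0" and eta: "\<eta> > 0"
  shows "\<forall>\<^sub>F L in sequentially. measure lborel
    {x \<in> {-R..R}. \<bar>x - \<beta>\<bar> > 2 \<and> (poly (block_seq \<beta> u v (Suc L)) x)\<^sup>2 < T} \<le> \<eta>"
proof -
  define A where "A = (\<lambda>L. {x \<in> {-R..R}. \<bar>x - \<beta>\<bar> > 2 \<and> (poly (block_seq \<beta> u v (Suc L)) x)\<^sup>2 < T})"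
  have [measurable]: "A L \<in> sets lborel" for L unfolding A_def by measurable
  define qp where "qp = v * v - [:- \<beta>, 1:] * u * v + u * u"
  have qp: "poly qp x = block_form (x - \<beta>) (poly u x) (poly v x)" for x
    by (simp add: qp_def block_form_def power2_eq_square algebra_simps)
  have "poly qp \<beta> \<noteq> 0"
    using nz[of \<beta>] unfolding qp block_form_def by (auto simp: sum_power2_eq_zero_iff add.commute)
  then have "finite {x. poly qp x = 0}" by (intro poly_roots_finite) auto
  then have ae: "AE x in lborel. poly qp x \<noteq> 0"
    by (intro AE_I'[of "{x. poly qp x = 0}"]) (auto intro: finite_imp_null_set_lborel)
  have "(\<lambda>L. \<integral>x. (indicator (A L) x :: real) \<partial>lborel) \<longlonglongrightarrow> integral\<^sup>L lborel (\<lambda>_::real. 0)"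
  proof (rule integral_dominated_convergence[where w = "indicator {-R..R}"])
    show "AE x in lborel. norm (indicator (A L) x :: real) \<le> indicator {-R..R} x" for L
      by (auto simp: A_def indicator_def)
    show "AE x in lborel. (\<lambda>L. indicator (A L) x :: real) \<longlonglongrightarrow> 0"
      using ae
    proof eventually_elim
      case (elim x)
      show ?case
      proof (cases "\<bar>x - \<beta>\<bar> > 2")
        case True
        have "filterlim (\<lambda>n. (poly (block_seq \<beta> u v n) x)\<^sup>2) at_top sequentially"
          using elim True unfolding qp
          by (intro hyperbolic_growth[of _ "x - \<beta>"] poly_block_seq_rec) auto
        then have "filterlim (\<lambda>n. (poly (block_seq \<beta> u v (Suc n)) x)\<^sup>2) at_top sequentially"
          by (subst filterlim_sequentially_Suc[of "\<lambda>n. (poly (block_seq \<beta> u v n) x)\<^sup>2"])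
        then have "\<forall>\<^sub>F n in sequentially. (poly (block_seq \<beta> u v (Suc n)) x)\<^sup>2 \<ge> T"
          by (simp add: filterlim_at_top)
        then have "\<forall>\<^sub>F n in sequentially. (indicator (A n) x :: real) = 0"
          by eventually_elim (auto simp: A_def)
        then show ?thesis by (rule tendsto_eventually)
      qed (simp add: A_def)
    qed
    show "integrable lborel (indicator {-R..R} :: real \<Rightarrow> real)"
      by (rule integrable_real_indicator) (auto simp: emeasure_lborel_Icc_eq)
  qed auto
  then have "(\<lambda>L. measure lborel (A L)) \<longlonglongrightarrow> 0"
    by simp
  then have "\<forall>\<^sub>F L in sequentially. measure lborel (A L) < \<eta>"
    using eta by (rule order_tendstoD)
  then show ?thesis by eventually_elim (simp add: A_def)
qed

definition block_energy :: "real \<Rightarrow> real \<Rightarrow> real \<Rightarrow> real poly \<Rightarrow> real poly \<Rightarrow> real" where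
  "block_energy c d \<beta> u v
    = (LINT x:{c..d}|lborel. block_form (x - \<beta>) (poly u x) (poly v x) / sqrt (4 - (x - \<beta>)\<^sup>2))"

lemma block_energy_step:
  fixes \<beta> \<beta>' :: real
  defines "\<delta> \<equiv> \<beta>' - \<beta>"
  assumes eps: "\<epsilon> > 0" "\<And>x. x \<in> {c..d} \<Longrightarrow> \<bar>x - \<beta>\<bar> \<le> 2 - \<epsilon>"
    and y': "\<And>x. x \<in> {c..d} \<Longrightarrow> \<bar>x - \<beta>'\<bar> < 2"
    and d: "\<bar>\<delta>\<bar> \<le> \<epsilon> / 3"
    and osc: "\<delta> * (LINT x:{c..d}|lborel. block_osc \<beta> u v L x * (1 / sqrt (4 - (x - \<beta>')\<^sup>2))) \<le> \<eta>"
  shows "block_energy c d \<beta>' (block_seq \<beta> u v L) (block_seq \<beta> u v (Suc L))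
    \<le> (1 + 3 * (\<delta> / \<epsilon>)\<^sup>2) * block_energy c d \<beta> u v + \<eta>"
proof -
  define Q where "Q = (\<lambda>x. block_form (x - \<beta>) (poly u x) (poly v x))"
  define w where "w = (\<lambda>x. sqrt (4 - (x - \<beta>)\<^sup>2))"
  define w' where "w' = (\<lambda>x. sqrt (4 - (x - \<beta>')\<^sup>2))"
  have y: "\<bar>x - \<beta>\<bar> < 2" if "x \<in> {c..d}" for x using eps(1) eps(2)[OF that] by linarith
  have W: "4 - (x - \<beta>)\<^sup>2 > 0" "4 - (x - \<beta>')\<^sup>2 > 0" if "x \<in> {c..d}" for x
    using four_minus_square_pos y y' that by auto
  have nz: "w x \<noteq> 0" "w' x \<noteq> 0" "4 - (x - \<beta>)\<^sup>2 \<noteq> 0" if "x \<in> {c..d}" for x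
    using W[OF that] by (auto simp: w_def w'_def)
  have cw: "continuous_on {c..d} w" "continuous_on {c..d} w'" "continuous_on {c..d} Q"
    unfolding w_def w'_def Q_def by (intro continuous_intros continuous_on_block_form)+
  have co: "continuous_on {c..d} (block_osc \<beta> u v L)" by (rule continuous_on_block_osc) (rule y)
  have div: "(q * a + e * r) / z = q * (a / z) + e * (r * (1 / z))" for q a e r z :: real
    by (simp add: add_divide_distrib)
  \<comment> \<open>Passing from \<beta> to \<beta>' adds \<delta> times the product of two
    consecutive values to the form. The mean of that product becomes the factor 1 + \<delta> y / (4
    - y^2), which the change of weight absorbs; the rest is \<open>block_osc\<close>.\<close>
  have point: "block_form (x - \<beta>') (poly (block_seq \<beta> u v L) x) (poly (block_seq \<beta> u v (Suc L)) x) / w' x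
     = Q x * ((1 + \<delta> * (x - \<beta>) / (4 - (x - \<beta>)\<^sup>2)) / w' x) + \<delta> * (block_osc \<beta> u v L x * (1 / w' x))"
    if "x \<in> {c..d}" for x
  proof -
    have "block_form (x - \<beta>') (poly (block_seq \<beta> u v L) x) (poly (block_seq \<beta> u v (Suc L)) x)
        = Q x + \<delta> * (poly (block_seq \<beta> u v L) x * poly (block_seq \<beta> u v (Suc L)) x)"
      unfolding Q_def block_form_block_seq[of x \<beta> u v L, symmetric]
      by (simp add: block_form_def \<delta>_def algebra_simps)
    also have "\<dots> = Q x * (1 + \<delta> * (x - \<beta>) / (4 - (x - \<beta>)\<^sup>2)) + \<delta> * block_osc \<beta> u v L x"
      by (simp add: block_osc_def Q_def algebra_simps)
    finally show ?thesis
      using div[of "Q x" "1 + \<delta> * (x - \<beta>) / (4 - (x - \<beta>)\<^sup>2)" \<delta> "block_osc \<beta> u v L x" "w' x"] by simp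
  qed
  have i1: "set_integrable lborel {c..d} (\<lambda>x. Q x * ((1 + \<delta> * (x - \<beta>) / (4 - (x - \<beta>)\<^sup>2)) / w' x))"
    by (intro set_integrable_continuous continuous_intros cw) (use nz in auto)
  have i2: "set_integrable lborel {c..d} (\<lambda>x. block_osc \<beta> u v L x * (1 / w' x))"
    by (intro set_integrable_continuous continuous_intros cw co) (use nz in auto)
  have i3: "set_integrable lborel {c..d} (\<lambda>x. (1 + 3 * (\<delta> / \<epsilon>)\<^sup>2) * (Q x / w x))"
    by (intro set_integrable_continuous continuous_intros cw) (use nz in auto)
  have "block_energy c d \<beta>' (block_seq \<beta> u v L) (block_seq \<beta> u v (Suc L))
      = (LINT x:{c..d}|lborel. Q x * ((1 + \<delta> * (x - \<beta>) / (4 - (x - \<beta>)\<^sup>2)) / w' x) + \<delta> * (block_osc \<beta> u v L x * (1 / w' x)))"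
    unfolding block_energy_def by (rule set_lebesgue_integral_cong) (use point in \<open>simp_all add: w'_def\<close>)
  also have "\<dots> = (LINT x:{c..d}|lborel. Q x * ((1 + \<delta> * (x - \<beta>) / (4 - (x - \<beta>)\<^sup>2)) / w' x))
      + \<delta> * (LINT x:{c..d}|lborel. block_osc \<beta> u v L x * (1 / w' x))"
    using set_integral_add(2)[OF i1 set_integrable_mult_right[OF i2]] by (simp only: set_integral_mult_right)
  also have "\<dots> \<le> (LINT x:{c..d}|lborel. (1 + 3 * (\<delta> / \<epsilon>)\<^sup>2) * (Q x / w x)) + \<eta>"
  proof (intro add_mono set_integral_mono i1 i3)
    show "\<delta> * (LINT x:{c..d}|lborel. block_osc \<beta> u v L x * (1 / w' x)) \<le> \<eta>" using osc by (simp add: w'_def)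
    fix x assume x: "x \<in> {c..d}"
    have "Q x \<ge> 0" unfolding Q_def using y[OF x] by (intro block_form_nonneg) auto
    moreover have "(1 + \<delta> * (x - \<beta>) / (4 - (x - \<beta>)\<^sup>2)) / w' x \<le> (1 + 3 * (\<delta> / \<epsilon>)\<^sup>2) / w x"
    proof -
      have w'x: "w' x = sqrt (4 - (x - \<beta> - \<delta>)\<^sup>2)" by (simp add: w'_def \<delta>_def)
      have "\<bar>x - \<beta> - \<delta>\<bar> < 2" using y'[OF x] by (simp add: \<delta>_def)
      then show ?thesis
        unfolding w'x w_def by (rule weight_change_bound[OF eps(1) eps(2)[OF x] _ d])
    qed
    ultimately have "Q x * ((1 + \<delta> * (x - \<beta>) / (4 - (x - \<beta>)\<^sup>2)) / w' x) \<le> Q x * ((1 + 3 * (\<delta> / \<epsilon>)\<^sup>2) / w x)"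
      by (rule mult_left_mono[rotated])
    then show "Q x * ((1 + \<delta> * (x - \<beta>) / (4 - (x - \<beta>)\<^sup>2)) / w' x) \<le> (1 + 3 * (\<delta> / \<epsilon>)\<^sup>2) * (Q x / w x)"
      by (simp add: mult.commute)
  qed
  also have "(LINT x:{c..d}|lborel. (1 + 3 * (\<delta> / \<epsilon>)\<^sup>2) * (Q x / w x)) = (1 + 3 * (\<delta> / \<epsilon>)\<^sup>2) * block_energy c d \<beta> u v"
    unfolding block_energy_def Q_def w_def by (simp only: set_integral_mult_right)
  finally show ?thesis by simp
qed

section \<open>Slow oscillation\<close>

text \<open>sin(ln t) sweeps [-1, 1] forever with derivative O(1/t). The factor 1 - t^(-1/4) keeps
  \<beta> at distance \<epsilon> = lam t^(-1/4) from the ends, so that step over distance is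
  O(t^(-3/4)), with summable square. Any exponent between 0 and 1/2 in place of 1/4 would
  do.\<close>

lemma slow_oscillation_exists:
  fixes lam :: real
  assumes lam: "lam > 0"
  shows "\<exists>\<beta> \<epsilon> :: nat \<Rightarrow> real.
    (\<forall>k. \<epsilon> k > 0 \<and> \<bar>\<beta> k\<bar> \<le> lam - \<epsilon> k) \<and>
    summable (\<lambda>k. ((\<beta> (Suc k) - \<beta> k) / \<epsilon> k)\<^sup>2) \<and>
    (\<forall>t\<in>{-lam..lam}. \<exists>s. filterlim s at_top sequentially \<and> (\<lambda>j. \<beta> (s j)) \<longlonglongrightarrow> t)"
proof -
  define B where "B = (\<lambda>t::real. lam * ((1 - t powr (- 1/4)) * sin (ln t)))"
  define \<beta> where "\<beta> = (\<lambda>k. B (real (Suc k)))"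
  define \<epsilon> where "\<epsilon> = (\<lambda>k. lam * real (Suc k) powr (- 1/4))"
  have eps: "\<epsilon> k > 0" for k using lam by (simp add: \<epsilon>_def)
  have bound: "\<bar>\<beta> k\<bar> \<le> lam - \<epsilon> k" for k
  proof -
    have "real (Suc k) powr (- 1/4) \<le> 1" using powr_mono[of "- 1/4" 0 "real (Suc k)"] by simp
    then have "\<bar>(1 - real (Suc k) powr (- 1/4)) * sin (ln (real (Suc k)))\<bar> \<le> (1 - real (Suc k) powr (- 1/4)) * 1"
      unfolding abs_mult by (intro mult_mono) auto
    then have "lam * \<bar>(1 - real (Suc k) powr (- 1/4)) * sin (ln (real (Suc k)))\<bar> \<le> lam * (1 - real (Suc k) powr (- 1/4))"
      using lam by simp
    then show ?thesis using lam by (simp add: \<beta>_def \<epsilon>_def B_def abs_mult right_diff_distrib)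
  qed
  have step: "\<bar>B (t + 1) - B t\<bar> \<le> 2 * lam / t" if t: "t \<ge> 1" for t
  proof -
    define B' where "B' = (\<lambda>z::real. lam * ((1 - z powr (- 1/4)) * (cos (ln z) / z) + (1/4 * z powr (- 5/4)) * sin (ln z)))"
    have "(B has_real_derivative B' z) (at z)" if "t \<le> z" "z \<le> t + 1" for z
      unfolding B_def B'_def using that t
      by (auto intro!: derivative_eq_intros simp: field_simps)
    then obtain z where z: "t < z" "z < t + 1" "B (t + 1) - B t = (t + 1 - t) * B' z"
      using MVT2[of t "t + 1" B B'] by auto
    have z1: "z \<ge> 1" using z t by simp
    have p: "z powr (- 1/4) \<le> 1" "z powr (- 5/4) \<le> 1 / z"
      using powr_mono[of "- 1/4" 0 z] powr_mono[of "- 5/4" "- 1" z] z1 by (auto simp: powr_minus_divide)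
    have "\<bar>(1 - z powr (- 1/4)) * (cos (ln z) / z) + (1/4 * z powr (- 5/4)) * sin (ln z)\<bar>
       \<le> 1 * (1 / z) + (1/4 * (1 / z)) * 1"
    proof (rule order_trans[OF abs_triangle_ineq add_mono])
      show "\<bar>(1 - z powr (- 1/4)) * (cos (ln z) / z)\<bar> \<le> 1 * (1 / z)"
        unfolding abs_mult abs_divide using p z1 by (intro mult_mono frac_le) auto
      show "\<bar>(1/4 * z powr (- 5/4)) * sin (ln z)\<bar> \<le> (1/4 * (1 / z)) * 1"
        unfolding abs_mult using p z1 by (intro mult_mono) auto
    qed
    also have "\<dots> \<le> 2 / z" using z1 by (simp add: field_simps)
    also have "\<dots> \<le> 2 / t" using z t by (intro divide_left_mono) auto
    finally have "\<bar>B' z\<bar> \<le> lam * (2 / t)"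
      unfolding B'_def abs_mult[of lam] abs_of_pos[OF lam] by (rule mult_left_mono) (use lam in simp)
    then show ?thesis using z by (simp add: mult.commute)
  qed
  have sq: "((\<beta> (Suc k) - \<beta> k) / \<epsilon> k)\<^sup>2 \<le> 4 * real (Suc k) powr (- 3/2)" for k
  proof -
    define t where "t = real (Suc k)"
    have t: "t \<ge> 1" by (simp add: t_def)
    have "\<bar>(\<beta> (Suc k) - \<beta> k) / \<epsilon> k\<bar> = \<bar>B (t + 1) - B t\<bar> / (lam * t powr (- 1/4))"
      using lam t by (simp add: \<beta>_def \<epsilon>_def t_def abs_mult add.commute)
    also have "\<dots> \<le> (2 * lam / t) / (lam * t powr (- 1/4))"
      using lam t by (intro divide_right_mono step) auto
    also have "\<dots> = 2 * t powr (- 3/4)"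
    proof -
      have "t powr (- 3/4) * t powr (- 1/4) = 1 / t"
        using t by (simp add: powr_minus_divide flip: powr_add)
      then show ?thesis using lam t by (simp add: field_simps)
    qed
    finally have "\<bar>(\<beta> (Suc k) - \<beta> k) / \<epsilon> k\<bar>\<^sup>2 \<le> (2 * t powr (- 3/4))\<^sup>2" by (rule power_mono) simp
    also have "\<dots> = 4 * t powr (- 3/2)"
      using t by (simp add: power2_eq_square flip: powr_add)
    finally show ?thesis unfolding power2_abs t_def .
  qed
  have "summable (\<lambda>k. 4 * real (Suc k) powr (- 3/2))"
    by (intro summable_mult) (subst summable_Suc_iff[of "\<lambda>n. real n powr (- 3/2)"], simp add: summable_real_powr_iff)
  then have sum: "summable (\<lambda>k. ((\<beta> (Suc k) - \<beta> k) / \<epsilon> k)\<^sup>2)"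
    by (rule summable_comparison_test_ev[rotated]) (use sq in simp)
  have lim: "\<exists>s. filterlim s at_top sequentially \<and> (\<lambda>j. \<beta> (s j)) \<longlonglongrightarrow> t" if t: "t \<in> {-lam..lam}" for t
  proof -
    define \<tau> where "\<tau> = arcsin (t / lam)"
    have tl: "- 1 \<le> t / lam" "t / lam \<le> 1" using t lam by (auto simp: field_simps)
    have tau: "sin \<tau> = t / lam" "- (pi / 2) \<le> \<tau>" using tl arcsin_bounded[of "t / lam"] by (auto simp: \<tau>_def)
    \<comment> \<open>At the points e_j the value sin(ln e_j) is exactly t / lam. Rounding to the
      integer \<open>Suc (s j)\<close>, the argument belonging to \<open>\<beta> (s j)\<close>,
      changes the logarithm by at most 1 / e_j.\<close>
    define e where "e = (\<lambda>j::nat. exp (\<tau> + 2 * pi * real j))"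
    define s where "s = (\<lambda>j. nat \<lfloor>e j\<rfloor>)"
    have ej: "e j > 0" for j by (simp add: e_def)
    have sj: "real (s j) \<le> e j" "e j < real (Suc (s j))" for j
      using ej[of j] by (auto simp: s_def) linarith
    have "j \<le> s j" for j
    proof (cases "j = 0")
      case False
      have "real j \<le> 1 + \<tau> + 2 * pi * real j"
      proof -
        have "pi * 1 \<le> pi * real j" using False by (intro mult_left_mono) auto
        moreover have "1 * real j \<le> pi * real j" using pi_gt3 by (intro mult_right_mono) auto
        ultimately show ?thesis using tau(2) by linarith
      qed
      also have "\<dots> \<le> e j" unfolding e_def by (rule order_trans[OF _ exp_ge_add_one_self]) simp
      finally show ?thesis unfolding s_def by (simp add: le_nat_iff le_floor_iff)
    qed simp
    then have s: "filterlim s at_top sequentially"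
      by (intro filterlim_at_top_mono[OF filterlim_ident]) auto
    define d where "d = (\<lambda>j. ln (real (Suc (s j))) - (\<tau> + 2 * pi * real j))"
    have d: "\<bar>d j\<bar> \<le> 1 / e j" for j
    proof -
      have dj: "d j = ln (real (Suc (s j)) / e j)"
        unfolding d_def using ej[of j] by (subst ln_div) (auto simp: e_def)
      have "real (Suc (s j)) / e j \<ge> 1" "real (Suc (s j)) / e j \<le> 1 + 1 / e j"
        using sj[of j] ej[of j] by (auto simp: field_simps)
      then show ?thesis unfolding dj using ln_le_minus_one[of "real (Suc (s j)) / e j"] by auto
    qed
    have "(\<lambda>j. 1 / e j) \<longlonglongrightarrow> 0" unfolding e_def by real_asymp
    then have "d \<longlonglongrightarrow> 0" by (rule Lim_null_comparison[rotated]) (use d in auto)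
    then have "(\<lambda>j. sin (\<tau> + d j)) \<longlonglongrightarrow> sin (\<tau> + 0)" by (intro tendsto_intros)
    moreover have "sin (ln (real (Suc (s j)))) = sin (\<tau> + d j)" for j
    proof -
      have "ln (real (Suc (s j))) = (\<tau> + d j) + 2 * real j * pi" by (simp add: d_def algebra_simps)
      then show ?thesis by (simp only: sin_add[of "\<tau> + d j"] cos_2npi sin_2npi mult_1_right mult_zero_right add_0_right)
    qed
    ultimately have sn: "(\<lambda>j. sin (ln (real (Suc (s j))))) \<longlonglongrightarrow> t / lam" using tau by simp
    have "(\<lambda>k. real (Suc k) powr (- 1/4)) \<longlonglongrightarrow> 0" by real_asymp
    then have "(\<lambda>j. real (Suc (s j)) powr (- 1/4)) \<longlonglongrightarrow> 0" using s by (rule filterlim_compose)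
    then have "(\<lambda>j. lam * ((1 - real (Suc (s j)) powr (- 1/4)) * sin (ln (real (Suc (s j)))))) \<longlonglongrightarrow> lam * ((1 - 0) * (t / lam))"
      by (intro tendsto_intros sn)
    then show ?thesis using s lam by (auto simp: \<beta>_def B_def)
  qed
  show ?thesis using eps bound sum lim by blast
qed

section \<open>Construction of the potential\<close>

text \<open>Growth holds for all sufficiently large lengths, smallness of the oscillating term for
  arbitrarily large ones; hence some length has both.\<close>

lemma good_block_exists:
  fixes \<beta> \<beta>' :: real
  assumes eps: "\<epsilon> > 0" "\<And>x. x \<in> {c..d} \<Longrightarrow> \<bar>x - \<beta>\<bar> \<le> 2 - \<epsilon>"
    and y': "\<And>x. x \<in> {c..d} \<Longrightarrow> \<bar>x - \<beta>'\<bar> < 2"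
    and nz: "\<And>x. poly u x \<noteq> 0 \<or> poly v x \<noteq> 0" and eta: "\<eta> > 0"
  shows "\<exists>L\<ge>1. (\<bar>\<beta>' - \<beta>\<bar> \<le> \<epsilon> / 3 \<longrightarrow>
      block_energy c d \<beta>' (block_seq \<beta> u v L) (block_seq \<beta> u v (Suc L))
        \<le> (1 + 3 * ((\<beta>' - \<beta>) / \<epsilon>)\<^sup>2) * block_energy c d \<beta> u v + \<eta>)
    \<and> measure lborel {x \<in> {-R..R}. \<bar>x - \<beta>\<bar> > 2 \<and> (poly (block_seq \<beta> u v (Suc L)) x)\<^sup>2 < T} \<le> \<eta>"
proof -
  obtain L1 where L1: "\<And>L. L \<ge> L1 \<Longrightarrow> measure lborel
    {x \<in> {-R..R}. \<bar>x - \<beta>\<bar> > 2 \<and> (poly (block_seq \<beta> u v (Suc L)) x)\<^sup>2 < T} \<le> \<eta>"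
    using hyperbolic_small_set[of u v, OF nz eta] unfolding eventually_sequentially by blast
  have g: "continuous_on {c..d} (\<lambda>x. 1 / sqrt (4 - (x - \<beta>')\<^sup>2))"
    using four_minus_square_pos[OF y'] by (intro continuous_intros) force
  obtain L where L: "L \<ge> max 1 L1"
    "(\<beta>' - \<beta>) * (LINT x:{c..d}|lborel. block_osc \<beta> u v L x * (1 / sqrt (4 - (x - \<beta>')\<^sup>2))) \<le> \<eta>"
    using block_osc_integral_small[OF eps g eta] by blast
  show ?thesis
    using block_energy_step[OF eps y' _ L(2)] L1 L(1) by (intro exI[of _ L]) auto
qed

theorem block_potential_exists:
  fixes \<beta> \<epsilon> R T \<eta> :: "nat \<Rightarrow> real"
  assumes eps: "\<And>k. \<epsilon> k > 0" "\<And>k x. x \<in> {c..d} \<Longrightarrow> \<bar>x - \<beta> k\<bar> \<le> 2 - \<epsilon> k"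
    and eta: "\<And>k. \<eta> k > 0"
  shows "\<exists>b N. N 0 = 0 \<and> strict_mono N \<and> (\<forall>k n. N k < n \<and> n \<le> N (Suc k) \<longrightarrow> b n = \<beta> k) \<and>
    (\<forall>k. \<bar>\<beta> (Suc k) - \<beta> k\<bar> \<le> \<epsilon> k / 3 \<longrightarrow>
      block_energy c d (\<beta> (Suc k)) (jacobi_poly b (N (Suc k))) (jacobi_poly b (Suc (N (Suc k))))
      \<le> (1 + 3 * ((\<beta> (Suc k) - \<beta> k) / \<epsilon> k)\<^sup>2)
          * block_energy c d (\<beta> k) (jacobi_poly b (N k)) (jacobi_poly b (Suc (N k))) + \<eta> k) \<and>
    (\<forall>k. measure lborel {x \<in> {-R k..R k}. \<bar>x - \<beta> k\<bar> > 2 \<and>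
      (poly (jacobi_poly b (Suc (N (Suc k)))) x)\<^sup>2 < T k} \<le> \<eta> k)"
proof -
  \<comment> \<open>The state is a block end M with the pair (p_M, p_{M+1}), starting from (p_0,
    p_1) = (0, 1). Absence of common zeros is carried along because the growth estimate for the next
    block depends on it.\<close>
  define P :: "nat \<Rightarrow> nat \<times> real poly \<times> real poly \<Rightarrow> bool" where
    "P = (\<lambda>k (M, u, v). (\<forall>x. poly u x \<noteq> 0 \<or> poly v x \<noteq> 0) \<and> (k = 0 \<longrightarrow> (M, u, v) = (0, 0, 1)))"
  define E :: "nat \<Rightarrow> real poly \<Rightarrow> real poly \<Rightarrow> real poly \<Rightarrow> real poly \<Rightarrow> bool" where "E = (\<lambda>k u v u' v'. \<bar>\<beta> (Suc k) - \<beta> k\<bar> \<le> \<epsilon> k / 3 \<longrightarrow>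
      block_energy c d (\<beta> (Suc k)) u' v'
      \<le> (1 + 3 * ((\<beta> (Suc k) - \<beta> k) / \<epsilon> k)\<^sup>2) * block_energy c d (\<beta> k) u v + \<eta> k)"
  define S :: "nat \<Rightarrow> real poly \<Rightarrow> bool" where "S = (\<lambda>k v'. measure lborel {x \<in> {-R k..R k}. \<bar>x - \<beta> k\<bar> > 2 \<and> (poly v' x)\<^sup>2 < T k} \<le> \<eta> k)"
  define Q :: "nat \<Rightarrow> nat \<times> real poly \<times> real poly \<Rightarrow> nat \<times> real poly \<times> real poly \<Rightarrow> bool" where
    "Q = (\<lambda>k (M, u, v) (M', u', v'). \<exists>L\<ge>1. M' = M + L \<and> u' = block_seq (\<beta> k) u v L \<and>
      v' = block_seq (\<beta> k) u v (Suc L) \<and> E k u v u' v' \<and> S k v')"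
  have "\<exists>f. \<forall>k. P k (f k) \<and> Q k (f k) (f (Suc k))"
  proof (rule dependent_nat_choice)
    show "\<exists>s. P 0 s" by (auto simp: P_def)
    fix s k assume Pk: "P k s"
    obtain M u v where s: "s = (M, u, v)" by (cases s)
    have nz: "poly u x \<noteq> 0 \<or> poly v x \<noteq> 0" for x using Pk by (auto simp: P_def s)
    have y': "\<bar>x - \<beta> (Suc k)\<bar> < 2" if "x \<in> {c..d}" for x
      using eps(1)[of "Suc k"] eps(2)[OF that, of "Suc k"] by linarith
    obtain L where L: "L \<ge> 1" "E k u v (block_seq (\<beta> k) u v L) (block_seq (\<beta> k) u v (Suc L))"
      "S k (block_seq (\<beta> k) u v (Suc L))"
      using good_block_exists[OF eps(1) eps(2) y' nz eta[of k], where R = "R k" and T = "T k"] unfolding E_def S_def by blast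
    show "\<exists>t. P (Suc k) t \<and> Q k s t"
      using L block_seq_no_common_zero[OF nz]
      by (intro exI[of _ "(M + L, block_seq (\<beta> k) u v L, block_seq (\<beta> k) u v (Suc L))"])
        (auto simp: P_def Q_def s simp del: block_seq.simps)
  qed
  then obtain f where f: "\<And>k. P k (f k)" "\<And>k. Q k (f k) (f (Suc k))" by blast
  define N where "N = (\<lambda>k. fst (f k))"
  define U where "U = (\<lambda>k. fst (snd (f k)))"
  define V where "V = (\<lambda>k. snd (snd (f k)))"
  have fk: "f k = (N k, U k, V k)" for k by (simp add: N_def U_def V_def)
  have init: "N 0 = 0" "U 0 = 0" "V 0 = 1" using f(1)[of 0] by (auto simp: P_def fk)
  have step: "\<exists>L\<ge>1. N (Suc k) = N k + L \<and> U (Suc k) = block_seq (\<beta> k) (U k) (V k) L \<and>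
      V (Suc k) = block_seq (\<beta> k) (U k) (V k) (Suc L)" for k
    using f(2)[of k] by (auto simp: Q_def fk)
  have ES: "E k (U k) (V k) (U (Suc k)) (V (Suc k))" "S k (V (Suc k))" for k
    using f(2)[of k] by (auto simp: Q_def fk)
  have sm: "strict_mono N"
    unfolding strict_mono_Suc_iff using step by (metis less_add_same_cancel1 less_le_trans zero_less_one)
  define b where "b = (\<lambda>n. \<beta> (LEAST k. n \<le> N (Suc k)))"
  have b: "b n = \<beta> k" if "N k < n" "n \<le> N (Suc k)" for k n
  proof -
    have "(LEAST k. n \<le> N (Suc k)) = k"
    proof (rule Least_equality)
      fix j assume "n \<le> N (Suc j)"
      then have "N k < N (Suc j)" using that by simp
      then show "k \<le> j" using sm by (simp add: strict_mono_less)
    qed (use that in simp)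
    then show ?thesis by (simp add: b_def)
  qed
  have jp: "jacobi_poly b (N k) = U k \<and> jacobi_poly b (Suc (N k)) = V k" for k
  proof (induction k)
    case (Suc k)
    obtain L where L: "L \<ge> 1" "N (Suc k) = N k + L" "U (Suc k) = block_seq (\<beta> k) (U k) (V k) L"
      "V (Suc k) = block_seq (\<beta> k) (U k) (V k) (Suc L)" using step by blast
    \<comment> \<open>The range includes i = L + 1: the polynomial with index N_{k+1} + 1 still uses
      only values of the potential up to index N_{k+1}, which belong to block k.\<close>
    have "i \<le> Suc L \<longrightarrow> jacobi_poly b (N k + i) = block_seq (\<beta> k) (U k) (V k) i" for i
    proof (induction i rule: induct_nat_012)
      case (ge2 n)
      show ?case
      proof
        assume n: "Suc (Suc n) \<le> Suc L"
        then have "b (Suc (N k + n)) = \<beta> k" using L(2) by (intro b) auto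
        then show "jacobi_poly b (N k + Suc (Suc n)) = block_seq (\<beta> k) (U k) (V k) (Suc (Suc n))"
          using ge2 n by simp
      qed
    qed (use Suc in auto)
    from this[of L] this[of "Suc L"] show ?case using L by simp
  qed (simp add: init)
  show ?thesis
    using init(1) sm b ES unfolding E_def S_def
    by (intro exI[of _ b] exI[of _ N]) (simp add: jp)
qed

section \<open>Support of the spectral measure\<close>

lemma (in real_distribution) poly_integrable:
  assumes "AE x in M. \<bar>x\<bar> \<le> R"
  shows "integrable M (poly p)"
proof -
  obtain B where B: "\<And>x. \<bar>indicator {-R..R} x * poly p x\<bar> \<le> B" using poly_bounded_on_Icc by blast
  have "AE x in M. norm (poly p x) \<le> B"
    using assms
  proof eventually_elim
    case (elim x)
    then show ?case using B[of x] by (auto simp: indicator_def abs_le_iff split: if_splits)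
  qed
  then show ?thesis by (intro integrable_const_bound) auto
qed

lemma jacobi_poly_orthonormal:
  assumes M: "real_distribution M" and sup: "AE x in M. \<bar>x\<bar> \<le> R"
    and row: "\<And>n. n \<ge> 1 \<Longrightarrow> integral\<^sup>L M (poly (jacobi_poly b n)) = (if n = 1 then 1 else 0)"
  shows "(\<integral>x. poly (jacobi_poly b m) x * poly (jacobi_poly b n) x \<partial>M) = (if m = n \<and> n \<ge> 1 then 1 else 0)"
proof (rule jacobi_form_orthonormal[where b = b])
  interpret real_distribution M by (rule M)
  have int: "integrable M (\<lambda>x. poly p x * poly q x)" for p q
  proof -
    have "(\<lambda>x. poly p x * poly q x) = poly (p * q)" by (simp add: fun_eq_iff)
    then show ?thesis using poly_integrable[OF sup] by metis
  qed
  have row': "integral\<^sup>L M (poly (jacobi_poly b n)) = (if n = 1 then 1 else 0)" for n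
  proof (cases "n = 0")
    case True
    have "poly 0 = (\<lambda>_::real. 0 :: real)" by (simp add: fun_eq_iff)
    then show ?thesis using True by simp
  qed (simp add: row)
  show "(\<integral>x. poly (jacobi_poly b 1) x * poly (jacobi_poly b n) x \<partial>M) = (if n = 1 then 1 else 0)" for n
    using row'[of n] by simp
  show "(\<integral>x. poly (jacobi_poly b (Suc m)) x * poly (jacobi_poly b n) x \<partial>M)
      + b m * (\<integral>x. poly (jacobi_poly b m) x * poly (jacobi_poly b n) x \<partial>M)
      + (\<integral>x. poly (jacobi_poly b (m - 1)) x * poly (jacobi_poly b n) x \<partial>M)
    = (\<integral>x. poly (jacobi_poly b m) x * poly (jacobi_poly b (Suc n)) x \<partial>M)
      + b n * (\<integral>x. poly (jacobi_poly b m) x * poly (jacobi_poly b n) x \<partial>M)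
      + (\<integral>x. poly (jacobi_poly b m) x * poly (jacobi_poly b (n - 1)) x \<partial>M)"
    if "m \<ge> 1" "n \<ge> 1" for m n
  proof -
    have shift: "(\<integral>x. x * (poly (jacobi_poly b k) x * poly q x) \<partial>M)
      = (\<integral>x. poly (jacobi_poly b (Suc k)) x * poly q x \<partial>M)
      + b k * (\<integral>x. poly (jacobi_poly b k) x * poly q x \<partial>M)
      + (\<integral>x. poly (jacobi_poly b (k - 1)) x * poly q x \<partial>M)" if "k \<ge> 1" for k q
    proof -
      have "x * (poly (jacobi_poly b k) x * poly q x) = poly (jacobi_poly b (Suc k)) x * poly q x
          + b k * (poly (jacobi_poly b k) x * poly q x) + poly (jacobi_poly b (k - 1)) x * poly q x" for x
        unfolding poly_jacobi_poly_Suc[OF that] by (simp add: algebra_simps)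
      then show ?thesis
        using int by (simp only: Bochner_Integration.integral_add Bochner_Integration.integrable_add
            integrable_mult_right integral_mult_right_zero)
    qed
    show ?thesis
      using shift[OF that(1), of "jacobi_poly b n"] shift[OF that(2), of "jacobi_poly b m"]
      by (simp only: mult.commute[of "poly (jacobi_poly b n) x" for x] mult.commute[of "poly (jacobi_poly b (Suc n)) x" for x]
          mult.commute[of "poly (jacobi_poly b (n - 1)) x" for x])
  qed
qed auto

lemma emeasure_lborel_Icc_subset:
  fixes A :: "real set"
  shows "A \<subseteq> {c..d} \<Longrightarrow> emeasure lborel A < \<infinity>"
  using emeasure_mono[of A "{c..d}" lborel] by (auto simp: emeasure_lborel_Icc_eq intro: le_less_trans)

lemma half_inner_delta_one: "half_inner delta_one v = v 1"
proof -
  have "half_inner delta_one v = (\<Sum>\<^sub>\<infinity>n\<in>{1}. delta_one n * v n)"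
    unfolding half_inner_def by (rule infsum_cong_neutral) (auto simp: delta_one_def)
  then show ?thesis by (simp add: delta_one_def)
qed

text \<open>The moment of order m is the coefficient of p_1 in the expansion of x^m, and these
  coefficients are the entries of J^m \<delta>_1.\<close>

lemma is_spectral_measureI:
  assumes M: "real_distribution M" and sup: "AE x in M. \<bar>x\<bar> \<le> R"
    and row: "\<And>n. n \<ge> 1 \<Longrightarrow> integral\<^sup>L M (poly (jacobi_poly b n)) = (if n = 1 then 1 else 0)"
    and a: "\<forall>n\<ge>1. a n = 1"
  shows "is_spectral_measure a b M"
  unfolding is_spectral_measure_def
proof (intro conjI allI)
  interpret real_distribution M by (rule M)
  show "sets M = sets borel" by simp
  fix m
  show "integrable M (\<lambda>x. x ^ m)"
  proof -
    have "(\<lambda>x. x ^ m) = poly (monom 1 m :: real poly)" by (simp add: fun_eq_iff poly_monom)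
    then show ?thesis using poly_integrable[OF sup] by metis
  qed
  define w where "w = (half_jacobi a b ^^ m) delta_one"
  have "monom 1 m = (\<Sum>n=1..Suc m. smult (w n) (jacobi_poly b n))"
    using jacobi_power_expansion[OF a, of m b] by (simp add: w_def)
  then have "x ^ m = (\<Sum>n=1..Suc m. w n * poly (jacobi_poly b n) x)" for x
    by (metis (no_types, lifting) mult_1 poly_monom poly_smult poly_sum sum.cong)
  then have "integral\<^sup>L M (\<lambda>x. x ^ m) = (\<Sum>n=1..Suc m. w n * integral\<^sup>L M (poly (jacobi_poly b n)))"
    using poly_integrable[OF sup] by (simp add: Bochner_Integration.integral_sum del: sum.cl_ivl_Suc)
  also have "\<dots> = (\<Sum>n=1..Suc m. if n = 1 then w n else 0)"
    by (rule sum.cong) (auto simp: row)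
  also have "\<dots> = w 1" by (subst sum.delta) auto
  finally show "integral\<^sup>L M (\<lambda>x. x ^ m) = half_inner delta_one ((half_jacobi a b ^^ m) delta_one)"
    by (simp add: half_inner_delta_one w_def)
qed

text \<open>Since \<open>\<integral> p\<^sub>n\<^sup>2 d\<mu> = 1\<close>, along a sparse sequence \<open>p\<^sub>n\<^sup>2\<close> stays below \<open>2\<^sup>k\<close> almost everywhere with
  respect to \<open>\<mu>\<close>; by assumption it exceeds \<open>2\<^sup>k\<close> on all late hyperbolic blocks for Lebesgue almost
  every \<open>x\<close>.\<close>

lemma density_vanishes:
  fixes \<beta> :: "nat \<Rightarrow> real" and p :: "nat \<Rightarrow> real poly"
  assumes M: "real_distribution M" and dec: "is_lebesgue_decomposition M f Ms"
    and p: "\<And>k. integrable M (\<lambda>x. (poly (p k) x)\<^sup>2)" "\<And>k. (\<integral>x. (poly (p k) x)\<^sup>2 \<partial>M) \<le> 1"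
    and A: "\<And>k. measure lborel {x \<in> {- real k..real k}. \<bar>x - \<beta> k\<bar> > 2 \<and> (poly (p k) x)\<^sup>2 < 2 ^ k} \<le> (1 / 2) ^ k"
  shows "AE x in lborel. (\<exists>\<^sub>F k in sequentially. \<bar>x - \<beta> k\<bar> > 2) \<longrightarrow> f x = 0"
proof -
  interpret real_distribution M by (rule M)
  have [measurable]: "f \<in> borel_measurable borel" using dec by (simp add: is_lebesgue_decomposition_def)
  define A where "A = (\<lambda>k. {x \<in> {- real k..real k}. \<bar>x - \<beta> k\<bar> > 2 \<and> (poly (p k) x)\<^sup>2 < 2 ^ k})"
  have Am [measurable]: "A k \<in> sets borel" for k unfolding A_def by measurable
  have Afin: "emeasure lborel (A k) < \<infinity>" for k
    by (rule emeasure_lborel_Icc_subset[of _ "- real k" "real k"]) (auto simp: A_def)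
  have sg: "summable (\<lambda>k. (1 / 2 :: real) ^ k)" by (rule summable_geometric) simp
  have aeA: "AE x in lborel. \<forall>\<^sub>F k in sequentially. x \<in> space lborel - A k"
  proof (rule borel_cantelli_AE1[OF _ Afin])
    show "summable (\<lambda>k. measure lborel (A k))"
      by (rule summable_comparison_test_ev[OF _ sg]) (use A in \<open>auto simp: A_def\<close>)
  qed simp
  define D where "D = (\<lambda>k. {x. 2 ^ k \<le> (poly (p k) x)\<^sup>2})"
  have Dm [measurable]: "D k \<in> sets borel" for k unfolding D_def by measurable
  have Db: "measure M (D k) \<le> (1 / 2) ^ k" for k
  proof -
    have "emeasure M {x \<in> space M. (poly (p k) x)\<^sup>2 \<ge> 2 ^ k} \<le> (1 / 2 ^ k) * (\<integral>x. (poly (p k) x)\<^sup>2 \<partial>M)"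
      by (rule integral_Markov_inequality[OF p(1)]) auto
    also have "\<dots> \<le> ennreal ((1 / 2) ^ k)"
      using p(2)[of k] by (intro ennreal_leI) (simp add: power_divide divide_right_mono)
    finally show ?thesis by (simp add: D_def emeasure_eq_measure)
  qed
  have aeD: "AE x in M. \<forall>\<^sub>F k in sequentially. x \<in> space M - D k"
  proof (rule borel_cantelli_AE1)
    show "summable (\<lambda>k. measure M (D k))"
      by (rule summable_comparison_test_ev[OF _ sg]) (use Db in auto)
  qed (auto simp: emeasure_eq_measure)
  \<comment> \<open>Points with infinitely many hyperbolic blocks at which p_k^2 \<ge> 2^k from some
    block on. Lebesgue almost every point with infinitely many hyperbolic blocks lies in
    \<open>G\<close>, but the Markov bound makes \<open>G\<close> \<mu>-null, so f vanishes almost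
    everywhere on it.\<close>
  define G where "G = {x. \<not> (\<forall>\<^sub>F k in sequentially. \<not> \<bar>x - \<beta> k\<bar> > 2) \<and> (\<forall>\<^sub>F k in sequentially. x \<notin> A k)}"
  have Gm [measurable]: "G \<in> sets borel" unfolding G_def by measurable
  have "AE x in M. x \<notin> G"
    using aeD
  proof eventually_elim
    case (elim x)
    show ?case
    proof
      assume "x \<in> G"
      then have fr: "\<exists>\<^sub>F k in sequentially. \<bar>x - \<beta> k\<bar> > 2" and ev: "\<forall>\<^sub>F k in sequentially. x \<notin> A k"
        by (auto simp: G_def frequently_def)
      have "\<forall>\<^sub>F k in sequentially. real k \<ge> \<bar>x\<bar>"
        using filterlim_real_sequentially by (auto simp: filterlim_at_top)
      then have "\<forall>\<^sub>F k in sequentially. \<not> \<bar>x - \<beta> k\<bar> > 2"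
        using ev elim by eventually_elim (auto simp: A_def D_def not_le abs_le_iff)
      then show False using fr by (simp add: frequently_def)
    qed
  qed
  then have "emeasure M G = 0" by (subst AE_iff_measurable[symmetric, of G M "\<lambda>x. x \<notin> G"]) auto
  moreover have "emeasure M G = emeasure (density lborel (\<lambda>x. ennreal (f x))) G + emeasure Ms G"
    using dec by (simp add: is_lebesgue_decomposition_def)
  ultimately have "emeasure (density lborel (\<lambda>x. ennreal (f x))) G = 0" by simp
  then have "(\<integral>\<^sup>+x. ennreal (f x) * indicator G x \<partial>lborel) = 0"
    by (subst (asm) emeasure_density) auto
  then have "AE x in lborel. ennreal (f x) * indicator G x = 0"
    by (subst (asm) nn_integral_0_iff_AE) auto
  then show ?thesis
    using aeA
  proof eventually_elim
    case (elim x)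
    have "f x \<ge> 0" using dec by (simp add: is_lebesgue_decomposition_def)
    then show ?case using elim by (auto simp: G_def frequently_def indicator_def ennreal_eq_0_iff split: if_splits)
  qed
qed

lemma poly_uniform_approximation:
  fixes g :: "real \<Rightarrow> real"
  assumes "continuous_on {-r..r} g" "e > 0"
  shows "\<exists>P. \<forall>x\<in>{-r..r}. \<bar>g x - poly P x\<bar> < e"
proof -
  obtain h where h: "real_polynomial_function h" "\<And>x. x \<in> {-r..r} \<Longrightarrow> \<bar>g x - h x\<bar> < e"
    using Stone_Weierstrass_real_polynomial_function[OF compact_Icc assms] by blast
  then obtain a n where "h = (\<lambda>x. \<Sum>i\<le>n. a i * x ^ i)" unfolding real_polynomial_function_iff_sum by blast
  then have heq: "h x = poly (\<Sum>i\<le>n. monom (a i) i) x" for x by (simp add: poly_sum poly_monom)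
  show ?thesis using h(2)[unfolded heq] by blast
qed

text \<open>The bound passes from polynomials to continuous functions and then to indicators of
  closed sets, giving |T|^2 \<le> C \<mu>(T) for closed T in [c, d]. Inner regularity extends the
  conclusion |Z| = 0 to the Borel set \<open>Z\<close>.\<close>

lemma density_positive:
  assumes M: "real_distribution M" and sup: "AE x in M. \<bar>x\<bar> \<le> R"
    and dec: "is_lebesgue_decomposition M f Ms"
    and bound: "\<And>P. (LINT x:{c..d}|lborel. poly P x)\<^sup>2 \<le> C * (\<integral>x. (poly P x)\<^sup>2 \<partial>M)"
  shows "AE x in lborel. x \<in> {c..d} \<longrightarrow> f x > 0"
proof -
  interpret real_distribution M by (rule M)
  have fm [measurable]: "f \<in> borel_measurable borel" and f0: "\<And>x. f x \<ge> 0"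
    using dec by (auto simp: is_lebesgue_decomposition_def)
  have cont: "(LINT x:{c..d}|lborel. g x)\<^sup>2 \<le> C * (\<integral>x. (g x)\<^sup>2 \<partial>M)"
    if g: "continuous_on UNIV g" "\<And>x. \<bar>g x\<bar> \<le> 1" for g :: "real \<Rightarrow> real"
  proof -
    \<comment> \<open>The interval contains both [c, d] and the support of \<mu>, so one uniform
      approximation serves both sides of the bound.\<close>
    define r where "r = max \<bar>R\<bar> (max \<bar>c\<bar> \<bar>d\<bar>)"
    have "\<exists>P. \<forall>x\<in>{-r..r}. \<bar>g x - poly P x\<bar> < 1 / real (Suc j)" for j
      using g by (intro poly_uniform_approximation) (auto intro: continuous_on_subset)
    then obtain P where P: "\<And>j x. x \<in> {-r..r} \<Longrightarrow> \<bar>g x - poly (P j) x\<bar> < 1 / real (Suc j)" by metis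
    have [measurable]: "g \<in> borel_measurable borel" by (rule borel_measurable_continuous_onI) (rule g)
    have lim: "(\<lambda>j. poly (P j) x) \<longlonglongrightarrow> g x" if "x \<in> {-r..r}" for x
    proof (rule LIM_zero_cancel, rule Lim_null_comparison)
      show "\<forall>\<^sub>F j in sequentially. norm (poly (P j) x - g x) \<le> 1 / real (Suc j)"
        using P[OF that] by (auto simp: abs_minus_commute less_imp_le intro!: always_eventually)
      show "(\<lambda>j. 1 / real (Suc j)) \<longlonglongrightarrow> 0" by (rule LIMSEQ_Suc) (rule lim_1_over_n)
    qed
    have Pb: "\<bar>poly (P j) x\<bar> \<le> 2" if "x \<in> {-r..r}" for j x
    proof -
      have "1 / real (Suc j) \<le> 1" by simp
      then show ?thesis using P[OF that, of j] g(2)[of x] by linarith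
    qed
    have l1: "(\<lambda>j. LINT x:{c..d}|lborel. poly (P j) x) \<longlonglongrightarrow> (LINT x:{c..d}|lborel. g x)"
      unfolding set_lebesgue_integral_def
    proof (rule integral_dominated_convergence[where w = "\<lambda>x. indicator {c..d} x * 2"])
      show "integrable lborel (\<lambda>x. indicator {c..d} x * 2 :: real)"
        by (intro integrable_mult_left integrable_real_indicator) (auto simp: emeasure_lborel_Icc_eq)
      have sub: "x \<in> {c..d} \<Longrightarrow> x \<in> {-r..r}" for x by (auto simp: r_def)
      show "AE x in lborel. (\<lambda>j. indicator {c..d} x *\<^sub>R poly (P j) x) \<longlonglongrightarrow> indicator {c..d} x *\<^sub>R g x"
        using lim[OF sub] by (intro AE_I2) (auto simp: indicator_def)
      show "AE x in lborel. norm (indicator {c..d} x *\<^sub>R poly (P j) x) \<le> indicator {c..d} x * 2" for j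
        using Pb[OF sub] by (intro AE_I2) (auto simp: indicator_def)
    qed auto
    have l2: "(\<lambda>j. \<integral>x. (poly (P j) x)\<^sup>2 \<partial>M) \<longlonglongrightarrow> (\<integral>x. (g x)\<^sup>2 \<partial>M)"
    proof (rule integral_dominated_convergence[where w = "\<lambda>_. 4"])
      show "AE x in M. (\<lambda>j. (poly (P j) x)\<^sup>2) \<longlonglongrightarrow> (g x)\<^sup>2"
        using sup by eventually_elim (auto intro!: tendsto_intros lim simp: r_def)
      show "AE x in M. norm ((poly (P j) x)\<^sup>2) \<le> 4" for j
        using sup
      proof eventually_elim
        case (elim x)
        then have "\<bar>poly (P j) x\<bar> \<le> 2" by (intro Pb) (auto simp: r_def)
        from power_mono[OF this, of 2] show ?case by simp
      qed
    qed auto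
    show ?thesis
      by (rule LIMSEQ_le[OF tendsto_power[OF l1] tendsto_mult_left[OF l2]]) (use bound in auto)
  qed
  obtain N where N: "N \<in> null_sets lborel" "emeasure Ms (UNIV - N) = 0" and Mss: "sets Ms = sets borel"
    using dec by (auto simp: is_lebesgue_decomposition_def)
  have [measurable]: "N \<in> sets borel" using N(1) by (auto simp: null_sets_def)
  \<comment> \<open>Removing \<open>N\<close> discards the singular part and f = 0 discards the
    rest, so \<open>Z\<close> is \<mu>-null.\<close>
  define Z where "Z = {x \<in> {c..d} - N. f x = 0}"
  have Zm [measurable]: "Z \<in> sets borel" unfolding Z_def by measurable
  have "emeasure Ms Z \<le> emeasure Ms (UNIV - N)"
    by (rule emeasure_mono) (auto simp: Z_def Mss)
  then have "emeasure Ms Z = 0" using N(2) by simp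
  moreover have "emeasure (density lborel (\<lambda>x. ennreal (f x))) Z = 0"
  proof -
    have "emeasure (density lborel (\<lambda>x. ennreal (f x))) Z = (\<integral>\<^sup>+x. ennreal (f x) * indicator Z x \<partial>lborel)"
      by (rule emeasure_density) auto
    also have "\<dots> = (\<integral>\<^sup>+x. 0 \<partial>(lborel :: real measure))"
      by (rule nn_integral_cong) (auto simp: Z_def indicator_def)
    finally show ?thesis by simp
  qed
  moreover have "emeasure M Z = emeasure (density lborel (\<lambda>x. ennreal (f x))) Z + emeasure Ms Z"
    using dec by (simp add: is_lebesgue_decomposition_def)
  ultimately have MZ: "emeasure M Z = 0" by simp
  have closed_null: "emeasure lborel T = 0" if T: "closed T" "T \<subseteq> Z" for T
  proof (cases "T = {}")
    case False
    have [measurable]: "T \<in> sets borel" using T by (simp add: borel_closed)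
    have Tfin: "emeasure lborel T < \<infinity>"
      by (rule emeasure_lborel_Icc_subset[of _ c d]) (use T(2) in \<open>auto simp: Z_def\<close>)
    have MT: "emeasure M T = 0" using MZ emeasure_mono[OF T(2), of M] by simp
    \<comment> \<open>Continuous tents decreasing to the indicator of T; closedness of T makes the
      distance positive off T.\<close>
    define g where "g = (\<lambda>n x. max 0 (1 - real n * infdist x T))"
    have gc: "continuous_on UNIV (g n)" for n unfolding g_def by (intro continuous_intros)
    have gb: "\<bar>g n x\<bar> \<le> 1" for n x using infdist_nonneg[of x T] by (auto simp: g_def abs_le_iff)
    have gT: "g n x = 1" if "x \<in> T" for n x using that by (simp add: g_def)
    have gm [measurable]: "g n \<in> borel_measurable borel" for n
      by (rule borel_measurable_continuous_onI) (rule gc)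
    have "(\<lambda>n. \<integral>x. (g n x)\<^sup>2 \<partial>M) \<longlonglongrightarrow> (\<integral>x. indicator T x \<partial>M)"
    proof (rule integral_dominated_convergence[where w = "\<lambda>_. 1"])
      show "AE x in M. norm ((g n x)\<^sup>2) \<le> 1" for n
        using power_mono[OF gb, of n _ 2] by (intro AE_I2) auto
      show "AE x in M. (\<lambda>n. (g n x)\<^sup>2) \<longlonglongrightarrow> indicator T x"
      proof (rule AE_I2)
        fix x
        show "(\<lambda>n. (g n x)\<^sup>2) \<longlonglongrightarrow> indicator T x"
        proof (cases "x \<in> T")
          case False
          then have pos: "infdist x T > 0"
            using infdist_pos_not_in_closed[OF T(1) \<open>T \<noteq> {}\<close>] by simp
          obtain n0 where n0: "1 / infdist x T < real n0" using reals_Archimedean2 by blast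
          have "\<forall>\<^sub>F n in sequentially. (g n x)\<^sup>2 = 0"
            unfolding eventually_sequentially
          proof (intro exI allI impI)
            fix n assume "n \<ge> n0"
            then have "1 / infdist x T < real n" using n0 by linarith
            then show "(g n x)\<^sup>2 = 0" using pos by (simp add: g_def field_simps)
          qed
          then show ?thesis using False by (simp add: tendsto_eventually)
        qed (simp add: gT)
      qed
    qed auto
    moreover have "(\<integral>x. indicator T x \<partial>M) = (0::real)" using MT by (simp add: measure_def)
    ultimately have "(\<lambda>n. C * (\<integral>x. (g n x)\<^sup>2 \<partial>M)) \<longlonglongrightarrow> C * 0" by (intro tendsto_intros) simp
    moreover have "(measure lborel T)\<^sup>2 \<le> C * (\<integral>x. (g n x)\<^sup>2 \<partial>M)" for n
    proof -
      have "measure lborel T = (\<integral>x. indicator T x \<partial>lborel)" by simp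
      also have "\<dots> \<le> (LINT x:{c..d}|lborel. g n x)"
        unfolding set_lebesgue_integral_def
      proof (rule integral_mono)
        show "integrable lborel (indicator T :: real \<Rightarrow> real)"
          by (rule integrable_real_indicator) (use Tfin in simp_all)
        show "integrable lborel (\<lambda>x. indicator {c..d} x *\<^sub>R g n x)"
          using borel_integrable_atLeastAtMost'[of c d "g n"] continuous_on_subset[OF gc]
          by (auto simp: set_integrable_def)
        show "indicator T x \<le> indicator {c..d} x *\<^sub>R g n x" for x
          using T(2) gT[of x n] by (auto simp: indicator_def Z_def g_def)
      qed
      finally have "(measure lborel T)\<^sup>2 \<le> (LINT x:{c..d}|lborel. g n x)\<^sup>2" by (intro power_mono) auto
      also have "\<dots> \<le> C * (\<integral>x. (g n x)\<^sup>2 \<partial>M)" by (rule cont[OF gc gb])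
      finally show ?thesis .
    qed
    ultimately have "(measure lborel T)\<^sup>2 \<le> C * 0" by (intro LIMSEQ_le_const) auto
    then have "measure lborel T = 0" by simp
    with Tfin show ?thesis by (auto simp: measure_def enn2real_eq_0_iff)
  qed simp
  have "emeasure lborel Z = 0"
  proof (rule ccontr)
    assume nz: "emeasure lborel Z \<noteq> 0"
    have fin: "emeasure lborel Z < \<infinity>"
      by (rule emeasure_lborel_Icc_subset[of _ c d]) (auto simp: Z_def)
    define m where "m = measure lborel Z"
    have em: "emeasure lborel Z = ennreal m"
      unfolding m_def using fin by (intro emeasure_eq_ennreal_measure) auto
    then have "m \<noteq> 0" using nz by auto
    then have m: "m > 0" "emeasure lborel Z = ennreal m"
      using em measure_nonneg[of lborel Z] by (auto simp: m_def less_le)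
    have "Z \<in> sets lebesgue" by (rule sets_completionI_sets) simp
    then obtain T where T: "closed T" "T \<subseteq> Z" "Z - T \<in> lmeasurable" "emeasure lebesgue (Z - T) < ennreal m"
      by (rule sets_lebesgue_inner_closed[OF _ m(1)])
    have Tm: "T \<in> sets lborel" using T(1) by (simp add: borel_closed)
    have ZT: "Z - T \<in> sets lborel" using Tm by simp
    have "emeasure lborel Z = emeasure lborel T + emeasure lborel (Z - T)"
      using plus_emeasure[OF Tm ZT] T(2) by (simp add: Un_absorb1)
    also have "emeasure lborel (Z - T) = emeasure lebesgue (Z - T)" using ZT by simp
    also have "emeasure lborel T + emeasure lebesgue (Z - T) < ennreal m"
      using closed_null[OF T(1,2)] T(4) by simp
    finally show False using m by simp
  qed
  then have "AE x in lborel. x \<notin> Z" by (subst AE_iff_measurable[of Z]) auto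
  moreover have "AE x in lborel. x \<notin> N" using N(1) by (rule AE_not_in)
  ultimately show ?thesis
  proof eventually_elim
    case (elim x)
    then show ?case using f0[of x] by (auto simp: Z_def less_le)
  qed
qed

section \<open>The example\<close>

lemma discrete_gronwall:
  fixes V \<kappa> \<eta> :: "nat \<Rightarrow> real"
  assumes step: "\<And>k. V (Suc k) \<le> (1 + \<kappa> k) * V k + \<eta> k"
    and nonneg: "\<And>k. \<kappa> k \<ge> 0" "\<And>k. \<eta> k \<ge> 0" "V 0 \<ge> 0"
    and summable: "summable \<kappa>" "summable \<eta>"
  shows "\<exists>C. \<forall>k. V k \<le> C"
proof -
  define p where "p = (\<lambda>k. \<Prod>i<k. 1 + \<kappa> i)"
  have p1: "p k \<ge> 1" for k unfolding p_def using nonneg by (intro prod_ge_1) auto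
  have "p k \<le> exp (suminf \<kappa>)" for k
  proof -
    have "p k \<le> (\<Prod>i<k. exp (\<kappa> i))"
      unfolding p_def using nonneg by (intro prod_mono) (auto simp: exp_ge_add_one_self add_nonneg_nonneg)
    also have "\<dots> = exp (\<Sum>i<k. \<kappa> i)" by (simp add: exp_sum)
    also have "\<dots> \<le> exp (suminf \<kappa>)" using nonneg summable by (simp add: sum_le_suminf)
    finally show ?thesis .
  qed
  moreover have "V k \<le> p k * (V 0 + (\<Sum>i<k. \<eta> i))" for k
  proof (induction k)
    case (Suc k)
    have "V (Suc k) \<le> (1 + \<kappa> k) * (p k * (V 0 + (\<Sum>i<k. \<eta> i))) + 1 * \<eta> k"
    proof -
      have "(1 + \<kappa> k) * V k \<le> (1 + \<kappa> k) * (p k * (V 0 + (\<Sum>i<k. \<eta> i)))"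
        using nonneg(1)[of k] by (intro mult_left_mono[OF Suc]) auto
      then show ?thesis using step[of k] by simp
    qed
    also have "\<dots> \<le> (1 + \<kappa> k) * (p k * (V 0 + (\<Sum>i<k. \<eta> i))) + p (Suc k) * \<eta> k"
      using p1 nonneg by (intro add_left_mono mult_right_mono) auto
    also have "\<dots> = p (Suc k) * (V 0 + (\<Sum>i<Suc k. \<eta> i))" by (simp add: p_def algebra_simps)
    finally show ?case .
  qed (simp add: p_def)
  ultimately have "V k \<le> exp (suminf \<kappa>) * (V 0 + suminf \<eta>)" for k
    using nonneg summable p1[of k]
    by (intro order_trans[OF \<open>\<And>k. V k \<le> p k * (V 0 + (\<Sum>i<k. \<eta> i))\<close>] mult_mono add_left_mono sum_le_suminf)
      (auto intro!: add_nonneg_nonneg sum_nonneg)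
  then show ?thesis by blast
qed

text \<open>The form controls u^2 + v^2 only away from the band edges, hence the smaller interval on
  the left. The constant is e/2 from the form times 1/2, as the weight's square root is at most
  2.\<close>

lemma block_energy_lower:
  assumes sub: "c \<le> c'" "d' \<le> d" and e: "e > 0"
    and el: "\<And>x. x \<in> {c..d} \<Longrightarrow> \<bar>x - \<beta>\<bar> < 2" "\<And>x. x \<in> {c'..d'} \<Longrightarrow> \<bar>x - \<beta>\<bar> \<le> 2 - e"
  shows "e / 4 * ((LINT x:{c'..d'}|lborel. (poly v x)\<^sup>2) + (LINT x:{c'..d'}|lborel. (poly u x)\<^sup>2))
    \<le> block_energy c d \<beta> u v"
proof -
  define h where "h = (\<lambda>x. block_form (x - \<beta>) (poly u x) (poly v x) / sqrt (4 - (x - \<beta>)\<^sup>2))"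
  have ci: "set_integrable lborel {c'..d'} (\<lambda>x. (poly p x)\<^sup>2)" for p
    by (intro set_integrable_continuous continuous_intros)
  have "e / 4 * ((LINT x:{c'..d'}|lborel. (poly v x)\<^sup>2) + (LINT x:{c'..d'}|lborel. (poly u x)\<^sup>2))
      = (LINT x:{c'..d'}|lborel. e / 4 * ((poly v x)\<^sup>2 + (poly u x)\<^sup>2))"
    using set_integral_add(2)[OF ci ci] by (simp only: set_integral_mult_right)
  also have "\<dots> \<le> (LINT x:{c..d}|lborel. h x)"
    unfolding set_lebesgue_integral_def
  proof (rule integral_mono)
    show "integrable lborel (\<lambda>x. indicator {c'..d'} x *\<^sub>R (e / 4 * ((poly v x)\<^sup>2 + (poly u x)\<^sup>2)))"
    proof -
      have "continuous_on {c'..d'} (\<lambda>x. e / 4 * ((poly v x)\<^sup>2 + (poly u x)\<^sup>2))"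
        by (intro continuous_intros)
      from set_integrable_continuous[OF this] show ?thesis unfolding set_integrable_def .
    qed
    have "continuous_on {c..d} h"
      unfolding h_def using four_minus_square_pos[OF el(1)]
      by (intro continuous_intros continuous_on_block_form) force
    then show "integrable lborel (\<lambda>x. indicator {c..d} x *\<^sub>R h x)"
      using set_integrable_continuous[of c d h] by (simp add: set_integrable_def)
    fix x
    show "indicator {c'..d'} x *\<^sub>R (e / 4 * ((poly v x)\<^sup>2 + (poly u x)\<^sup>2)) \<le> indicator {c..d} x *\<^sub>R h x"
    proof (cases "x \<in> {c..d}")
      case True
      have w: "sqrt (4 - (x - \<beta>)\<^sup>2) > 0" "sqrt (4 - (x - \<beta>)\<^sup>2) \<le> 2"
        using four_minus_square_pos[OF el(1)[OF True]] by (auto intro: real_le_lsqrt)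
      have q0: "block_form (x - \<beta>) (poly u x) (poly v x) \<ge> 0"
        using el(1)[OF True] by (intro block_form_nonneg) auto
      have h0: "h x \<ge> 0" unfolding h_def using q0 w by simp
      show ?thesis
      proof (cases "x \<in> {c'..d'}")
        case in': True
        have "e / 4 * ((poly v x)\<^sup>2 + (poly u x)\<^sup>2) = (e / 2 * ((poly u x)\<^sup>2 + (poly v x)\<^sup>2)) / 2" by simp
        also have "\<dots> \<le> block_form (x - \<beta>) (poly u x) (poly v x) / 2"
          using block_form_lower(2)[OF el(2)[OF in']] by (intro divide_right_mono) auto
        also have "\<dots> \<le> h x" unfolding h_def using w q0 by (intro divide_left_mono) auto
        finally show ?thesis using True in' by simp
      qed (use True h0 in simp)
    qed (use sub in auto)
  qed
  finally show ?thesis by (simp add: block_energy_def h_def)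
qed

text \<open>Cauchy--Schwarz in the coefficients with respect to the orthonormal p_i, followed by
  Parseval. Bounds along a sequence of m suffice, since any m exceeding the degree of P will do;
  they are available at block ends only.\<close>

lemma poly_integral_bound:
  assumes M: "real_distribution M" and sup: "AE x in M. \<bar>x\<bar> \<le> R"
    and row: "\<And>n. n \<ge> 1 \<Longrightarrow> integral\<^sup>L M (poly (jacobi_poly b n)) = (if n = 1 then 1 else 0)"
    and N: "\<And>n. \<exists>m>n. (\<Sum>i=1..m. (LINT x:{c..d}|lborel. poly (jacobi_poly b i) x)\<^sup>2) \<le> C"
  shows "(LINT x:{c..d}|lborel. poly P x)\<^sup>2 \<le> C * (\<integral>x. (poly P x)\<^sup>2 \<partial>M)"
proof -
  interpret real_distribution M by (rule M)
  obtain m where m: "m > degree P" "(\<Sum>i=1..m. (LINT x:{c..d}|lborel. poly (jacobi_poly b i) x)\<^sup>2) \<le> C"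
    using N by blast
  obtain a where a: "P = (\<Sum>i=1..m. smult (a i) (jacobi_poly b i))" using jacobi_poly_span[OF m(1)] by blast
  define p where "p = (\<lambda>i x. poly (jacobi_poly b i) x)"
  have P: "poly P x = (\<Sum>i=1..m. a i * p i x)" for x by (subst a) (simp add: poly_sum p_def)
  define I where "I = (\<lambda>i. LINT x:{c..d}|lborel. p i x)"
  have pint: "integrable M (\<lambda>x. p i x * p j x)" for i j
  proof -
    have "(\<lambda>x. p i x * p j x) = poly (jacobi_poly b i * jacobi_poly b j)" by (simp add: fun_eq_iff p_def)
    then show ?thesis using poly_integrable[OF sup] by metis
  qed
  have "(LINT x:{c..d}|lborel. poly P x) = (\<integral>x. (\<Sum>i=1..m. a i * (indicator {c..d} x *\<^sub>R p i x)) \<partial>lborel)"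
    unfolding set_lebesgue_integral_def P by (simp add: sum_distrib_left mult.left_commute)
  also have "\<dots> = (\<Sum>i=1..m. a i * I i)"
  proof -
    have "integrable lborel (\<lambda>x. indicator {c..d} x *\<^sub>R p i x)" for i
      using borel_integrable_atLeastAtMost'[of c d "p i"]
      by (simp add: set_integrable_def p_def continuous_intros)
    then show ?thesis
      by (subst Bochner_Integration.integral_sum) (auto simp: I_def set_lebesgue_integral_def)
  qed
  finally have "(LINT x:{c..d}|lborel. poly P x)\<^sup>2 = (\<Sum>i=1..m. a i * I i)\<^sup>2" by simp
  also have "\<dots> \<le> (\<Sum>i=1..m. (a i)\<^sup>2) * (\<Sum>i=1..m. (I i)\<^sup>2)" by (rule Cauchy_Schwarz_ineq_sum)
  also have "\<dots> \<le> (\<Sum>i=1..m. (a i)\<^sup>2) * C"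
    using m(2) by (intro mult_left_mono sum_nonneg) (auto simp: I_def p_def)
  also have "(\<Sum>i=1..m. (a i)\<^sup>2) = (\<integral>x. (poly P x)\<^sup>2 \<partial>M)"
  proof -
    have "(\<integral>x. (poly P x)\<^sup>2 \<partial>M) = (\<integral>x. (\<Sum>i=1..m. \<Sum>j=1..m. (a i * a j) * (p i x * p j x)) \<partial>M)"
      unfolding P power2_eq_square sum_product by (simp add: algebra_simps)
    also have "\<dots> = (\<Sum>i=1..m. \<Sum>j=1..m. (a i * a j) * (\<integral>x. p i x * p j x \<partial>M))"
      using pint by (simp add: Bochner_Integration.integral_sum Bochner_Integration.integrable_sum)
    also have "\<dots> = (\<Sum>i=1..m. \<Sum>j=1..m. if i = j then (a i)\<^sup>2 else 0)"
      using jacobi_poly_orthonormal[OF M sup row, of n m for n m]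
      by (intro sum.cong refl) (simp add: power2_eq_square p_def)
    also have "\<dots> = (\<Sum>i=1..m. (a i)\<^sup>2)" by simp
    finally show ?thesis by simp
  qed
  finally show ?thesis by (simp add: mult.commute)
qed

section \<open>Right limits and differences of the potential\<close>

text \<open>Vanishing differences make every right limit constant in n. Conversely, convergence of b
  along one sequence spreads to all shifts by induction in both directions.\<close>

lemma right_limits_slowly_varying:
  fixes b :: "nat \<Rightarrow> real"
  assumes b: "\<And>n. n \<ge> 1 \<Longrightarrow> \<bar>b n\<bar> \<le> lam"
    and diff: "(\<lambda>n. b (Suc n) - b n) \<longlonglongrightarrow> 0"
    and lim: "\<And>t. t \<in> {-lam..lam} \<Longrightarrow> \<exists>s. filterlim s at_top sequentially \<and> (\<lambda>j. b (s j)) \<longlonglongrightarrow> t"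
  shows "right_limits (\<lambda>_. 1) b = {const_jacobi 1 \<beta> | \<beta>. \<beta> \<in> {-lam..lam}}"
proof -
  have nat_top: "filterlim (\<lambda>j. nat (n + s j)) at_top sequentially" if "filterlim s at_top sequentially" for n s
    unfolding filterlim_at_top
  proof
    fix Z
    have "\<forall>\<^sub>F j in sequentially. int Z - n \<le> s j" using that by (simp add: filterlim_at_top)
    then show "\<forall>\<^sub>F j in sequentially. Z \<le> nat (n + s j)" by eventually_elim linarith
  qed
  have step: "(\<lambda>j. b (nat (n + 1 + s j)) - b (nat (n + s j))) \<longlonglongrightarrow> 0"
    if s: "filterlim s at_top sequentially" for n s
  proof (rule Lim_transform_eventually)
    show "(\<lambda>j. b (Suc (nat (n + s j))) - b (nat (n + s j))) \<longlonglongrightarrow> 0"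
      by (rule filterlim_compose[OF diff nat_top[OF s]])
    have "\<forall>\<^sub>F j in sequentially. - n \<le> s j" using s by (simp add: filterlim_at_top)
    then show "\<forall>\<^sub>F j in sequentially. b (Suc (nat (n + s j))) - b (nat (n + s j)) = b (nat (n + 1 + s j)) - b (nat (n + s j))"
      by eventually_elim (simp add: Suc_nat_eq_nat_zadd1 algebra_simps)
  qed
  show ?thesis
  proof (intro set_eqI iffI)
    fix J assume "J \<in> right_limits (\<lambda>_. 1) b"
    then obtain ar br s where J: "J = (ar, br)" and s: "filterlim s at_top sequentially"
      and la: "\<And>n. (\<lambda>j. 1) \<longlonglongrightarrow> ar n" and lb: "\<And>n. (\<lambda>j. b (nat (n + s j))) \<longlonglongrightarrow> br n"
      by (auto simp: right_limits_def)
    have ar: "ar n = 1" for n using la[of n] by (simp add: LIMSEQ_const_iff)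
    have next_eq: "br (n + 1) = br n" for n
      using LIMSEQ_unique[OF tendsto_diff[OF lb[of "n + 1"] lb[of n]] step[OF s, of n]] by simp
    have br: "br n = br 0" for n
    proof (induction n rule: int_induct[where k = 0])
      case (step1 i)
      then show ?case using next_eq[of i] by simp
    next
      case (step2 i)
      then show ?case using next_eq[of "i - 1"] by simp
    qed simp
    have "\<forall>\<^sub>F j in sequentially. 1 \<le> s j" using s by (simp add: filterlim_at_top)
    then have ev: "\<forall>\<^sub>F j in sequentially. b (nat (0 + s j)) \<in> {-lam..lam}"
    proof eventually_elim
      case (elim j)
      then have "\<bar>b (nat (s j))\<bar> \<le> lam" by (intro b) linarith
      then show ?case by (auto simp: abs_le_iff)
    qed
    have "br 0 \<in> {-lam..lam}"
      by (rule Lim_in_closed_set[OF closed_atLeastAtMost ev _ lb[of 0]]) simp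
    moreover have "J = const_jacobi 1 (br 0)" unfolding J const_jacobi_def using ar br by auto
    ultimately show "J \<in> {const_jacobi 1 \<beta> | \<beta>. \<beta> \<in> {-lam..lam}}" by blast
  next
    fix J assume "J \<in> {const_jacobi 1 \<beta> | \<beta>. \<beta> \<in> {-lam..lam}}"
    then obtain t where t: "t \<in> {-lam..lam}" "J = const_jacobi 1 t" by blast
    obtain s where s: "filterlim s at_top sequentially" "(\<lambda>j. b (s j)) \<longlonglongrightarrow> t" using lim[OF t(1)] by blast
    have si: "filterlim (\<lambda>j. int (s j)) at_top sequentially"
      by (rule filterlim_compose[OF filterlim_int_sequentially s(1)])
    have "(\<lambda>j. b (nat (n + int (s j)))) \<longlonglongrightarrow> t" for n
    proof (induction n rule: int_induct[where k = 0])
      case (step1 i)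
      then show ?case using tendsto_add[OF step1(2) step[OF si, of i]] by simp
    next
      case (step2 i)
      then show ?case using tendsto_diff[OF step2(2) step[OF si, of "i - 1"]] by simp
    qed (use s in simp)
    then show "J \<in> right_limits (\<lambda>_. 1) b"
      unfolding t(2) const_jacobi_def right_limits_def using si by (auto intro!: exI[of _ "\<lambda>j. int (s j)"])
  qed
qed

lemma summable_q_differences:
  fixes b D :: "nat \<Rightarrow> real"
  assumes D: "\<And>n. n \<ge> 1 \<Longrightarrow> b (Suc n) - b n = D n" and s: "summable (\<lambda>n. (D n)\<^sup>2)"
  shows "(\<lambda>n. \<bar>b (n + q) - b n\<bar>\<^sup>2) summable_on {1..}"
proof -
  have tele: "b (n + q) - b n = (\<Sum>i<q. D (n + i))" if "n \<ge> 1" for n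
  proof (induction q)
    case (Suc q)
    then show ?case using D[of "n + q"] that by simp
  qed simp
  have "summable (\<lambda>n. real q * (\<Sum>i<q. (D (n + i))\<^sup>2))"
    by (intro summable_mult summable_sum summable_ignore_initial_segment[OF s])
  then have "(\<lambda>n. real q * (\<Sum>i<q. (D (n + i))\<^sup>2)) summable_on UNIV"
    by (intro norm_summable_imp_summable_on) (simp add: sum_nonneg abs_mult)
  then have "(\<lambda>n. real q * (\<Sum>i<q. (D (n + i))\<^sup>2)) summable_on {1..}"
    by (rule summable_on_subset_banach) simp
  then show ?thesis
  proof (rule summable_on_comparison_test)
    fix n :: nat assume "n \<in> {1..}"
    then have "\<bar>b (n + q) - b n\<bar>\<^sup>2 = (\<Sum>i<q. 1 * D (n + i))\<^sup>2" using tele by simp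
    also have "\<dots> \<le> (\<Sum>i<q. 1\<^sup>2) * (\<Sum>i<q. (D (n + i))\<^sup>2)" by (rule Cauchy_Schwarz_ineq_sum)
    finally show "\<bar>b (n + q) - b n\<bar>\<^sup>2 \<le> real q * (\<Sum>i<q. (D (n + i))\<^sup>2)" by simp
  qed simp
qed

lemma eq_mod_null_iff_AE: "eq_mod_null S T \<longleftrightarrow> (AE x in lborel. x \<in> S \<longleftrightarrow> x \<in> T)"
proof -
  have "(S - T) \<union> (T - S) = {x. \<not> (x \<in> S \<longleftrightarrow> x \<in> T)}" by auto
  then show ?thesis
    by (simp add: eq_mod_null_def null_sets_completion_iff2 eventually_ae_filter)
qed

theorem theorem1p6:
  fixes lam :: real and q :: nat
  assumes "0 < lam" "lam < 2" "q > 1"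
  shows "\<exists>(a :: nat \<Rightarrow> real) (b :: nat \<Rightarrow> real) (S :: real set).
    (\<forall>n\<ge>1. a n = 1) \<and>
    bdd_above ((\<lambda>n. \<bar>b n\<bar>) ` {1..}) \<and>
    (\<lambda>n. \<bar>b (n + q) - b n\<bar>\<^sup>2) summable_on {1..} \<and>
    right_limits a b = {const_jacobi 1 \<beta> | \<beta>. \<beta> \<in> {-lam..lam}} \<and>
    is_Sigma_ac a b S \<and>
    \<not> eq_mod_null (\<Inter>J \<in> right_limits a b. q_int_spectrum q J) S \<and>
    eq_mod_null S (\<Inter>J \<in> right_limits a b. spectrum J)"
proof -
  define c d where "c = - 2 + lam" and "d = 2 - lam"
  obtain \<beta> \<epsilon> :: "nat \<Rightarrow> real" where eps: "\<And>k. \<epsilon> k > 0" and beta: "\<And>k. \<bar>\<beta> k\<bar> \<le> lam - \<epsilon> k"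
    and sq: "summable (\<lambda>k. ((\<beta> (Suc k) - \<beta> k) / \<epsilon> k)\<^sup>2)"
    and lim: "\<And>t. t \<in> {-lam..lam} \<Longrightarrow> \<exists>s. filterlim s at_top sequentially \<and> (\<lambda>j. \<beta> (s j)) \<longlonglongrightarrow> t"
    using slow_oscillation_exists[OF assms(1)] by blast
  define \<delta> where "\<delta> = (\<lambda>k. \<beta> (Suc k) - \<beta> k)"
  have el: "\<bar>x - \<beta> k\<bar> \<le> 2 - \<epsilon> k" if "x \<in> {c..d}" for k x
    using that beta[of k] unfolding c_def d_def atLeastAtMost_iff by linarith
  have blam: "\<bar>\<beta> k\<bar> \<le> lam" for k using beta[of k] eps[of k] by linarith
  obtain b N where N0: "N 0 = 0" and sm: "strict_mono N"
    and b: "\<And>k n. N k < n \<Longrightarrow> n \<le> N (Suc k) \<Longrightarrow> b n = \<beta> k"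
    and energy: "\<And>k. \<bar>\<delta> k\<bar> \<le> \<epsilon> k / 3 \<Longrightarrow>
      block_energy c d (\<beta> (Suc k)) (jacobi_poly b (N (Suc k))) (jacobi_poly b (Suc (N (Suc k))))
      \<le> (1 + 3 * (\<delta> k / \<epsilon> k)\<^sup>2)
          * block_energy c d (\<beta> k) (jacobi_poly b (N k)) (jacobi_poly b (Suc (N k))) + (1 / 2) ^ k"
    and small: "\<And>k. measure lborel {x \<in> {- real k..real k}. \<bar>x - \<beta> k\<bar> > 2 \<and>
      (poly (jacobi_poly b (Suc (N (Suc k)))) x)\<^sup>2 < 2 ^ k} \<le> (1 / 2) ^ k"
    \<comment> \<open>The errors 2^(-k) are summable, both for the energy and for Borel--Cantelli;
      the windows [-k, k] exhaust the line and the thresholds 2^k make Markov's bounds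
      summable.\<close>
    using block_potential_exists[of \<epsilon> c d \<beta> "\<lambda>k. (1 / 2) ^ k" real "\<lambda>k. 2 ^ k", OF eps el]
    unfolding \<delta>_def by auto
  have block: "\<exists>k. N k < n \<and> n \<le> N (Suc k)" if "n \<ge> 1" for n
  proof -
    define k where "k = (LEAST k. n \<le> N (Suc k))"
    have "n \<le> N (Suc n)" using seq_suble[OF sm, of "Suc n"] by simp
    then have k: "n \<le> N (Suc k)" unfolding k_def by (rule LeastI)
    have "N k < n"
    proof (cases k)
      case (Suc j)
      then have "\<not> n \<le> N (Suc j)" unfolding k_def by (intro not_less_Least) simp
      then show ?thesis using Suc by simp
    qed (use N0 that in simp)
    then show ?thesis using k by blast
  qed
  have babs: "\<bar>b n\<bar> \<le> lam" if n: "n \<ge> 1" for n using block[OF n] b blam by metis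
  have bN: "b (Suc (N k)) = \<beta> k" for k
    by (rule b) (use strict_monoD[OF sm, of k "Suc k"] in auto)
  \<comment> \<open>The index 0 carries no coefficient, so the difference there is replaced by
    0.\<close>
  define D where "D = (\<lambda>n. if n \<ge> 1 then b (Suc n) - b n else 0)"
  have sd: "summable (\<lambda>k. (\<delta> k)\<^sup>2)"
  proof (rule summable_comparison_test_ev)
    show "summable (\<lambda>k. lam\<^sup>2 * (\<delta> k / \<epsilon> k)\<^sup>2)" using sq by (simp add: \<delta>_def summable_mult)
    have "norm ((\<delta> k)\<^sup>2) \<le> lam\<^sup>2 * (\<delta> k / \<epsilon> k)\<^sup>2" for k
    proof -
      have "\<epsilon> k \<le> lam" using beta[of k] by linarith
      then have "(\<epsilon> k)\<^sup>2 \<le> lam\<^sup>2" using eps[of k] by (intro power_mono) auto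
      then have "(\<epsilon> k)\<^sup>2 * (\<delta> k / \<epsilon> k)\<^sup>2 \<le> lam\<^sup>2 * (\<delta> k / \<epsilon> k)\<^sup>2" by (rule mult_right_mono) simp
      then show ?thesis using eps[of k] by (simp add: power_divide)
    qed
    then show "\<forall>\<^sub>F k in sequentially. norm ((\<delta> k)\<^sup>2) \<le> lam\<^sup>2 * (\<delta> k / \<epsilon> k)\<^sup>2" by simp
  qed
  \<comment> \<open>\<open>D\<close> vanishes inside blocks and equals \<delta>_k at the last index
    of block k, so the long blocks cost nothing.\<close>
  have sD: "summable (\<lambda>n. (D n)\<^sup>2)"
  proof (rule summable_mono_reindex[THEN iffD1, of "\<lambda>k. N (Suc k)"])
    show smS: "strict_mono (\<lambda>k. N (Suc k))" using sm by (simp add: strict_mono_Suc_iff)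
    have "D (N (Suc k)) = \<delta> k" for k
    proof -
      have lt: "N k < N (Suc k)" using strict_monoD[OF sm, of k "Suc k"] by simp
      then show ?thesis using b[of k "N (Suc k)"] bN[of "Suc k"] by (simp add: D_def \<delta>_def)
    qed
    then show "summable (\<lambda>k. (D (N (Suc k)))\<^sup>2)" using sd by simp
    fix n assume n: "n \<notin> range (\<lambda>k. N (Suc k))"
    show "(D n)\<^sup>2 = 0"
    proof (cases "n \<ge> 1")
      case True
      obtain k where k: "N k < n" "n \<le> N (Suc k)" using block[OF True] by blast
      then have "n < N (Suc k)" using n by (auto simp: order.strict_iff_order)
      then show ?thesis using b[of k n] b[of k "Suc n"] k by (simp add: D_def)
    qed (simp add: D_def)
  qed
  have diff: "(\<lambda>n. b (Suc n) - b n) \<longlonglongrightarrow> 0"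
  proof (rule Lim_transform_eventually)
    have "(\<lambda>n. sqrt ((D n)\<^sup>2)) \<longlonglongrightarrow> sqrt 0" by (intro tendsto_intros summable_LIMSEQ_zero sD)
    then show "D \<longlonglongrightarrow> 0" by (simp add: tendsto_rabs_zero_iff)
    show "\<forall>\<^sub>F n in sequentially. D n = b (Suc n) - b n"
      by (rule eventually_mono[OF eventually_ge_at_top[of 1]]) (simp add: D_def)
  qed
  have RL: "right_limits (\<lambda>_. 1) b = {const_jacobi 1 \<beta> | \<beta>. \<beta> \<in> {-lam..lam}}"
  proof (rule right_limits_slowly_varying[OF babs diff])
    fix t assume "t \<in> {-lam..lam}"
    then obtain s where s: "filterlim s at_top sequentially" "(\<lambda>j. \<beta> (s j)) \<longlonglongrightarrow> t" using lim by blast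
    have "filterlim (\<lambda>j. Suc (N (s j))) at_top sequentially"
      by (rule filterlim_at_top_mono[OF s(1)]) (use seq_suble[OF sm] in \<open>auto intro!: always_eventually le_SucI\<close>)
    then show "\<exists>s. filterlim s at_top sequentially \<and> (\<lambda>j. b (s j)) \<longlonglongrightarrow> t"
      using s(2) by (intro exI[of _ "\<lambda>j. Suc (N (s j))"]) (simp add: bN)
  qed
  obtain M where M: "real_distribution M" and sup: "AE x in M. \<bar>x\<bar> \<le> 2 + lam"
    and row: "\<And>n. n \<ge> 1 \<Longrightarrow> integral\<^sup>L M (poly (jacobi_poly b n)) = (if n = 1 then 1 else 0)"
    using jacobi_spectral_measure_exists[of b lam, OF babs] by blast
  interpret M: real_distribution M by (rule M)
  obtain f Ms where dec: "is_lebesgue_decomposition M f Ms"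
    using lebesgue_decomposition_exists[OF M.finite_measure_axioms] by auto
  define S where "S = {x. f x > 0}"
  have spec: "is_spectral_measure (\<lambda>_. 1) b M" by (rule is_spectral_measureI[OF M sup row]) auto
  have Sac: "is_Sigma_ac (\<lambda>_. 1) b S" unfolding is_Sigma_ac_def S_def using spec dec by blast
  have zero: "AE x in lborel. \<bar>x\<bar> > 2 - lam \<longrightarrow> f x = 0"
  proof -
    have "AE x in lborel. (\<exists>\<^sub>F k in sequentially. \<bar>x - \<beta> k\<bar> > 2) \<longrightarrow> f x = 0"
    proof (rule density_vanishes[OF M dec _ _ small])
      fix k
      define p where "p = jacobi_poly b (Suc (N (Suc k)))"
      have "(\<lambda>x. (poly p x)\<^sup>2) = poly (p * p)" by (simp add: fun_eq_iff power2_eq_square)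
      then show "integrable M (\<lambda>x. (poly p x)\<^sup>2)" using M.poly_integrable[OF sup] by metis
      show "(\<integral>x. (poly p x)\<^sup>2 \<partial>M) \<le> 1"
        using jacobi_poly_orthonormal[OF M sup row, of "Suc (N (Suc k))" "Suc (N (Suc k))"]
        by (simp add: p_def power2_eq_square)
    qed
    moreover have "\<exists>\<^sub>F k in sequentially. \<bar>x - \<beta> k\<bar> > 2" if x: "\<bar>x\<bar> > 2 - lam" for x
    proof -
      \<comment> \<open>The end of [-lam, lam] farther from x: the distance is |x| + lam > 2, and
        \<beta> comes near it infinitely often.\<close>
      define t where "t = (if x > 0 then - lam else lam)"
      have t: "t \<in> {-lam..lam}" "\<bar>x - t\<bar> > 2" using x assms by (auto simp: t_def)
      obtain s where s: "filterlim s at_top sequentially" "(\<lambda>j. \<beta> (s j)) \<longlonglongrightarrow> t" using lim[OF t(1)] by blast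
      have "(\<lambda>j. \<bar>x - \<beta> (s j)\<bar>) \<longlonglongrightarrow> \<bar>x - t\<bar>" by (intro tendsto_intros s)
      then have "\<forall>\<^sub>F j in sequentially. \<bar>x - \<beta> (s j)\<bar> > 2" using t(2) by (rule order_tendstoD)
      then have "\<exists>\<^sub>F j in sequentially. \<bar>x - \<beta> (s j)\<bar> > 2" by (intro eventually_frequently) auto
      then show ?thesis
        using filterlim_iff[THEN iffD1, OF s(1), rule_format, of "\<lambda>k. \<not> \<bar>x - \<beta> k\<bar> > 2"]
        unfolding frequently_def by blast
    qed
    ultimately show ?thesis by (auto elim: eventually_mono)
  qed
  define V where "V = (\<lambda>k. block_energy c d (\<beta> k) (jacobi_poly b (N k)) (jacobi_poly b (Suc (N k))))"
  have el2: "\<bar>x - \<beta> k\<bar> < 2" if "x \<in> {c..d}" for k x using el[OF that, of k] eps[of k] by linarith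
  \<comment> \<open>The energy inequality holds once |\<delta>_k| \<le> \<epsilon>_k / 3, hence from
    some k0 on because \<delta>_k / \<epsilon>_k tends to 0.\<close>
  obtain k0 C where VC: "\<And>k. k \<ge> k0 \<Longrightarrow> V k \<le> C"
  proof -
    have "(\<lambda>k. (\<delta> k / \<epsilon> k)\<^sup>2) \<longlonglongrightarrow> 0" using sq unfolding \<delta>_def by (rule summable_LIMSEQ_zero)
    then have "\<forall>\<^sub>F k in sequentially. (\<delta> k / \<epsilon> k)\<^sup>2 < (1 / 3)\<^sup>2" by (rule order_tendstoD) simp
    then obtain k0 where k0: "\<And>k. k \<ge> k0 \<Longrightarrow> (\<delta> k / \<epsilon> k)\<^sup>2 < (1 / 3)\<^sup>2" unfolding eventually_sequentially by blast
    have d3: "\<bar>\<delta> k\<bar> \<le> \<epsilon> k / 3" if "k \<ge> k0" for k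
    proof -
      have "\<bar>\<delta> k / \<epsilon> k\<bar>\<^sup>2 < (1 / 3)\<^sup>2" using k0[OF that] by (simp only: power2_abs)
      then have "\<bar>\<delta> k / \<epsilon> k\<bar> < 1 / 3" by (rule power2_less_imp_less) simp
      then show ?thesis using eps[of k] by (simp add: abs_divide field_simps)
    qed
    have "\<exists>C. \<forall>k. V (k + k0) \<le> C"
    proof (rule discrete_gronwall)
      show "V (Suc k + k0) \<le> (1 + 3 * (\<delta> (k + k0) / \<epsilon> (k + k0))\<^sup>2) * V (k + k0) + (1 / 2) ^ (k + k0)" for k
        using energy[OF d3[of "k + k0"]] by (simp add: V_def)
      have "block_form (x - \<beta> k0) (poly u x) (poly v x) / sqrt (4 - (x - \<beta> k0)\<^sup>2) \<ge> 0" if "x \<in> {c..d}" for x u v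
        using el2[OF that, of k0] four_minus_square_pos[OF el2[OF that, of k0]] by (auto intro!: divide_nonneg_nonneg block_form_nonneg)
      then show "V (0 + k0) \<ge> 0"
        unfolding V_def block_energy_def set_lebesgue_integral_def
        by (intro integral_nonneg_AE AE_I2) (auto simp: indicator_def)
      show "summable (\<lambda>k. 3 * (\<delta> (k + k0) / \<epsilon> (k + k0))\<^sup>2)"
        using sq unfolding \<delta>_def by (intro summable_mult summable_ignore_initial_segment)
      show "summable (\<lambda>k. (1 / 2 :: real) ^ (k + k0))"
        by (intro summable_ignore_initial_segment summable_geometric) simp
    qed auto
    then obtain C where "\<And>k. V (k + k0) \<le> C" by blast
    then have "V k \<le> C" if "k \<ge> k0" for k using that by (metis le_add_diff_inverse2)
    then show ?thesis by (rule that)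
  qed
  \<comment> \<open>At distance e = 1 / (j + 1) from the ends of K the form is bounded below
    uniformly in k, as |\<beta>_k| \<le> lam. The constant blows up with j, but positivity almost
    everywhere survives the countable union.\<close>
  have posj: "AE x in lborel. x \<in> {c + 1 / real (Suc j)..d - 1 / real (Suc j)} \<longrightarrow> f x > 0" for j
  proof (rule density_positive[OF M sup dec], rule poly_integral_bound[OF M sup row])
    define e where "e = 1 / real (Suc j)"
    have e: "e > 0" by (simp add: e_def)
    fix n
    define k where "k = max k0 (Suc n)"
    have Nk: "N k > n" using seq_suble[OF sm, of k] by (simp add: k_def)
    have "(\<Sum>i=1..N k. (LINT x:{c + e..d - e}|lborel. poly (jacobi_poly b i) x)\<^sup>2)
      \<le> 3 * pi * ((LINT x:{c + e..d - e}|lborel. (poly (jacobi_poly b (Suc (N k))) x)\<^sup>2)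
      + (LINT x:{c + e..d - e}|lborel. (poly (jacobi_poly b (N k)) x)\<^sup>2))" (is "_ \<le> 3 * pi * ?E")
      by (rule jacobi_poly_integrals_bound) (use assms e in \<open>auto simp: c_def d_def\<close>)
    also have "\<dots> \<le> 3 * pi * (4 / e * C)"
    proof (intro mult_left_mono)
      have "e / 4 * ?E \<le> V k"
        unfolding V_def
      proof (rule block_energy_lower[OF _ _ e])
        show "\<bar>x - \<beta> k\<bar> \<le> 2 - e" if "x \<in> {c + e..d - e}" for x
          using that blam[of k] unfolding c_def d_def atLeastAtMost_iff by linarith
      qed (use e el2 in auto)
      also have "\<dots> \<le> C" by (rule VC) (simp add: k_def)
      finally show "?E \<le> 4 / e * C" using e by (simp add: field_simps)
    qed simp
    finally show "\<exists>m>n. (\<Sum>i=1..m. (LINT x:{c + 1 / real (Suc j)..d - 1 / real (Suc j)}|lborel. poly (jacobi_poly b i) x)\<^sup>2)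
        \<le> 3 * pi * (4 / (1 / real (Suc j)) * C)"
      using Nk unfolding e_def by blast
  qed
  have pos: "AE x in lborel. x \<in> {c<..<d} \<longrightarrow> f x > 0"
  proof -
    have "AE x in lborel. \<forall>j. x \<in> {c + 1 / real (Suc j)..d - 1 / real (Suc j)} \<longrightarrow> f x > 0"
      unfolding AE_all_countable using posj by blast
    then show ?thesis
    proof eventually_elim
      case (elim x)
      show ?case
      proof
        assume x: "x \<in> {c<..<d}"
        then have "min (x - c) (d - x) > 0" by simp
        then obtain j where "inverse (real (Suc j)) < min (x - c) (d - x)" using reals_Archimedean by blast
        then have "x \<in> {c + 1 / real (Suc j)..d - 1 / real (Suc j)}" by (auto simp: inverse_eq_divide)
        then show "f x > 0" using elim by blast
      qed
    qed
  qed
  have specI: "(\<Inter>J \<in> right_limits (\<lambda>_. 1) b. spectrum J) = {c..d}"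
  proof -
    have "(\<Inter>J \<in> right_limits (\<lambda>_. 1) b. spectrum J) = (\<Inter>\<beta>\<in>{-lam..lam}. {\<beta> - 2..\<beta> + 2})"
    proof -
      have "{const_jacobi 1 \<beta> | \<beta>. \<beta> \<in> {-lam..lam}} = const_jacobi 1 ` {-lam..lam}" by blast
      then show ?thesis unfolding RL by (simp add: spectrum_const_jacobi)
    qed
    also have "\<dots> = {c..d}"
    proof (intro set_eqI iffI)
      fix x assume x: "x \<in> (\<Inter>\<beta>\<in>{-lam..lam}. {\<beta> - 2..\<beta> + 2})"
      have "lam \<in> {-lam..lam}" "- lam \<in> {-lam..lam}" using assms by auto
      from INT_D[OF x this(1)] INT_D[OF x this(2)] show "x \<in> {c..d}" by (auto simp: c_def d_def)
    qed (auto simp: c_def d_def)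
    finally show ?thesis .
  qed
  have eq: "eq_mod_null S (\<Inter>J \<in> right_limits (\<lambda>_. 1) b. spectrum J)"
    unfolding specI eq_mod_null_iff_AE
    using zero pos AE_lborel_singleton[of c] AE_lborel_singleton[of d]
    by eventually_elim (auto simp: S_def c_def d_def abs_if not_less split: if_splits)
  have neq: "\<not> eq_mod_null (\<Inter>J \<in> right_limits (\<lambda>_. 1) b. q_int_spectrum q J) S"
  proof
    assume "eq_mod_null (\<Inter>J \<in> right_limits (\<lambda>_. 1) b. q_int_spectrum q J) S"
    then have ae: "AE x in lborel. x \<in> (\<Inter>J \<in> right_limits (\<lambda>_. 1) b. q_int_spectrum q J) \<longleftrightarrow> x \<in> S"
      unfolding eq_mod_null_iff_AE .
    define \<theta> where "\<theta> = pi / real q"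
    define z where "z = 2 * cos \<theta>"
    have "pi / real q \<le> pi / 2" using assms(3) by (intro divide_left_mono) auto
    then have th: "0 < \<theta>" "\<theta> \<le> pi / 2" using assms(3) by (auto simp: \<theta>_def)
    have sth: "sin \<theta> \<noteq> 0" using sin_gt_zero[of \<theta>] th pi_gt_zero by simp
    have "cos \<theta> < 1" using cos_monotone_0_pi[of 0 \<theta>] th pi_gt_zero by simp
    then have z: "0 \<le> z" "z < 2" using th by (auto simp: z_def cos_ge_zero)
    \<comment> \<open>Since q > 1 gives 0 \<le> z < 2, the interval of radius lam about z meets (c,
      d) in a nonempty open interval. For x in it, \<beta> = x - z is an admissible constant at
      which the discriminant is 2 cos \<pi> = -2.\<close>
    define l r where "l = max (z - lam) c" and "r = min (z + lam) d"
    have lr: "l < r" using z assms by (auto simp: l_def r_def c_def d_def)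
    have out: "x \<notin> (\<Inter>J \<in> right_limits (\<lambda>_. 1) b. q_int_spectrum q J)" if x: "x \<in> {l<..<r}" for x
    proof -
      have "discriminant q (const_jacobi 1 (x - z)) x = 2 * cos (real q * \<theta>)"
        using discriminant_const_jacobi[OF sth, of q "x - z"] by (simp add: z_def)
      then have "x \<notin> q_int_spectrum q (const_jacobi 1 (x - z))"
        using assms(3) by (simp add: q_int_spectrum_def \<theta>_def)
      moreover have "x - z \<in> {-lam..lam}" using x by (auto simp: l_def r_def)
      ultimately show ?thesis unfolding RL by blast
    qed
    have "AE x in lborel. x \<notin> {l<..<r}"
      using ae pos
    proof eventually_elim
      case (elim x)
      then show ?case using out[of x] by (auto simp: S_def l_def r_def)
    qed
    then have "emeasure lborel {l<..<r} = 0"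
      by (subst (asm) AE_iff_measurable[of "{l<..<r}"]) auto
    then show False using lr by simp
  qed
  have "bdd_above ((\<lambda>n. \<bar>b n\<bar>) ` {1..})" by (rule bdd_aboveI2[of _ _ lam]) (simp add: babs)
  moreover have "(\<lambda>n. \<bar>b (n + q) - b n\<bar>\<^sup>2) summable_on {1..}"
    by (rule summable_q_differences[OF _ sD]) (simp add: D_def)
  ultimately show ?thesis
    using RL Sac neq eq by (intro exI[of _ "\<lambda>_. 1"] exI[of _ b] exI[of _ S]) simp
qed

end
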